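(* Let $k\ge 1$, $i\in\{0,1\}$, $0\le j\le k$, and let $L_{i,1}\otimes L_{j,k}=\bigoplus_{l=0}^{k+1}N_l\otimes L_{l,k+1}$ and $L_{(1^N(j+1)),k+1}=\bigoplus_{l=0}^{k+1}N_{l,(1^N(j+1))}\otimes L_{l,k+1}$ be the decompositions into irreducible $\widehat{\mathfrak{sl}}_2$-modules. Then for every $0\le l\le k+1$ $$\mathrm{ch}_q\,N_l=\lim_{n\to\infty}\mathrm{ch}_q\,N_{l,(1^{2n+i-1}(j+1))}.$$
   Context: Let $e,h,f$ be the standard basis of $\mathfrak{sl}_2$, $x_i=x\otimes t^i$; $\widehat{\mathfrak{sl}}_2=\mathfrak{sl}_2\otimes\mathbb C[t,t^{-1}]\oplus\mathbb CK\oplus\mathbb Cd$, $K$ central, $[d,x_i]=-ix_i$. $L_{l,k}$ ($0\le l\le k$) is the irreducible integrable level $k$ module with highest weight vector $v_{l,k}$, $h_0v_{l,k}=lv_{l,k}$, $dv_{l,k}=0$. For $\kappa\ge1$ and $\mathbf m\in\mathbb Z_{\ge0}^\kappa$, $L_{\mathbf m,\kappa}=L_{(1^{m_1}\cdots\kappa^{m_\kappa}),\kappa}$ is the integrable level $\kappa$ module obtained as the inductive limit of $\mathfrak{sl}_2\otimes\mathbb C[t]$-module embeddings $V_{(m_1,\ldots,m_\kappa)}\hookrightarrow V_{(m_1,\ldots,m_\kappa+2)}\hookrightarrow\cdots$, where $V_{\mathbf m}$ is the fusion product of $m_a$ copies of the $(a+1)$-dimensional irreducible $\mathfrak{sl}_2$-module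 $\pi_a$, $a=1,\ldots,\kappa$ (the associated graded $\mathfrak{sl}_2\otimes\mathbb C[t]$-module of the tensor product of evaluation modules at pairwise distinct points, filtered by $t$-degree from the tensor product of lowest weight vectors). Explicitly: let $v(p)\in L_{0,1}\oplus L_{1,1}$ ($p\in\mathbb Z$) be the extremal vectors, $h_0v(p)=-pv(p)$, and $M_a=m_a+\cdots+m_\kappa$; then $L_{\mathbf m,\kappa}\simeq U(\widehat{\mathfrak{sl}}_2)\cdot(v(M_1)\otimes\cdots\otimes v(M_\kappa))$ inside a tensor product of $\kappa$ level one modules, and $d$ on $L_{\mathbf m,\kappa}$ is the restriction of $d$ on this tensor product (with $dv_{0,1}=dv_{1,1}=0$). $(1^N(j+1))$ denotes the tuple in $\mathbb Z_{\ge0}^{k+1}$ corresponding to $N$ copies of $\pi_1$ and one copy of $\pi_{j+1}$. $N_l$ (resp. $N_{l,(1^N(j+1))}$) is the space of highest weight vectors (killed by $e_0$ and all $x_r$, $r>0$) of $h_0$-weight $l$ in $L_{i,1}\otimes L_{j,k}$ (resp. in $L_{(1^N(j+1)),k+1}$), and $\mathrm{ch}_q N=\sum_sq^s\dim\{v\in N:dv=sv\}$, where $d$ acts on $L_{i,1}\otimes L_{j,k}$ with $d(v_{i,1}\otimes v_{j,k})=0$. The limit is coefficientwise. *)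

theory Defs
  imports Complex_Main "HOL-Library.Poly_Mapping"
begin

section \<open>Complex vector spaces\<close>

class complex_vector = ab_group_add +
  fixes scaleC :: "complex \<Rightarrow> 'a \<Rightarrow> 'a"  (infixr "*\<^sub>C" 75)
  assumes scaleC_add_right: "a *\<^sub>C (x + y) = a *\<^sub>C x + a *\<^sub>C y"
    and scaleC_add_left: "(a + b) *\<^sub>C x = a *\<^sub>C x + b *\<^sub>C x"
    and scaleC_scaleC: "a *\<^sub>C b *\<^sub>C x = (a * b) *\<^sub>C x"
    and scaleC_one: "1 *\<^sub>C x = x"

interpretation complex_vector: vector_space "scaleC :: complex \<Rightarrow> 'a \<Rightarrow> 'a::complex_vector"
  by unfold_locales (fact scaleC_add_right scaleC_add_left scaleC_scaleC scaleC_one)+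

abbreviation clinear :: "('a::complex_vector \<Rightarrow> 'b::complex_vector) \<Rightarrow> bool" where
  "clinear \<equiv> Vector_Spaces.linear scaleC scaleC"

instantiation poly_mapping :: (type, complex_vector) complex_vector
begin

lift_definition scaleC_poly_mapping :: "complex \<Rightarrow> ('a \<Rightarrow>\<^sub>0 'b) \<Rightarrow> 'a \<Rightarrow>\<^sub>0 'b"
  is "\<lambda>c f x. c *\<^sub>C f x"
  by (erule rev_finite_subset) auto

instance
proof
  fix a b :: complex and x y :: "'a \<Rightarrow>\<^sub>0 'b"
  show "a *\<^sub>C (x + y) = a *\<^sub>C x + a *\<^sub>C y" by transfer (simp add: scaleC_add_right)
  show "(a + b) *\<^sub>C x = a *\<^sub>C x + b *\<^sub>C x" by transfer (simp add: scaleC_add_left)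
  show "a *\<^sub>C b *\<^sub>C x = (a * b) *\<^sub>C x" by transfer (simp add: scaleC_scaleC)
  show "1 *\<^sub>C x = x" by transfer (simp add: scaleC_one)
qed

end

instantiation complex :: complex_vector
begin

definition scaleC_complex :: "complex \<Rightarrow> complex \<Rightarrow> complex" where
  "scaleC_complex = (*)"

instance
  by standard (simp_all add: scaleC_complex_def algebra_simps)

end


section \<open>Tensor powers\<close>

text \<open>
  The type \<open>'v tensor\<close> is the direct sum of all tensor powers of \<open>'v\<close>: the free vector space on
  lists over \<open>'v\<close>, modulo multilinearity in the entries. The \<open>n\<close>-th tensor power is the
  subspace \<open>tensor_power n\<close> spanned by the pure tensors of length \<open>n\<close>.
\<close>

definition tensor_relations :: "('v::complex_vector list \<Rightarrow>\<^sub>0 complex) set" where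
  "tensor_relations = complex_vector.span
     ({Poly_Mapping.single (us @ (x + y) # ws) 1
         - Poly_Mapping.single (us @ x # ws) 1 - Poly_Mapping.single (us @ y # ws) 1
       | us x y ws. True}
      \<union> {Poly_Mapping.single (us @ (c *\<^sub>C x) # ws) 1 - c *\<^sub>C Poly_Mapping.single (us @ x # ws) 1
       | us c x ws. True})"

definition tensor_eq ::
    "('v::complex_vector list \<Rightarrow>\<^sub>0 complex) \<Rightarrow> ('v list \<Rightarrow>\<^sub>0 complex) \<Rightarrow> bool" where
  "tensor_eq f g \<longleftrightarrow> f - g \<in> tensor_relations"

lemma subspace_tensor_relations: "complex_vector.subspace tensor_relations"
  by (simp add: tensor_relations_def complex_vector.subspace_span)

quotient_type (overloaded) 'v tensor = "'v::complex_vector list \<Rightarrow>\<^sub>0 complex" / tensor_eq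
  morphisms rep_tensor abs_tensor
proof (rule equivpI)
  note S = subspace_tensor_relations
  show "reflp (tensor_eq :: ('v list \<Rightarrow>\<^sub>0 complex) \<Rightarrow> _)"
    by (rule reflpI) (simp add: tensor_eq_def complex_vector.subspace_0 [OF S])
  show "symp (tensor_eq :: ('v list \<Rightarrow>\<^sub>0 complex) \<Rightarrow> _)"
  proof (rule sympI)
    fix f g :: "'v list \<Rightarrow>\<^sub>0 complex"
    assume "tensor_eq f g"
    then have "- (f - g) \<in> tensor_relations"
      unfolding tensor_eq_def by (rule complex_vector.subspace_neg [OF S])
    then show "tensor_eq g f" by (simp add: tensor_eq_def)
  qed
  show "transp (tensor_eq :: ('v list \<Rightarrow>\<^sub>0 complex) \<Rightarrow> _)"
  proof (rule transpI)
    fix f g h :: "'v list \<Rightarrow>\<^sub>0 complex"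
    assume "tensor_eq f g" and "tensor_eq g h"
    then have "(f - g) + (g - h) \<in> tensor_relations"
      unfolding tensor_eq_def by (rule complex_vector.subspace_add [OF S])
    then show "tensor_eq f h" by (simp add: tensor_eq_def)
  qed
qed

instantiation tensor :: (complex_vector) complex_vector
begin

lift_definition zero_tensor :: "'a tensor" is 0 .

lift_definition plus_tensor :: "'a tensor \<Rightarrow> 'a tensor \<Rightarrow> 'a tensor" is "(+)"
  unfolding tensor_eq_def
  by (subst add_diff_add) (rule complex_vector.subspace_add [OF subspace_tensor_relations])

lift_definition uminus_tensor :: "'a tensor \<Rightarrow> 'a tensor" is uminus
  unfolding tensor_eq_def
  by (subst minus_diff_minus) (rule complex_vector.subspace_neg [OF subspace_tensor_relations])

definition minus_tensor :: "'a tensor \<Rightarrow> 'a tensor \<Rightarrow> 'a tensor" where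
  "minus_tensor a b = a + - b"

lift_definition scaleC_tensor :: "complex \<Rightarrow> 'a tensor \<Rightarrow> 'a tensor" is scaleC
  unfolding tensor_eq_def
  by (subst complex_vector.scale_right_diff_distrib [symmetric])
    (rule complex_vector.subspace_scale [OF subspace_tensor_relations])

instance
proof
  fix a b c :: "'a tensor" and r s :: complex
  note [simp] = tensor_eq_def complex_vector.subspace_0 [OF subspace_tensor_relations]
  show "a + b + c = a + (b + c)" by transfer (simp add: add.assoc)
  show "a + b = b + a" by transfer (simp add: add.commute)
  show "0 + a = a" by transfer simp
  show "- a + a = 0" by transfer simp
  show "a - b = a + - b" by (rule minus_tensor_def)
  show "r *\<^sub>C (a + b) = r *\<^sub>C a + r *\<^sub>C b" by transfer (simp add: scaleC_add_right)
  show "(r + s) *\<^sub>C a = r *\<^sub>C a + s *\<^sub>C a" by transfer (simp add: scaleC_add_left)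
  show "r *\<^sub>C s *\<^sub>C a = (r * s) *\<^sub>C a" by transfer (simp add: scaleC_scaleC)
  show "1 *\<^sub>C a = a" by transfer (simp add: scaleC_one)
qed

end

lift_definition pure :: "'v::complex_vector list \<Rightarrow> 'v tensor"
  is "\<lambda>vs. Poly_Mapping.single vs 1" .

definition tensor_power :: "nat \<Rightarrow> 'v::complex_vector tensor set" where
  "tensor_power n = complex_vector.span (pure ` {vs. length vs = n})"

definition multilinear :: "('v::complex_vector list \<Rightarrow> 'w::complex_vector) \<Rightarrow> bool" where
  "multilinear \<phi> \<longleftrightarrow> (\<forall>us ws. clinear (\<lambda>x. \<phi> (us @ x # ws)))"

text \<open>
  The value below is independent of the chosen representative as soon as \<open>\<phi>\<close> is multilinear
  (lemma \<open>tensor_lift\<close>); it is only used for such \<open>\<phi>\<close>.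
\<close>

definition tensor_lift ::
    "('v::complex_vector list \<Rightarrow> 'w::complex_vector) \<Rightarrow> 'v tensor \<Rightarrow> 'w" where
  "tensor_lift \<phi> t =
     (\<Sum>vs\<in>Poly_Mapping.keys (rep_tensor t). Poly_Mapping.lookup (rep_tensor t) vs *\<^sub>C \<phi> vs)"

lemma multilinear_pure: "multilinear (pure :: 'v::complex_vector list \<Rightarrow> 'v tensor)"
proof -
  have "clinear (\<lambda>x. pure (us @ x # ws) :: 'v tensor)" for us ws :: "'v list"
  proof (rule Vector_Spaces.linear.intro, unfold_locales)
    fix x y :: 'v and c :: complex
    let ?s = "\<lambda>vs. Poly_Mapping.single vs (1::complex)"
    have "?s (us @ (x + y) # ws) - ?s (us @ x # ws) - ?s (us @ y # ws) \<in> tensor_relations"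
      unfolding tensor_relations_def
      by (intro complex_vector.span_base UnI1 CollectI exI conjI) (rule refl TrueI)+
    then show "pure (us @ (x + y) # ws) = pure (us @ x # ws) + pure (us @ y # ws)"
      by (simp only: pure.abs_eq plus_tensor.abs_eq tensor.abs_eq_iff tensor_eq_def diff_diff_eq)
    have "?s (us @ (c *\<^sub>C x) # ws) - c *\<^sub>C ?s (us @ x # ws) \<in> tensor_relations"
      unfolding tensor_relations_def
      by (intro complex_vector.span_base UnI2 CollectI exI conjI) (rule refl TrueI)+
    then show "pure (us @ (c *\<^sub>C x) # ws) = c *\<^sub>C pure (us @ x # ws)"
      by (simp only: pure.abs_eq scaleC_tensor.abs_eq tensor.abs_eq_iff tensor_eq_def)
  qed
  then show ?thesis by (simp add: multilinear_def)
qed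

lemma tensor_lift:
  fixes \<phi> :: "'v::complex_vector list \<Rightarrow> 'w::complex_vector"
  assumes "multilinear \<phi>"
  shows "clinear (tensor_lift \<phi>)" and "tensor_lift \<phi> (pure vs) = \<phi> vs"
proof -
  define ext where "ext f = (\<Sum>vs\<in>Poly_Mapping.keys f. Poly_Mapping.lookup f vs *\<^sub>C \<phi> vs)"
    for f :: "'v list \<Rightarrow>\<^sub>0 complex"
  have ext_sup: "ext f = (\<Sum>vs\<in>A. Poly_Mapping.lookup f vs *\<^sub>C \<phi> vs)"
    if "finite A" "Poly_Mapping.keys f \<subseteq> A" for f A
    unfolding ext_def using that
    by (intro sum.mono_neutral_left) (auto simp: in_keys_iff)
  have ext_add: "ext (f + g) = ext f + ext g" for f g
  proof -
    let ?A = "Poly_Mapping.keys f \<union> Poly_Mapping.keys g"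
    have "ext (f + g) = (\<Sum>vs\<in>?A. Poly_Mapping.lookup (f + g) vs *\<^sub>C \<phi> vs)"
      by (rule ext_sup) (simp_all add: Poly_Mapping.keys_add)
    also have "\<dots> = ext f + ext g"
      by (simp add: ext_sup [of ?A f] ext_sup [of ?A g] lookup_add scaleC_add_left sum.distrib)
    finally show ?thesis .
  qed
  have ext_scale: "ext (c *\<^sub>C f) = c *\<^sub>C ext f" for c f
  proof -
    have lk: "Poly_Mapping.lookup (c *\<^sub>C f) vs = c * Poly_Mapping.lookup f vs" for vs
      by transfer (simp add: scaleC_complex_def)
    have "ext (c *\<^sub>C f) =
        (\<Sum>vs\<in>Poly_Mapping.keys f. Poly_Mapping.lookup (c *\<^sub>C f) vs *\<^sub>C \<phi> vs)"
      by (rule ext_sup) (auto simp: in_keys_iff lk)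
    also have "\<dots> = c *\<^sub>C ext f"
      by (simp add: ext_def lk complex_vector.scale_sum_right scaleC_scaleC)
    finally show ?thesis .
  qed
  have lin: "clinear ext"
    by (rule Vector_Spaces.linear.intro, unfold_locales) (fact ext_add ext_scale)+
  have ext_single: "ext (Poly_Mapping.single vs 1) = \<phi> vs" for vs
    by (simp add: ext_def scaleC_one)
  have "ext f = 0" if "f \<in> tensor_relations" for f
  proof -
    have lin_\<phi>: "clinear (\<lambda>x. \<phi> (us @ x # ws))" for us ws
      using assms by (simp add: multilinear_def)
    note simps = module_hom.diff [OF lin [unfolded linear_iff_module_hom]] ext_scale ext_single
      module_hom.add [OF lin_\<phi> [unfolded linear_iff_module_hom]]
      module_hom.scale [OF lin_\<phi> [unfolded linear_iff_module_hom]]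
    have "complex_vector.subspace {f. ext f = 0}"
      using module_hom.subspace_kernel [OF lin [unfolded linear_iff_module_hom]] by simp
    with that show ?thesis
      unfolding tensor_relations_def
      by (rule complex_vector.span_induct [where P = "\<lambda>f. ext f = 0"])
        (auto simp: simps)
  qed
  then have eq: "ext f = ext g" if "tensor_eq f g" for f g
    using that module_hom.diff [OF lin [unfolded linear_iff_module_hom], of f g]
    by (simp add: tensor_eq_def)
  have lift_abs: "tensor_lift \<phi> (abs_tensor f) = ext f" for f
  proof -
    have "tensor_eq (rep_tensor (abs_tensor f)) f"
      by (rule Quotient3_rep_abs [OF Quotient3_tensor])
        (simp add: tensor_eq_def complex_vector.subspace_0 [OF subspace_tensor_relations])
    then show ?thesis using eq by (simp add: tensor_lift_def ext_def)
  qed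
  show "tensor_lift \<phi> (pure vs) = \<phi> vs"
    by (simp add: pure.abs_eq lift_abs ext_single)
  show "clinear (tensor_lift \<phi>)"
  proof (rule Vector_Spaces.linear.intro, unfold_locales)
    fix s t :: "'v tensor" and c :: complex
    obtain f g where "s = abs_tensor f" "t = abs_tensor g"
      by (metis Quotient3_abs_rep [OF Quotient3_tensor])
    then show "tensor_lift \<phi> (s + t) = tensor_lift \<phi> s + tensor_lift \<phi> t"
      and "tensor_lift \<phi> (c *\<^sub>C s) = c *\<^sub>C tensor_lift \<phi> s"
      by (simp_all add: plus_tensor.abs_eq scaleC_tensor.abs_eq lift_abs ext_add ext_scale)
  qed
qed


section \<open>The affine Lie algebra and its modules\<close>

text \<open>The basis \<open>e\<^sub>n, h\<^sub>n, f\<^sub>n\<close> (\<open>n \<in> \<int>\<close>), \<open>K\<close>, \<open>d\<close> of the affine Lie algebra.\<close>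

datatype affine_sl2 = E int | H int | F int | K | D

text \<open>
  A representation is given by the operators of the basis elements. The relations are
  \<open>[x\<^sub>m, y\<^sub>n] = [x, y]\<^sub>m\<^sub>+\<^sub>n + m \<delta> tr(xy) K\<close> (with \<open>\<delta> = 1\<close> if \<open>m + n = 0\<close> and \<open>\<delta> = 0\<close> otherwise),
  \<open>[d, x\<^sub>n] = - n x\<^sub>n\<close>, and \<open>K\<close> is central.
\<close>

type_synonym 'v rep = "affine_sl2 \<Rightarrow> 'v \<Rightarrow> 'v"

definition commutator :: "'v::complex_vector rep \<Rightarrow> affine_sl2 \<Rightarrow> affine_sl2 \<Rightarrow> 'v \<Rightarrow> 'v" where
  "commutator \<rho> x y v = \<rho> x (\<rho> y v) - \<rho> y (\<rho> x v)"

locale affine_sl2_rep =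
  fixes \<rho> :: "'v::complex_vector rep"
  assumes clinear_rep: "clinear (\<rho> x)"
    and E_E: "commutator \<rho> (E m) (E n) v = 0"
    and F_F: "commutator \<rho> (F m) (F n) v = 0"
    and H_H: "commutator \<rho> (H m) (H n) v = (if m + n = 0 then (2 * of_int m) *\<^sub>C \<rho> K v else 0)"
    and H_E: "commutator \<rho> (H m) (E n) v = 2 *\<^sub>C \<rho> (E (m + n)) v"
    and H_F: "commutator \<rho> (H m) (F n) v = - 2 *\<^sub>C \<rho> (F (m + n)) v"
    and E_F: "commutator \<rho> (E m) (F n) v =
                \<rho> (H (m + n)) v + (if m + n = 0 then of_int m *\<^sub>C \<rho> K v else 0)"
    and K_central: "commutator \<rho> K x v = 0"
    and D_E: "commutator \<rho> D (E n) v = - of_int n *\<^sub>C \<rho> (E n) v"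
    and D_H: "commutator \<rho> D (H n) v = - of_int n *\<^sub>C \<rho> (H n) v"
    and D_F: "commutator \<rho> D (F n) v = - of_int n *\<^sub>C \<rho> (F n) v"

definition submodule :: "'v::complex_vector rep \<Rightarrow> 'v set \<Rightarrow> bool" where
  "submodule \<rho> S \<longleftrightarrow> complex_vector.subspace S \<and> (\<forall>x. \<forall>v\<in>S. \<rho> x v \<in> S)"

text \<open>The cyclic submodule \<open>U \<cdot> v\<close>, where \<open>U\<close> is the universal enveloping algebra.\<close>

definition generated_submodule :: "'v::complex_vector rep \<Rightarrow> 'v \<Rightarrow> 'v set" where
  "generated_submodule \<rho> v = submodule \<rho> hull {v}"

definition irreducible_rep :: "'v::complex_vector rep \<Rightarrow> bool" where
  "irreducible_rep \<rho> \<longleftrightarrow>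
     (UNIV :: 'v set) \<noteq> {0} \<and> (\<forall>S. submodule \<rho> S \<longrightarrow> S = {0} \<or> S = UNIV)"

text \<open>
  Integrability in the sense of Kac: the Cartan subalgebra spanned by \<open>h\<^sub>0, K, d\<close> is
  diagonalizable and the Chevalley generators \<open>e\<^sub>0\<close>, \<open>f\<^sub>0\<close> (first simple root) and
  \<open>f\<^sub>1\<close>, \<open>e\<^sub>-\<^sub>1\<close> (second simple root) are locally nilpotent.
\<close>

definition integrable_rep :: "'v::complex_vector rep \<Rightarrow> bool" where
  "integrable_rep \<rho> \<longleftrightarrow>
     complex_vector.span {v. \<forall>x\<in>{H 0, K, D}. \<exists>c. \<rho> x v = c *\<^sub>C v} = UNIV \<and>
     (\<forall>x\<in>{E 0, F 0, F 1, E (- 1)}. \<forall>v. \<exists>n. (\<rho> x ^^ n) v = 0)"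

text \<open>Killed by \<open>e\<^sub>0\<close> and by all \<open>x\<^sub>r\<close>, \<open>r > 0\<close>; the zero vector is included.\<close>

definition highest_weight_vector :: "'v::complex_vector rep \<Rightarrow> 'v \<Rightarrow> bool" where
  "highest_weight_vector \<rho> v \<longleftrightarrow>
     \<rho> (E 0) v = 0 \<and> (\<forall>r>0. \<rho> (E r) v = 0 \<and> \<rho> (H r) v = 0 \<and> \<rho> (F r) v = 0)"

text \<open>
  \<open>is_L l k \<rho>\<close>: \<open>\<rho>\<close> is a realization of the irreducible integrable module of level \<open>k\<close> and highest
  weight \<open>l\<close>, with \<open>d\<close> normalized to vanish on the highest weight vector. For \<open>0 \<le> l \<le> k\<close> and
  \<open>k \<ge> 1\<close> these modules all have countably infinite dimension, so they can be realized on one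
  and the same vector space.
\<close>

definition is_L :: "nat \<Rightarrow> nat \<Rightarrow> 'v::complex_vector rep \<Rightarrow> bool" where
  "is_L l k \<rho> \<longleftrightarrow>
     affine_sl2_rep \<rho> \<and> irreducible_rep \<rho> \<and> integrable_rep \<rho> \<and>
     (\<forall>v. \<rho> K v = of_nat k *\<^sub>C v) \<and>
     (\<exists>v. v \<noteq> 0 \<and> highest_weight_vector \<rho> v \<and> \<rho> (H 0) v = of_nat l *\<^sub>C v \<and> \<rho> D v = 0)"

text \<open>
  The extremal vectors form the orbit of the highest weight vectors under the affine Weyl
  group: for a simple root with \<open>sl\<^sub>2\<close>-triple \<open>(a, a\<^sup>\<or>, b)\<close>, the simple reflection maps an extremal
  vector \<open>v\<close> with \<open>a\<^sup>\<or> v = n v\<close> to \<open>b\<^sup>n v\<close> if \<open>n \<ge> 0\<close> and to \<open>a\<^sup>-\<^sup>n v\<close> if \<open>n \<le> 0\<close>. The two triples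
  are \<open>(e\<^sub>0, h\<^sub>0, f\<^sub>0)\<close> and \<open>(f\<^sub>1, K - h\<^sub>0, e\<^sub>-\<^sub>1)\<close>.
\<close>

inductive extremal :: "'v::complex_vector rep \<Rightarrow> 'v \<Rightarrow> bool" for \<rho> where
  highest: "v \<noteq> 0 \<Longrightarrow> highest_weight_vector \<rho> v \<Longrightarrow> extremal \<rho> v"
| reflect1_pos: "extremal \<rho> v \<Longrightarrow> \<rho> (H 0) v = of_nat n *\<^sub>C v \<Longrightarrow> extremal \<rho> ((\<rho> (F 0) ^^ n) v)"
| reflect1_neg: "extremal \<rho> v \<Longrightarrow> \<rho> (H 0) v = - of_nat n *\<^sub>C v \<Longrightarrow> extremal \<rho> ((\<rho> (E 0) ^^ n) v)"
| reflect0_pos: "extremal \<rho> v \<Longrightarrow> \<rho> K v - \<rho> (H 0) v = of_nat n *\<^sub>C v \<Longrightarrow>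
    extremal \<rho> ((\<rho> (E (- 1)) ^^ n) v)"
| reflect0_neg: "extremal \<rho> v \<Longrightarrow> \<rho> K v - \<rho> (H 0) v = - of_nat n *\<^sub>C v \<Longrightarrow>
    extremal \<rho> ((\<rho> (F 1) ^^ n) v)"


section \<open>Tensor products of modules\<close>

text \<open>
  \<open>tensor_rep [\<rho>\<^sub>1, \<dots>, \<rho>\<^sub>n]\<close> is the Leibniz action on the tensor product of \<open>\<rho>\<^sub>1, \<dots>, \<rho>\<^sub>n\<close>, whose
  underlying space is \<open>tensor_power n\<close> (it is extended by zero to the other tensor powers).
\<close>

definition tensor_rep :: "'v::complex_vector rep list \<Rightarrow> 'v tensor rep" where
  "tensor_rep \<rho>s x = tensor_lift (\<lambda>vs.
     if length vs = length \<rho>s then \<Sum>a<length \<rho>s. pure (vs[a := (\<rho>s ! a) x (vs ! a)]) else 0)"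

lemma tensor_rep_pure:
  fixes \<rho>s :: "'v::complex_vector rep list"
  assumes "\<And>\<rho>. \<rho> \<in> set \<rho>s \<Longrightarrow> clinear (\<rho> x)"
  shows "clinear (tensor_rep \<rho>s x)"
    and "length vs = length \<rho>s \<Longrightarrow>
      tensor_rep \<rho>s x (pure vs) = (\<Sum>a<length \<rho>s. pure (vs[a := (\<rho>s ! a) x (vs ! a)]))"
proof -
  let ?\<phi> = "\<lambda>vs. if length vs = length \<rho>s
    then \<Sum>a<length \<rho>s. pure (vs[a := (\<rho>s ! a) x (vs ! a)]) else 0"
  have pure_lin: "clinear (\<lambda>y. pure (us @ y # ws))" for us ws :: "'v list"
    by (rule multilinear_pure [unfolded multilinear_def, THEN spec, THEN spec])
  note pure_add = module_hom.add [OF pure_lin [unfolded linear_iff_module_hom]]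
    and pure_scale = module_hom.scale [OF pure_lin [unfolded linear_iff_module_hom]]
  have upd_add: "pure (vs[a := y + z]) = pure (vs[a := y]) + pure (vs[a := z])"
    and upd_scale: "pure (vs[a := c *\<^sub>C y]) = c *\<^sub>C pure (vs[a := y])"
    if "a < length vs" for vs a and y z :: 'v and c
    using that by (simp_all add: upd_conv_take_nth_drop pure_add pure_scale)
  have rep: "clinear ((\<rho>s ! a) x)" if "a < length \<rho>s" for a
    using that assms by simp
  note rep_add = module_hom.add [OF rep [unfolded linear_iff_module_hom]]
    and rep_scale = module_hom.scale [OF rep [unfolded linear_iff_module_hom]]
  let ?t = "\<lambda>us ws a y. pure ((us @ y # ws)[a := (\<rho>s ! a) x ((us @ y # ws) ! a)])"
  have upd: "(us @ y # ws)[a := w] = ((us @ z # ws)[a := w])[length us := y]"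
    if "a \<noteq> length us" for us ws :: "'v list" and y z w a
  proof -
    have "us @ y # ws = (us @ z # ws)[length us := y]" by simp
    then show ?thesis by (simp only: list_update_swap [OF that])
  qed
  have t_add: "?t us ws a (y + z) = ?t us ws a y + ?t us ws a z"
    and t_scale: "?t us ws a (c *\<^sub>C y) = c *\<^sub>C ?t us ws a y"
    if a: "a < length \<rho>s" and len: "length us + Suc (length ws) = length \<rho>s"
    for us ws a y z c
  proof -
    consider "a = length us" | "a \<noteq> length us" by blast
    then have "?t us ws a (y + z) = ?t us ws a y + ?t us ws a z \<and>
        ?t us ws a (c *\<^sub>C y) = c *\<^sub>C ?t us ws a y"
    proof cases
      case 1
      then show ?thesis
        using a by (simp add: rep_add rep_scale pure_add pure_scale)
    next
      case 2
      define w where "w = (\<rho>s ! a) x ((us @ 0 # ws) ! a)"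
      define vs where "vs = (us @ 0 # ws)[a := w]"
      have t: "?t us ws a y' = pure (vs[length us := y'])" for y'
      proof -
        have "(\<rho>s ! a) x ((us @ y' # ws) ! a) = w"
          using 2 by (simp add: w_def nth_append nth_Cons')
        then show ?thesis
          using upd [OF 2, of y' ws w 0] by (simp only: vs_def)
      qed
      have "length us < length vs" by (simp add: vs_def)
      then show ?thesis by (simp only: t upd_add upd_scale)
    qed
    then show "?t us ws a (y + z) = ?t us ws a y + ?t us ws a z"
      and "?t us ws a (c *\<^sub>C y) = c *\<^sub>C ?t us ws a y" by blast+
  qed
  have "multilinear ?\<phi>"
    unfolding multilinear_def
  proof (intro allI)
    fix us ws :: "'v list"
    show "clinear (\<lambda>y. ?\<phi> (us @ y # ws))"
    proof (rule Vector_Spaces.linear.intro, unfold_locales)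
      fix y z :: 'v and c :: complex
      show "?\<phi> (us @ (y + z) # ws) = ?\<phi> (us @ y # ws) + ?\<phi> (us @ z # ws)"
      proof (cases "length us + Suc (length ws) = length \<rho>s")
        case True
        then have "(\<Sum>a<length \<rho>s. ?t us ws a (y + z)) =
            (\<Sum>a<length \<rho>s. ?t us ws a y + ?t us ws a z)"
          by (intro sum.cong refl t_add) simp_all
        with True show ?thesis
          by (simp only: length_append list.size add_Suc_right add_0_right simp_thms if_True sum.distrib)
      qed simp
      show "?\<phi> (us @ (c *\<^sub>C y) # ws) = c *\<^sub>C ?\<phi> (us @ y # ws)"
      proof (cases "length us + Suc (length ws) = length \<rho>s")
        case True
        then have "(\<Sum>a<length \<rho>s. ?t us ws a (c *\<^sub>C y)) =
            (\<Sum>a<length \<rho>s. c *\<^sub>C ?t us ws a y)"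
          by (intro sum.cong refl t_scale) simp_all
        with True show ?thesis
          by (simp only: length_append list.size add_Suc_right add_0_right simp_thms if_True
              complex_vector.scale_sum_right)
      qed simp
    qed
  qed
  note lift = tensor_lift [OF this]
  show "clinear (tensor_rep \<rho>s x)"
    unfolding tensor_rep_def by (rule lift(1))
  show "tensor_rep \<rho>s x (pure vs) = (\<Sum>a<length \<rho>s. pure (vs[a := (\<rho>s ! a) x (vs ! a)]))"
    if "length vs = length \<rho>s"
    unfolding tensor_rep_def using lift(2) [of vs] that by simp
qed

text \<open>
  For \<open>m = [m\<^sub>1, \<dots>, m\<^sub>\<kappa>]\<close> this is \<open>[M\<^sub>1, \<dots>, M\<^sub>\<kappa>]\<close> with \<open>M\<^sub>a = m\<^sub>a + \<dots> + m\<^sub>\<kappa>\<close>.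
\<close>

definition tail_sums :: "nat list \<Rightarrow> nat list" where
  "tail_sums m = map (\<lambda>a. sum_list (drop a m)) [0..<length m]"

text \<open>
  The inductive limit \<open>L\<^sub>m\<^sub>,\<^sub>\<kappa>\<close> of fusion products, realized explicitly inside a tensor product of
  level one modules (this also fixes the action of \<open>d\<close>): it is the subspace \<open>fusion_limit_space\<close> with the action \<open>fusion_limit_rep\<close>.
  Here \<open>L 0 1\<close> and \<open>L 1 1\<close> are the two level one modules and \<open>v p\<close> is the extremal vector of
  \<open>h\<^sub>0\<close>-weight \<open>- p\<close>, which lies in \<open>L (p mod 2) 1\<close>; the \<open>a\<close>-th tensor factor is the
  level one module containing \<open>v M\<^sub>a\<close>.
\<close>

definition fusion_limit_rep ::
    "(nat \<Rightarrow> nat \<Rightarrow> 'v::complex_vector rep) \<Rightarrow> nat list \<Rightarrow> 'v tensor rep" where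
  "fusion_limit_rep L m = tensor_rep (map (\<lambda>p. L (p mod 2) 1) (tail_sums m))"

definition fusion_limit_space ::
    "(nat \<Rightarrow> nat \<Rightarrow> 'v::complex_vector rep) \<Rightarrow> (int \<Rightarrow> 'v) \<Rightarrow> nat list \<Rightarrow> 'v tensor set" where
  "fusion_limit_space L v m =
     generated_submodule (fusion_limit_rep L m) (pure (map (\<lambda>p. v (int p)) (tail_sums m)))"

text \<open>
  The tuple \<open>(1\<^sup>N (j+1))\<close> in \<open>\<nat>\<^sup>\<kappa>\<close>: \<open>N\<close> copies of \<open>\<pi>\<^sub>1\<close> and one copy of \<open>\<pi>\<^sub>j\<^sub>+\<^sub>1\<close>; for \<open>j = 0\<close>
  both contribute to the first entry.
\<close>

definition one_power_tuple :: "nat \<Rightarrow> nat \<Rightarrow> nat \<Rightarrow> nat list" where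
  "one_power_tuple \<kappa> N j =
     map (\<lambda>a. (if a = 1 then N else 0) + (if a = j + 1 then 1 else 0)) [1..<\<kappa> + 1]"

definition highest_weight_space ::
    "'v::complex_vector rep \<Rightarrow> 'v set \<Rightarrow> nat \<Rightarrow> 'v set" where
  "highest_weight_space \<rho> S l =
     {v \<in> S. highest_weight_vector \<rho> v \<and> \<rho> (H 0) v = of_nat l *\<^sub>C v}"

text \<open>
  The coefficient of \<open>q\<^sup>s\<close> in the graded character of \<open>N\<close>. The eigenspaces of \<open>d\<close> on the tensor
  products considered here are finite-dimensional, so \<open>dim\<close> is the true dimension.
\<close>

definition ch_q :: "'v::complex_vector rep \<Rightarrow> 'v set \<Rightarrow> int \<Rightarrow> nat" where
  "ch_q \<rho> N s = complex_vector.dim {v \<in> N. \<rho> D v = of_int s *\<^sub>C v}"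

end

theory Submission
  imports Defs "HOL-Library.Product_Plus"
begin

text \<open>
  For \<open>N = 2n + i - 1\<close> the tail sums of \<open>(1\<^sup>N (j+1))\<close> are \<open>2n + i\<close>, then \<open>j\<close> ones and \<open>k - j\<close> zeros.
  So the fusion limit is generated by \<open>v(2n + i) \<otimes> u\<close>, where
  \<open>u = v(1)\<^sup>\<otimes>\<^sup>j \<otimes> v(0)\<^sup>\<otimes>\<^sup>(\<^sup>k\<^sup>-\<^sup>j\<^sup>)\<close> lies in a tensor product of level one modules.
  The vector \<open>u\<close> is the lowest vector of the degree zero component of the submodule generated by
  the corresponding product of highest weight vectors, and this submodule is isomorphic to the second
  factor \<open>L j k\<close> (\<open>level_one_realization\<close>). Hence the fusion limit is isomorphic to a submodule
  \<open>M n\<close> of \<open>L i 1 \<otimes> L j k\<close>. It is shown that every vector lies in \<open>M n\<close> for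
  all large \<open>n\<close> (\<open>tensor_exhaustion\<close>). The highest weight vectors of a given weight and
  degree span a finite-dimensional space (\<open>tensor_grade_finite\<close>), so for large \<open>n\<close> they all
  lie in \<open>M n\<close>, and each coefficient of the character is eventually constant.

  Two facts about integrable modules carry the argument.

  Uniqueness of highest weight vectors (\<open>highest_weight_vector_unique\<close>): the Casimir operator,
  corrected by a multiple of \<open>d\<close>, is constant on a module generated by a highest weight vector.
  With the bounds that integrability puts on weights, this leaves room for no other highest weight
  vector. Such modules are therefore irreducible, and irreducible modules with equal highest weights are
  isomorphic (\<open>highest_weight_isomorphism\<close>).

  Exhaustion by Demazure modules (\<open>borel_chain_exhausts\<close>): the weights of a level one module lie
  inside a parabola (\<open>weight_bound\<close>), and the extremal vectors lie on it. They form a chain in which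
  simple reflections move one step up or down (\<open>extremal_in_chain\<close>). The modules that they generate over
  the Borel subalgebra grow along the chain, and each is stable under one of the two negative
  Chevalley generators, alternatingly. Their union is therefore the whole module.

  To combine them, identify \<open>u\<close> with a vector of \<open>L j k\<close>. A power of \<open>e\<^sub>0\<close> maps \<open>v(p) \<otimes> u\<close>,
  \<open>p > 0\<close>, to a nonzero multiple of \<open>v(- p) \<otimes> w\<close> with the highest weight vector \<open>w\<close> of \<open>L j k\<close>.
  The Borel subalgebra acts on \<open>w\<close> by scalars, so this generates \<open>x \<otimes> w\<close> for all \<open>x\<close> in a
  Demazure module, and \<open>w\<close> generates \<open>L j k\<close>.
\<close>

section \<open>Linear operators and their eigenvectors\<close>

lemma clinearI:
  assumes "\<And>x y. f (x + y) = f x + f y" and "\<And>c x. f (c *\<^sub>C x) = c *\<^sub>C f x"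
  shows "clinear f"
  by (rule Vector_Spaces.linear.intro, unfold_locales) (fact assms)+

context
  fixes f :: "'a::complex_vector \<Rightarrow> 'b::complex_vector"
  assumes lin: "clinear f"
begin

interpretation mh: module_hom scaleC scaleC f
  using lin by (simp add: linear_iff_module_hom)

lemma clinear_add: "f (x + y) = f x + f y" by (rule mh.add)
lemma clinear_scale: "f (c *\<^sub>C x) = c *\<^sub>C f x" by (rule mh.scale)
lemma clinear_zero: "f 0 = 0" by (rule mh.zero)
lemma clinear_diff: "f (x - y) = f x - f y" by (rule mh.diff)
lemma clinear_neg: "f (- x) = - f x" by (rule mh.neg)
lemma clinear_sum: "f (sum g A) = (\<Sum>a\<in>A. f (g a))" by (rule mh.sum)

lemma clinear_vimage_subspace:
  "complex_vector.subspace S \<Longrightarrow> complex_vector.subspace {x. f x \<in> S}"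
  using mh.subspace_vimage [of S] by (simp add: vimage_def)

lemma clinear_image_subspace:
  "complex_vector.subspace S \<Longrightarrow> complex_vector.subspace (f ` S)"
  by (rule mh.subspace_image)

lemma clinear_image_span:
  "f ` complex_vector.span S = complex_vector.span (f ` S)"
  by (rule mh.span_image [symmetric])

end

lemmas clinear_simps = clinear_add clinear_scale clinear_zero clinear_diff clinear_neg clinear_sum

lemma clinear_comp: "clinear f \<Longrightarrow> clinear g \<Longrightarrow> clinear (\<lambda>x. f (g x))"
  by (rule clinearI) (simp_all add: clinear_simps)

lemma clinear_plus: "clinear f \<Longrightarrow> clinear g \<Longrightarrow> clinear (\<lambda>x. f x + g x)"
  by (rule clinearI) (simp_all add: clinear_simps scaleC_add_right)

lemma clinear_scaled: "clinear f \<Longrightarrow> clinear (\<lambda>x. c *\<^sub>C f x)"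
  by (rule clinearI) (simp_all add: clinear_simps scaleC_add_right scaleC_scaleC mult.commute)

lemma clinear_ident: "clinear (\<lambda>x. x)"
  by (rule clinearI) simp_all

lemma clinear_minus: "clinear f \<Longrightarrow> clinear g \<Longrightarrow> clinear (\<lambda>x. f x - g x)"
  by (rule clinearI)
    (simp_all add: clinear_simps complex_vector.scale_right_diff_distrib algebra_simps)

lemma clinear_eq_on_span:
  assumes "clinear f" "clinear g" "x \<in> complex_vector.span B" "\<And>b. b \<in> B \<Longrightarrow> f b = g b"
  shows "f x = g x"
proof -
  have "complex_vector.subspace {x. f x - g x \<in> {0}}"
    by (rule clinear_vimage_subspace [OF clinear_minus [OF assms(1,2)]])
      (rule complex_vector.subspace_single_0)
  then have "complex_vector.span B \<subseteq> {x. f x - g x \<in> {0}}"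
    by (intro complex_vector.span_minimal) (auto simp: assms(4))
  with assms(3) show ?thesis by auto
qed

lemma clinear_span_mem:
  assumes "clinear f" "x \<in> complex_vector.span B" "complex_vector.subspace S"
    "\<And>b. b \<in> B \<Longrightarrow> f b \<in> S"
  shows "f x \<in> S"
proof -
  have "complex_vector.span B \<subseteq> {x. f x \<in> S}"
    by (rule complex_vector.span_minimal) (auto simp: assms(4) clinear_vimage_subspace assms(1,3))
  with assms(2) show ?thesis by auto
qed

lemma clinear_funpow:
  fixes f :: "'a::complex_vector \<Rightarrow> 'a"
  assumes f: "clinear f"
  shows "clinear (f ^^ n)"
proof (induction n)
  case 0
  have "f ^^ 0 = (\<lambda>x. x)" by auto
  then show ?case by (simp only: clinear_ident)
next
  case (Suc n)
  have "f ^^ Suc n = (\<lambda>x. f ((f ^^ n) x))" by auto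
  then show ?case using clinear_comp [OF f Suc] by simp
qed

lemma subspace_scale_cancel:
  assumes S: "complex_vector.subspace S" and c: "c \<noteq> 0" and mem: "c *\<^sub>C x \<in> S"
  shows "x \<in> S"
  using complex_vector.subspace_scale [OF S mem, of "inverse c"] c
  by (simp add: scaleC_scaleC scaleC_one)

lemma eigenspace_subspace:
  assumes "clinear T"
  shows "complex_vector.subspace {x. T x = c *\<^sub>C x}"
  using assms by (auto simp: complex_vector.subspace_def clinear_simps scaleC_add_right scaleC_scaleC mult.commute)

text \<open>
  Applying \<open>T - \<mu>\<close> kills the \<open>\<mu>\<close>-component and rescales the others by nonzero factors, so the
  eigencomponents of a vector are separated by induction on their number.
\<close>

lemma eigencomponent_mem:
  assumes T: "clinear T" and S: "complex_vector.subspace S" and TS: "\<And>x. x \<in> S \<Longrightarrow> T x \<in> S"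
    and fin: "finite A" and eig: "\<And>c. c \<in> A \<Longrightarrow> T (y c) = c *\<^sub>C y c"
    and mem: "(\<Sum>c\<in>A. y c) \<in> S" and c: "c \<in> A"
  shows "y c \<in> S"
  using fin eig mem c
proof (induction A arbitrary: y c rule: finite_induct)
  case (insert b A)
  let ?x = "\<Sum>c\<in>insert b A. y c"
  have "T ?x - b *\<^sub>C ?x = (\<Sum>c\<in>insert b A. (c - b) *\<^sub>C y c)"
    using insert.prems(1)
    by (simp add: clinear_simps [OF T] complex_vector.scale_sum_right
        complex_vector.scale_left_diff_distrib sum_subtractf del: sum.insert)
  also have "\<dots> = (\<Sum>c\<in>A. (c - b) *\<^sub>C y c)"
    using insert.hyps by simp
  finally have eq: "T ?x - b *\<^sub>C ?x = (\<Sum>c\<in>A. (c - b) *\<^sub>C y c)" .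
  have "T ?x - b *\<^sub>C ?x \<in> S"
    by (intro complex_vector.subspace_diff [OF S] complex_vector.subspace_scale [OF S] TS
        insert.prems(2))
  then have "(\<Sum>c\<in>A. (c - b) *\<^sub>C y c) \<in> S" by (simp only: eq)
  then have *: "(c - b) *\<^sub>C y c \<in> S" if "c \<in> A" for c
    using insert.prems(1) that
    by (intro insert.IH [where y = "\<lambda>c. (c - b) *\<^sub>C y c"])
      (simp_all add: clinear_simps [OF T] scaleC_scaleC mult.commute)
  have **: "y c \<in> S" if "c \<in> A" for c
    by (rule subspace_scale_cancel [OF S _ * [OF that]]) (use that insert.hyps in auto)
  then have "(\<Sum>c\<in>A. y c) \<in> S"
    by (intro complex_vector.subspace_sum [OF S])
  then have "?x - (\<Sum>c\<in>A. y c) \<in> S"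
    using insert.prems(2) S by (intro complex_vector.subspace_diff)
  then have "y b \<in> S" using insert.hyps by simp
  with ** insert.prems(3) show ?case by auto
qed simp

lemma span_eigenvectors_decompose:
  assumes T: "clinear T" and x: "x \<in> complex_vector.span B"
    and eig: "\<And>b. b \<in> B \<Longrightarrow> \<exists>c\<in>C. T b = c *\<^sub>C b"
  obtains A y where "finite A" "A \<subseteq> C" "x = (\<Sum>c\<in>A. y c)"
    "\<And>c. c \<in> A \<Longrightarrow> T (y c) = c *\<^sub>C y c"
    "\<And>c. c \<in> A \<Longrightarrow> y c \<in> complex_vector.span {b\<in>B. T b = c *\<^sub>C b}"
proof -
  obtain t r where t: "finite t" "t \<subseteq> B" and xr: "x = (\<Sum>a\<in>t. r a *\<^sub>C a)"
    using x unfolding complex_vector.span_explicit by blast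
  obtain g where g: "\<And>b. b \<in> B \<Longrightarrow> g b \<in> C \<and> T b = g b *\<^sub>C b"
    using eig by metis
  define y where "y c = (\<Sum>a\<in>{a\<in>t. g a = c}. r a *\<^sub>C a)" for c
  have "x = (\<Sum>c\<in>g ` t. y c)"
    unfolding xr y_def by (rule sum.group [symmetric]) (use t in auto)
  moreover have sp: "y c \<in> complex_vector.span {b\<in>B. T b = c *\<^sub>C b}" for c
    unfolding y_def using g t(2)
    by (intro complex_vector.span_sum complex_vector.span_scale complex_vector.span_base) auto
  moreover have "T (y c) = c *\<^sub>C y c" for c
    using clinear_eq_on_span [OF T clinear_scaled [OF clinear_ident] sp] by auto
  ultimately show thesis
    using that [of "g ` t" y] t g by blast
qed

lemma eigenvector_in_span:
  assumes T: "clinear T" and x: "x \<in> complex_vector.span B"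
    and eig: "\<And>b. b \<in> B \<Longrightarrow> \<exists>c. T b = c *\<^sub>C b" and Tx: "T x = c *\<^sub>C x"
  shows "x \<in> complex_vector.span {b\<in>B. T b = c *\<^sub>C b}"
proof -
  obtain A y where A: "finite A" and xy: "x = (\<Sum>c\<in>A. y c)"
    and Ty: "\<And>c. c \<in> A \<Longrightarrow> T (y c) = c *\<^sub>C y c"
    and sp: "\<And>c. c \<in> A \<Longrightarrow> y c \<in> complex_vector.span {b\<in>B. T b = c *\<^sub>C b}"
    by (rule span_eigenvectors_decompose [OF T x, of UNIV]) (use eig in auto)
  have "y a \<in> {x. T x = c *\<^sub>C x}" if "a \<in> A" for a
    using that Tx unfolding xy
    by (intro eigencomponent_mem [OF T eigenspace_subspace [OF T] _ A Ty])
      (auto simp: clinear_simps [OF T])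
  then have "y a \<in> complex_vector.span {b\<in>B. T b = c *\<^sub>C b}" if "a \<in> A" for a
    using that Ty [OF that] sp [OF that]
    by (cases "a = c") (auto simp: complex_vector.span_zero)
  then show ?thesis unfolding xy by (rule complex_vector.span_sum)
qed

section \<open>Representations of \<open>sl\<^sub>2\<close>\<close>

text \<open>
  The triple is given by operators on a vector space, so that both simple roots of the affine algebra
  give instances.
\<close>

locale sl2_triple =
  fixes e h f :: "'v::complex_vector \<Rightarrow> 'v"
  assumes lin_e: "clinear e" and lin_h: "clinear h" and lin_f: "clinear f"
    and ef: "e (f v) = f (e v) + h v"
    and he: "h (e v) = e (h v) + 2 *\<^sub>C e v"
    and hf: "h (f v) = f (h v) - 2 *\<^sub>C f v"
begin

lemmas lin_simps = clinear_simps [OF lin_e] clinear_simps [OF lin_h] clinear_simps [OF lin_f]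
  clinear_simps [OF clinear_funpow [OF lin_e]] clinear_simps [OF clinear_funpow [OF lin_f]]

lemma h_f_pow:
  assumes "h v = a *\<^sub>C v"
  shows "h ((f ^^ n) v) = (a - 2 * of_nat n) *\<^sub>C (f ^^ n) v"
proof (induction n)
  case (Suc n)
  have "h ((f ^^ Suc n) v) = (a - 2 * of_nat n) *\<^sub>C (f ^^ Suc n) v - 2 *\<^sub>C (f ^^ Suc n) v"
    by (simp add: hf Suc lin_simps)
  also have "\<dots> = (a - 2 * of_nat (Suc n)) *\<^sub>C (f ^^ Suc n) v"
    by (simp only: complex_vector.scale_left_diff_distrib [symmetric]) (simp add: diff_diff_eq)
  finally show ?case .
qed (simp add: assms)

lemma h_e_pow:
  assumes "h v = a *\<^sub>C v"
  shows "h ((e ^^ n) v) = (a + 2 * of_nat n) *\<^sub>C (e ^^ n) v"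
proof (induction n)
  case (Suc n)
  have "h ((e ^^ Suc n) v) = (a + 2 * of_nat n) *\<^sub>C (e ^^ Suc n) v + 2 *\<^sub>C (e ^^ Suc n) v"
    by (simp add: he Suc lin_simps)
  also have "\<dots> = (a + 2 * of_nat (Suc n)) *\<^sub>C (e ^^ Suc n) v"
    by (simp only: scaleC_add_left [symmetric]) (simp add: add_ac)
  finally show ?case .
qed (simp add: assms)

lemma e_f_pow:
  assumes "h v = a *\<^sub>C v"
  shows "e ((f ^^ Suc n) v) = (f ^^ Suc n) (e v) + (of_nat (Suc n) * (a - of_nat n)) *\<^sub>C (f ^^ n) v"
proof (induction n)
  case 0
  then show ?case using assms by (simp add: ef)
next
  case (Suc n)
  have "e ((f ^^ Suc (Suc n)) v) = f (e ((f ^^ Suc n) v)) + h ((f ^^ Suc n) v)"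
    by (simp add: ef)
  also have "\<dots> = (f ^^ Suc (Suc n)) (e v)
      + ((of_nat (Suc n) * (a - of_nat n)) *\<^sub>C (f ^^ Suc n) v
         + (a - 2 * of_nat (Suc n)) *\<^sub>C (f ^^ Suc n) v)"
    by (simp only: Suc h_f_pow [OF assms] lin_simps) (simp add: add.assoc)
  also have "\<dots> = (f ^^ Suc (Suc n)) (e v)
      + (of_nat (Suc (Suc n)) * (a - of_nat (Suc n))) *\<^sub>C (f ^^ Suc n) v"
  proof -
    have "of_nat (Suc n) * (a - of_nat n) + (a - 2 * of_nat (Suc n))
        = of_nat (Suc (Suc n)) * (a - of_nat (Suc n))"
      by (simp add: ring_distribs)
    then show ?thesis by (simp only: scaleC_add_left [symmetric])
  qed
  finally show ?case .
qed

lemma e_pow_f_pow_highest: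
  assumes hv: "h v = of_nat n *\<^sub>C v" and ev: "e v = 0" and "m \<le> n"
  shows "\<exists>c. c \<noteq> 0 \<and> (e ^^ m) ((f ^^ m) v) = c *\<^sub>C v"
  using \<open>m \<le> n\<close>
proof (induction m)
  case 0
  show ?case by (rule exI [of _ 1]) (simp add: scaleC_one)
next
  case (Suc m)
  then obtain c where c: "c \<noteq> 0" "(e ^^ m) ((f ^^ m) v) = c *\<^sub>C v" by auto
  let ?b = "of_nat (Suc m) * (of_nat n - of_nat m) :: complex"
  have b: "?b \<noteq> 0" using Suc.prems by (simp del: of_nat_Suc)
  have "(e ^^ Suc m) ((f ^^ Suc m) v) = (e ^^ m) (e ((f ^^ Suc m) v))"
    by (simp only: funpow_Suc_right o_apply)
  also have "\<dots> = (?b * c) *\<^sub>C v"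
    by (simp only: e_f_pow [OF hv] ev lin_simps) (simp add: c scaleC_scaleC lin_simps del: funpow.simps)
  finally show ?case using b c(1) by (intro exI [of _ "?b * c"]) simp
qed

text \<open>
  If \<open>N\<close> is minimal with \<open>f\<^sup>N v = 0\<close>, then \<open>0 = e f\<^sup>N v\<close> is the multiple \<open>N (a - N + 1)\<close> of
  \<open>f\<^sup>N\<^sup>-\<^sup>1 v \<noteq> 0\<close>.
\<close>

lemma highest_weight_nat:
  assumes hv: "h v = a *\<^sub>C v" and ev: "e v = 0" and "v \<noteq> 0" and nil: "(f ^^ N) v = 0"
  obtains n where "a = of_nat n" "(f ^^ Suc n) v = 0"
proof -
  define M where "M = (LEAST N. (f ^^ N) v = 0)"
  have M: "(f ^^ M) v = 0" unfolding M_def using nil by (rule LeastI)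
  with \<open>v \<noteq> 0\<close> obtain n where n: "M = Suc n" by (cases M) auto
  have "(f ^^ n) v \<noteq> 0"
    using n not_less_Least [of n "\<lambda>N. (f ^^ N) v = 0"] by (auto simp: M_def)
  moreover have "(of_nat (Suc n) * (a - of_nat n)) *\<^sub>C (f ^^ n) v = 0"
    using e_f_pow [OF hv, of n] M by (simp add: n ev lin_simps)
  ultimately have "of_nat (Suc n) * (a - of_nat n) = 0"
    by (simp only: complex_vector.scale_eq_0_iff) blast
  then have "a = of_nat n" by (simp add: of_nat_neq_0 del: of_nat_Suc)
  with M n that show thesis by blast
qed

text \<open>
  The reflection map \<open>f\<^sup>n\<close> from weight \<open>n\<close> to weight \<open>- n\<close> is injective. If \<open>f\<^sup>n\<close> kills \<open>x\<close>, then
  \<open>f\<^sup>n\<^sup>+\<^sup>2\<close> kills \<open>e x\<close>, so \<open>e x = 0\<close> by induction on the nilpotency order of \<open>e\<close>; for a highest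
  weight vector the claim is the formula for \<open>e\<^sup>n f\<^sup>n\<close>.
\<close>

lemma reflection_injective:
  assumes "h x = of_nat n *\<^sub>C x" "(e ^^ N) x = 0" "(f ^^ n) x = 0"
  shows "x = 0"
  using assms
proof (induction N arbitrary: x n)
  case (Suc N)
  have f1: "(f ^^ Suc n) x = 0" using Suc.prems(3) by (simp add: lin_simps)
  have "e ((f ^^ Suc (Suc n)) x) = 0" using f1 by (simp add: lin_simps)
  then have fe: "(f ^^ Suc (Suc n)) (e x) = 0"
    using e_f_pow [OF Suc.prems(1), of "Suc n"] f1 by (simp del: funpow.simps)
  have he': "h (e x) = of_nat (Suc (Suc n)) *\<^sub>C e x"
    using h_e_pow [OF Suc.prems(1), of 1] by (simp add: add_ac)
  have eN: "(e ^^ N) (e x) = 0"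
    using Suc.prems(2) by (simp only: funpow_Suc_right o_apply)
  have ex: "e x = 0" by (rule Suc.IH [OF he' eN fe])
  obtain c where "c \<noteq> 0" "(e ^^ n) ((f ^^ n) x) = c *\<^sub>C x"
    using e_pow_f_pow_highest [OF Suc.prems(1) ex order_refl] by blast
  then show ?case using Suc.prems(3) by (simp add: lin_simps)
qed simp

text \<open>
  Exchanging the roles of \<open>e\<close> and \<open>f\<close> transfers statements about lowering to statements about
  raising.
\<close>

lemma flip_triple: "sl2_triple f (\<lambda>v. - h v) e"
  by (rule sl2_triple.intro)
    (simp_all add: lin_e lin_f ef he hf lin_simps clinearI lin_h algebra_simps)

lemma reflection_injective_lowest:
  assumes "h x = - of_nat n *\<^sub>C x" "(f ^^ N) x = 0" "(e ^^ n) x = 0"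
  shows "x = 0"
  by (rule sl2_triple.reflection_injective [OF flip_triple _ assms(2,3)]) (simp add: assms(1))

end

section \<open>Representations of the affine Lie algebra\<close>

lemma submodule_generated: "submodule \<rho> (generated_submodule \<rho> v)"
  unfolding generated_submodule_def
  by (rule hull_in) (auto simp: submodule_def complex_vector.subspace_Inter)

lemma generated_submodule_mem: "v \<in> generated_submodule \<rho> v"
  unfolding generated_submodule_def using hull_subset [of "{v}" "submodule \<rho>"] by blast

lemma generated_submodule_minimal:
  "submodule \<rho> S \<Longrightarrow> v \<in> S \<Longrightarrow> generated_submodule \<rho> v \<subseteq> S"
  unfolding generated_submodule_def by (rule hull_minimal) auto

lemma submodule_subspace: "submodule \<rho> S \<Longrightarrow> complex_vector.subspace S"
  and submodule_closed: "submodule \<rho> S \<Longrightarrow> w \<in> S \<Longrightarrow> \<rho> x w \<in> S"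
  by (auto simp: submodule_def)

lemma submodule_funpow: "submodule \<rho> S \<Longrightarrow> w \<in> S \<Longrightarrow> (\<rho> x ^^ n) w \<in> S"
  by (induction n) (auto simp: submodule_closed)

lemma clinear_funpow_eq_0_mono:
  fixes f :: "'a::complex_vector \<Rightarrow> 'a"
  assumes "clinear f" "(f ^^ m) x = 0" "m \<le> n"
  shows "(f ^^ n) x = 0"
proof -
  have "(f ^^ (n - m + m)) x = 0"
    by (simp only: funpow_add o_apply assms(2) clinear_zero [OF clinear_funpow [OF assms(1)]])
  then show ?thesis using assms(3) by simp
qed

context affine_sl2_rep
begin

lemmas rep_simps = clinear_simps [OF clinear_rep]

lemma EE: "\<rho> (E m) (\<rho> (E n) v) = \<rho> (E n) (\<rho> (E m) v)"
  and FF: "\<rho> (F m) (\<rho> (F n) v) = \<rho> (F n) (\<rho> (F m) v)"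
  and HH: "\<rho> (H m) (\<rho> (H n) v) = \<rho> (H n) (\<rho> (H m) v)
             + (if m + n = 0 then (2 * of_int m) *\<^sub>C \<rho> K v else 0)"
  and HE: "\<rho> (H m) (\<rho> (E n) v) = \<rho> (E n) (\<rho> (H m) v) + 2 *\<^sub>C \<rho> (E (m + n)) v"
  and HF: "\<rho> (H m) (\<rho> (F n) v) = \<rho> (F n) (\<rho> (H m) v) - 2 *\<^sub>C \<rho> (F (m + n)) v"
  and EF: "\<rho> (E m) (\<rho> (F n) v) = \<rho> (F n) (\<rho> (E m) v) + \<rho> (H (m + n)) v
             + (if m + n = 0 then of_int m *\<^sub>C \<rho> K v else 0)"
  and Kx: "\<rho> K (\<rho> x v) = \<rho> x (\<rho> K v)"
  and DE: "\<rho> D (\<rho> (E n) v) = \<rho> (E n) (\<rho> D v) - of_int n *\<^sub>C \<rho> (E n) v"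
  and DH: "\<rho> D (\<rho> (H n) v) = \<rho> (H n) (\<rho> D v) - of_int n *\<^sub>C \<rho> (H n) v"
  and DF: "\<rho> D (\<rho> (F n) v) = \<rho> (F n) (\<rho> D v) - of_int n *\<^sub>C \<rho> (F n) v"
  using E_E [of m n v] F_F [of m n v] H_H [of m n v] H_E [of m n v] H_F [of m n v]
    E_F [of m n v] K_central [of x v] D_E [of n v] D_H [of n v] D_F [of n v]
  unfolding commutator_def
  by (simp_all only: diff_eq_eq complex_vector.scale_minus_left) (simp_all add: algebra_simps)

sublocale sl0: sl2_triple "\<rho> (E 0)" "\<rho> (H 0)" "\<rho> (F 0)"
  by (rule sl2_triple.intro) (simp_all add: clinear_rep EF HE HF)

sublocale sl1: sl2_triple "\<rho> (F 1)" "\<lambda>v. \<rho> K v - \<rho> (H 0) v" "\<rho> (E (- 1))"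
proof (rule sl2_triple.intro)
  fix v
  show "\<rho> (F 1) (\<rho> (E (- 1)) v) = \<rho> (E (- 1)) (\<rho> (F 1) v) + (\<rho> K v - \<rho> (H 0) v)"
    using EF [of "- 1" 1 v] by simp
  show "\<rho> K (\<rho> (F 1) v) - \<rho> (H 0) (\<rho> (F 1) v)
      = \<rho> (F 1) (\<rho> K v - \<rho> (H 0) v) + 2 *\<^sub>C \<rho> (F 1) v"
    using HF [of 0 1 v] by (simp add: Kx rep_simps)
  show "\<rho> K (\<rho> (E (- 1)) v) - \<rho> (H 0) (\<rho> (E (- 1)) v)
      = \<rho> (E (- 1)) (\<rho> K v - \<rho> (H 0) v) - 2 *\<^sub>C \<rho> (E (- 1)) v"
    using HE [of 0 "- 1" v] by (simp add: Kx rep_simps)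
qed (intro clinear_rep clinear_minus)+

text \<open>
  Reordering products of currents uses only that a bracket is a multiple of one current, with the sum of the
  indices, up to a central term.
\<close>

lemma current_bracket:
  assumes "X \<in> {E, H, F}" and "Y \<in> {E, H, F}"
  obtains Z a b where "Z \<in> {E, H, F}" "\<And>m n v. \<rho> (X m) (\<rho> (Y n) v) =
    \<rho> (Y n) (\<rho> (X m) v) + a *\<^sub>C \<rho> (Z (m + n)) v + (if m + n = 0 then (of_int m * b) *\<^sub>C \<rho> K v else 0)"
proof -
  have FE: "\<rho> (F m) (\<rho> (E n) v) = \<rho> (E n) (\<rho> (F m) v) + (- 1) *\<^sub>C \<rho> (H (m + n)) v
      + (if m + n = 0 then (of_int m * 1) *\<^sub>C \<rho> K v else 0)" for m n v
    using EF [of n m v] by (auto simp: scaleC_one add.commute add_eq_0_iff)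
  consider "X = E \<and> Y = E" | "X = H \<and> Y = H" | "X = F \<and> Y = F" | "X = E \<and> Y = H"
    | "X = H \<and> Y = E" | "X = H \<and> Y = F" | "X = F \<and> Y = H" | "X = E \<and> Y = F" | "X = F \<and> Y = E"
    using assms by blast
  then show thesis
  proof cases
    case 1
    show thesis
      by (rule that [of E "0" "0"], simp, simp only: 1 simp_thms, simp add: EE)
  next
    case 2
    show thesis
      by (rule that [of E "0" "2"], simp, simp only: 2 simp_thms, subst HH, simp add: mult.commute)
  next
    case 3
    show thesis
      by (rule that [of E "0" "0"], simp, simp only: 3 simp_thms, simp add: FF)
  next
    case 4
    show thesis
      by (rule that [of E "- 2" "0"], simp, simp only: 4 simp_thms, simp add: HE add.commute)
  next
    case 5
    show thesis
      by (rule that [of E "2" "0"], simp, simp only: 5 simp_thms, simp add: HE)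
  next
    case 6
    show thesis
      by (rule that [of F "- 2" "0"], simp, simp only: 6 simp_thms, simp add: HF)
  next
    case 7
    show thesis
      by (rule that [of F "2" "0"], simp, simp only: 7 simp_thms, simp add: HF add.commute)
  next
    case 8
    show thesis
      by (rule that [of H "1" "1"], simp, simp only: 8 simp_thms, simp add: EF scaleC_one)
  next
    case 9
    show thesis
      by (rule that [of H "- 1" 1], simp, simp only: 9 simp_thms, simp add: FE)
  qed
qed

lemma current_D:
  assumes "X \<in> {E, H, F}"
  shows "\<rho> D (\<rho> (X n) v) = \<rho> (X n) (\<rho> D v) - of_int n *\<^sub>C \<rho> (X n) v"
  using assms by (auto simp: DE DH DF)

lemma current_H:
  assumes "X \<in> {E, H, F}"
  shows "\<exists>c\<le>1. \<forall>n v. \<rho> (H 0) (\<rho> (X n) v) = \<rho> (X n) (\<rho> (H 0) v) + of_int (2 * c) *\<^sub>C \<rho> (X n) v"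
  using assms
proof (elim insertE emptyE)
  show ?thesis if "X = E" using that by (intro exI [of _ 1]) (simp add: HE)
  show ?thesis if "X = H" using that by (intro exI [of _ 0]) (use HH [of 0] in simp)
  show ?thesis if "X = F" using that by (intro exI [of _ "- 1"]) (simp add: HF)
qed

text \<open>
  The Chevalley generators and \<open>d\<close> generate the whole algebra: \<open>h\<^sub>\<plusminus>\<^sub>1\<close> are brackets of generators,
  and they shift the index of \<open>e\<^sub>n\<close> and \<open>f\<^sub>n\<close>.
\<close>

lemma submodule_if_chevalley_closed:
  assumes S: "complex_vector.subspace S"
    and E0: "\<And>v. v \<in> S \<Longrightarrow> \<rho> (E 0) v \<in> S" and F0: "\<And>v. v \<in> S \<Longrightarrow> \<rho> (F 0) v \<in> S"
    and F1: "\<And>v. v \<in> S \<Longrightarrow> \<rho> (F 1) v \<in> S" and E1: "\<And>v. v \<in> S \<Longrightarrow> \<rho> (E (- 1)) v \<in> S"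
    and D: "\<And>v. v \<in> S \<Longrightarrow> \<rho> D v \<in> S"
  shows "submodule \<rho> S"
proof -
  note sub = complex_vector.subspace_diff [OF S] complex_vector.subspace_add [OF S]
  have half: "x \<in> S" if "2 *\<^sub>C x \<in> S" for x
    using complex_vector.subspace_scale [OF S that, of "1/2"] by (simp add: scaleC_scaleC scaleC_one)
  have H0: "\<rho> (H 0) v \<in> S" if "v \<in> S" for v
  proof -
    have "\<rho> (H 0) v = \<rho> (E 0) (\<rho> (F 0) v) - \<rho> (F 0) (\<rho> (E 0) v)" by (simp add: EF)
    then show ?thesis using that by (simp add: sub E0 F0)
  qed
  have K: "\<rho> K v \<in> S" if "v \<in> S" for v
  proof -
    have "\<rho> K v = \<rho> (F 1) (\<rho> (E (- 1)) v) - \<rho> (E (- 1)) (\<rho> (F 1) v) + \<rho> (H 0) v"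
      by (simp add: sl1.ef)
    then show ?thesis using that by (simp add: sub E1 F1 H0)
  qed
  have H1: "\<rho> (H 1) v \<in> S" if "v \<in> S" for v
  proof -
    have "\<rho> (H 1) v = \<rho> (E 0) (\<rho> (F 1) v) - \<rho> (F 1) (\<rho> (E 0) v)" by (simp add: EF)
    then show ?thesis using that by (simp add: sub E0 F1)
  qed
  have Hm1: "\<rho> (H (- 1)) v \<in> S" if "v \<in> S" for v
  proof -
    have "\<rho> (H (- 1)) v = \<rho> (E (- 1)) (\<rho> (F 0) v) - \<rho> (F 0) (\<rho> (E (- 1)) v)" by (simp add: EF)
    then show ?thesis using that by (simp add: sub E1 F0)
  qed
  have En: "\<forall>v\<in>S. \<rho> (E n) v \<in> S" for n
  proof (induction n rule: int_induct [where k = 0])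
    case (step1 i)
    have eq: "2 *\<^sub>C \<rho> (E (i + 1)) v = \<rho> (H 1) (\<rho> (E i) v) - \<rho> (E i) (\<rho> (H 1) v)" for v
      by (simp add: HE add.commute)
    show ?case by (rule ballI, rule half) (use step1 in \<open>simp add: eq sub H1\<close>)
  next
    case (step2 i)
    have eq: "2 *\<^sub>C \<rho> (E (i - 1)) v = \<rho> (H (- 1)) (\<rho> (E i) v) - \<rho> (E i) (\<rho> (H (- 1)) v)" for v
      by (simp add: HE)
    show ?case by (rule ballI, rule half) (use step2 in \<open>simp add: eq sub Hm1\<close>)
  qed (simp add: E0)
  have Fn: "\<forall>v\<in>S. \<rho> (F n) v \<in> S" for n
  proof (induction n rule: int_induct [where k = 0])
    case (step1 i)
    have eq: "2 *\<^sub>C \<rho> (F (i + 1)) v = \<rho> (F i) (\<rho> (H 1) v) - \<rho> (H 1) (\<rho> (F i) v)" for v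
      by (simp add: HF add.commute)
    show ?case by (rule ballI, rule half) (use step1 in \<open>simp add: eq sub H1\<close>)
  next
    case (step2 i)
    have eq: "2 *\<^sub>C \<rho> (F (i - 1)) v = \<rho> (F i) (\<rho> (H (- 1)) v) - \<rho> (H (- 1)) (\<rho> (F i) v)" for v
      by (simp add: HF)
    show ?case by (rule ballI, rule half) (use step2 in \<open>simp add: eq sub Hm1\<close>)
  qed (simp add: F0)
  have Hn: "\<rho> (H n) v \<in> S" if "v \<in> S" for n v
  proof -
    have "\<rho> (H n) v = \<rho> (E n) (\<rho> (F 0) v) - \<rho> (F 0) (\<rho> (E n) v)" by (simp add: EF)
    then show ?thesis using that En F0 by (simp add: sub)
  qed
  have "\<rho> x v \<in> S" if "v \<in> S" for x v
    using that En Fn Hn K D by (cases x) auto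
  then show ?thesis using S by (simp add: submodule_def)
qed

text \<open>
  If the bracket \<open>z\<close> of \<open>x\<close> and \<open>y\<close> preserves the vectors on which \<open>x\<close> is nilpotent, then so does
  \<open>y\<close>, by induction on the nilpotency order.
\<close>

lemma nilpotent_commutator:
  assumes XY: "\<And>w. \<rho> x (\<rho> y w) = \<rho> y (\<rho> x w) + c *\<^sub>C z w"
    and z: "\<And>w n. (\<rho> x ^^ n) w = 0 \<Longrightarrow> \<exists>N. (\<rho> x ^^ N) (z w) = 0"
    and "(\<rho> x ^^ n) w = 0"
  shows "\<exists>N. (\<rho> x ^^ N) (\<rho> y w) = 0"
  using assms(3)
proof (induction n arbitrary: w)
  case 0
  then show ?case by (intro exI [of _ 0]) (simp add: rep_simps)
next
  case (Suc n)
  note lin = clinear_simps [OF clinear_funpow [OF clinear_rep]]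
  have "(\<rho> x ^^ n) (\<rho> x w) = 0" using Suc.prems by (simp only: funpow_Suc_right o_apply)
  then obtain M where M: "(\<rho> x ^^ M) (\<rho> y (\<rho> x w)) = 0" using Suc.IH by blast
  obtain N where N: "(\<rho> x ^^ N) (z w) = 0" using z Suc.prems by blast
  have "(\<rho> x ^^ (N + M)) (\<rho> y (\<rho> x w)) = 0" "(\<rho> x ^^ (N + M)) (z w) = 0"
    using clinear_funpow_eq_0_mono [OF clinear_rep] M N by auto
  then have "(\<rho> x ^^ Suc (N + M)) (\<rho> y w) = 0"
    by (simp only: funpow_Suc_right o_apply XY) (simp add: lin)
  then show ?case by blast
qed

text \<open>
  For a real root vector \<open>x\<close> repeated brackets with \<open>x\<close> end in zero, so the operators can be treated
  in the reverse order of these brackets.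
\<close>

lemma nilpotent_vectors_submodule:
  assumes "x \<in> {E 0, F 0, E (- 1)}"
  shows "submodule \<rho> {w. \<exists>n. (\<rho> x ^^ n) w = 0}" (is "submodule \<rho> ?S")
proof -
  note lin = clinear_simps [OF clinear_funpow [OF clinear_rep]]
  have S: "complex_vector.subspace ?S"
  proof (rule complex_vector.subspaceI)
    fix u w assume "u \<in> ?S" "w \<in> ?S"
    then obtain m n where "(\<rho> x ^^ m) u = 0" "(\<rho> x ^^ n) w = 0" by blast
    then have "(\<rho> x ^^ (n + m)) u = 0" "(\<rho> x ^^ (n + m)) w = 0"
      using clinear_funpow_eq_0_mono [OF clinear_rep] by auto
    then show "u + w \<in> ?S" by (auto simp: lin intro!: exI [of _ "n + m"])
  qed (auto simp: lin)
  have com: "\<exists>N. (\<rho> x ^^ N) (\<rho> y w) = 0"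
    if "\<And>w. \<rho> x (\<rho> y w) = \<rho> y (\<rho> x w)" "(\<rho> x ^^ n) w = 0" for y w n
    by (rule nilpotent_commutator [where c = 0 and z = "\<lambda>_. 0"]) (use that in \<open>auto simp: lin\<close>)
  consider "x = E 0" | "x = F 0" | "x = E (- 1)" using assms by blast
  then have "\<forall>y. \<forall>w\<in>?S. \<rho> y w \<in> ?S"
  proof cases
    case 1
    have e: "\<exists>N. (\<rho> x ^^ N) (\<rho> (E m) w) = 0" if "(\<rho> x ^^ n) w = 0" for n m w
      by (rule com [OF _ that]) (simp add: 1 EE)
    have h: "\<exists>N. (\<rho> x ^^ N) (\<rho> (H m) w) = 0" if "(\<rho> x ^^ n) w = 0" for n m w
      by (rule nilpotent_commutator [where z = "\<rho> (E m)" and c = "- 2", OF _ e that]) (simp_all add: 1 HE)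
    have f: "\<exists>N. (\<rho> x ^^ N) (\<rho> (F m) w) = 0" if "(\<rho> x ^^ n) w = 0" for n m w
      by (rule nilpotent_commutator [where z = "\<rho> (H m)" and c = "1", OF _ h that]) (simp_all add: 1 EF scaleC_one)
    have d: "\<exists>N. (\<rho> x ^^ N) (\<rho> D w) = 0" if "(\<rho> x ^^ n) w = 0" for n w
      by (rule com [OF _ that]) (simp add: 1 DE)
    have k: "\<exists>N. (\<rho> x ^^ N) (\<rho> K w) = 0" if "(\<rho> x ^^ n) w = 0" for n w
      by (rule com [OF _ that]) (simp add: Kx)
    show ?thesis
    proof (intro allI ballI)
      fix y w assume "w \<in> ?S"
      then show "\<rho> y w \<in> ?S" by (cases y) (use e h f d k in auto)
    qed
  next
    case 2
    have f: "\<exists>N. (\<rho> x ^^ N) (\<rho> (F m) w) = 0" if "(\<rho> x ^^ n) w = 0" for n m w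
      by (rule com [OF _ that]) (simp add: 2 FF)
    have h: "\<exists>N. (\<rho> x ^^ N) (\<rho> (H m) w) = 0" if "(\<rho> x ^^ n) w = 0" for n m w
      by (rule nilpotent_commutator [where z = "\<rho> (F m)" and c = "2", OF _ f that]) (simp_all add: 2 HF)
    have e: "\<exists>N. (\<rho> x ^^ N) (\<rho> (E m) w) = 0" if "(\<rho> x ^^ n) w = 0" for n m w
      by (rule nilpotent_commutator [where z = "\<rho> (H m)" and c = "- 1", OF _ h that]) (simp_all add: 2 EF scaleC_one)
    have d: "\<exists>N. (\<rho> x ^^ N) (\<rho> D w) = 0" if "(\<rho> x ^^ n) w = 0" for n w
      by (rule com [OF _ that]) (simp add: 2 DF)
    have k: "\<exists>N. (\<rho> x ^^ N) (\<rho> K w) = 0" if "(\<rho> x ^^ n) w = 0" for n w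
      by (rule com [OF _ that]) (simp add: Kx)
    show ?thesis
    proof (intro allI ballI)
      fix y w assume "w \<in> ?S"
      then show "\<rho> y w \<in> ?S" by (cases y) (use e h f d k in auto)
    qed
  next
    case 3
    have e: "\<exists>N. (\<rho> x ^^ N) (\<rho> (E m) w) = 0" if "(\<rho> x ^^ n) w = 0" for n m w
      by (rule com [OF _ that]) (simp add: 3 EE)
    have h: "\<exists>N. (\<rho> x ^^ N) (\<rho> (H m) w) = 0" if "(\<rho> x ^^ n) w = 0" for n m w
      by (rule nilpotent_commutator [where z = "\<rho> (E (m - 1))" and c = "- 2", OF _ e that]) (simp_all add: 3 HE)
    have k: "\<exists>N. (\<rho> x ^^ N) (\<rho> K w) = 0" if "(\<rho> x ^^ n) w = 0" for n w
      by (rule com [OF _ that]) (simp add: Kx)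
    have hk: "\<exists>N. (\<rho> x ^^ N) (\<rho> (H m) w - (if m = 0 then \<rho> K w else 0)) = 0"
      if "(\<rho> x ^^ n) w = 0" for n m w
    proof -
      have "\<rho> (H m) w \<in> ?S" "\<rho> K w \<in> ?S" using h [OF that] k [OF that] by auto
      then have "\<rho> (H m) w - (if m = 0 then \<rho> K w else 0) \<in> ?S"
        using complex_vector.subspace_diff [OF S] by (cases "m = 0") simp_all
      then show ?thesis by simp
    qed
    have f: "\<exists>N. (\<rho> x ^^ N) (\<rho> (F m) w) = 0" if "(\<rho> x ^^ n) w = 0" for n m w
    proof (rule nilpotent_commutator [where z = "\<lambda>w. \<rho> (H (m - 1)) w - (if m - 1 = 0 then \<rho> K w else 0)" and c = "1", OF _ hk that])
      fix w
      show "\<rho> x (\<rho> (F m) w) = \<rho> (F m) (\<rho> x w)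
          + 1 *\<^sub>C (\<rho> (H (m - 1)) w - (if m - 1 = 0 then \<rho> K w else 0))"
        by (auto simp: 3 EF scaleC_one)
    qed
    have d: "\<exists>N. (\<rho> x ^^ N) (\<rho> D w) = 0" if "(\<rho> x ^^ n) w = 0" for n w
      by (rule nilpotent_commutator [where z = "\<rho> (E (- 1))" and c = "- 1", OF _ e that]) (simp_all add: 3 DE scaleC_one)
    show ?thesis
    proof (intro allI ballI)
      fix y w assume "w \<in> ?S"
      then show "\<rho> y w \<in> ?S" by (cases y) (use e h f d k in auto)
    qed
  qed
  with S show ?thesis by (simp add: submodule_def)
qed

end

section \<open>The Casimir operator\<close>

text \<open>
  Twice the normally ordered sum \<open>\<Sum> (h\<^sub>-\<^sub>r h\<^sub>r / 2 + e\<^sub>-\<^sub>r f\<^sub>r + f\<^sub>-\<^sub>r e\<^sub>r)\<close> over all integers \<open>r\<close>, cut off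
  at \<open>|r| \<le> R\<close>. The contributions of \<open>r\<close> and \<open>- r\<close> are combined. On a vector killed by all
  high modes the value is the same for all large \<open>R\<close>.
\<close>

definition casimir_mode :: "'v::complex_vector rep \<Rightarrow> int \<Rightarrow> 'v \<Rightarrow> 'v" where
  "casimir_mode \<rho> r w = 2 *\<^sub>C \<rho> (H (- r)) (\<rho> (H r) w)
     + (4 *\<^sub>C \<rho> (E (- r)) (\<rho> (F r) w) + 4 *\<^sub>C \<rho> (F (- r)) (\<rho> (E r) w))"

primrec casimir :: "'v::complex_vector rep \<Rightarrow> nat \<Rightarrow> 'v \<Rightarrow> 'v" where
  "casimir \<rho> 0 w = \<rho> (H 0) (\<rho> (H 0) w) + 2 *\<^sub>C \<rho> (H 0) w + 4 *\<^sub>C \<rho> (F 0) (\<rho> (E 0) w)"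
| "casimir \<rho> (Suc R) w = casimir \<rho> R w + casimir_mode \<rho> (int (Suc R)) w"

context affine_sl2_rep
begin

lemmas scale_simps = rep_simps scaleC_add_right complex_vector.scale_right_diff_distrib scaleC_scaleC

lemma FE: "\<rho> (F m) (\<rho> (E n) v) = \<rho> (E n) (\<rho> (F m) v) - \<rho> (H (m + n)) v
    + (if m + n = 0 then of_int m *\<^sub>C \<rho> K v else 0)"
proof (cases "m + n = 0")
  case True
  then have "n = - m" by simp
  then show ?thesis using EF [of n m v] by simp
next
  case False
  then show ?thesis using EF [of n m v] by (simp add: add.commute)
qed

lemma clinear_casimir: "clinear (casimir \<rho> R)"
proof (induction R)
  case 0
  show ?case by (rule clinearI) (simp_all add: scale_simps add_ac mult.commute)
next
  case (Suc R)
  have "casimir \<rho> (Suc R) = (\<lambda>w. casimir \<rho> R w + casimir_mode \<rho> (int (Suc R)) w)" by auto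
  moreover have "clinear (casimir_mode \<rho> (int (Suc R)))"
    by (rule clinearI) (simp_all add: casimir_mode_def scale_simps add_ac mult.commute)
  ultimately show ?case using Suc by (simp only: clinear_plus)
qed

lemma casimir_F0: "casimir \<rho> R (\<rho> (F 0) w) = \<rho> (F 0) (casimir \<rho> R w)"
proof (induction R)
  case 0
  have a: "\<rho> (H 0) (\<rho> (F 0) w) = \<rho> (F 0) (\<rho> (H 0) w) - 2 *\<^sub>C \<rho> (F 0) w" for w
    using HF [of 0 0 w] by simp
  have b: "\<rho> (E 0) (\<rho> (F 0) w) = \<rho> (F 0) (\<rho> (E 0) w) + \<rho> (H 0) w"
    using EF [of 0 0 w] by simp
  have "4 *\<^sub>C x - 2 *\<^sub>C x = 2 *\<^sub>C x" for x :: 'v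
    using complex_vector.scale_left_diff_distrib [of 4 2 x] by simp
  then show ?case by (simp add: a b scale_simps)
next
  case (Suc R)
  define r where "r = int (Suc R)"
  have r: "r > 0" "r - 1 = int R" "- r = - int R - 1" by (simp_all add: r_def)
  have a: "\<rho> (H (- r)) (\<rho> (H r) (\<rho> (F 0) w)) = \<rho> (F 0) (\<rho> (H (- r)) (\<rho> (H r) w))
      - 2 *\<^sub>C \<rho> (F (- r)) (\<rho> (H r) w) - 2 *\<^sub>C \<rho> (H (- r)) (\<rho> (F r) w)"
    by (simp add: HF rep_simps)
  have b: "\<rho> (E (- r)) (\<rho> (F r) (\<rho> (F 0) w)) = \<rho> (F 0) (\<rho> (E (- r)) (\<rho> (F r) w))
      + \<rho> (H (- r)) (\<rho> (F r) w)"
    using EF [of "- r" 0 "\<rho> (F r) w"] r(1) by (simp add: FF [of r 0])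
  have c: "\<rho> (F (- r)) (\<rho> (E r) (\<rho> (F 0) w)) = \<rho> (F 0) (\<rho> (F (- r)) (\<rho> (E r) w))
      + \<rho> (F (- r)) (\<rho> (H r) w)"
    using EF [of r 0 w] r(1) by (simp add: FF [of "- r" 0] rep_simps)
  have "casimir_mode \<rho> r (\<rho> (F 0) w) = \<rho> (F 0) (casimir_mode \<rho> r w)"
    unfolding casimir_mode_def a b c by (simp add: scale_simps)
  then show ?case using Suc by (simp add: rep_simps r_def)
qed

text \<open>
  The commutators with the single modes telescope. What remains is a boundary term at mode \<open>R\<close>, the
  central term from mode \<open>1\<close>, and \<open>8 e\<^sub>-\<^sub>1\<close> from mode \<open>0\<close>, in total \<open>4 (c + 2) e\<^sub>-\<^sub>1\<close> at level
  \<open>c\<close> once the boundary term vanishes.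
\<close>

lemma casimir_E_minus_1: "casimir \<rho> R (\<rho> (E (- 1)) w) = \<rho> (E (- 1)) (casimir \<rho> R w)
    + (8 *\<^sub>C \<rho> (E (- 1)) w + (if R = 0 then 0 else 4 *\<^sub>C \<rho> (E (- 1)) (\<rho> K w)))
    + (4 *\<^sub>C \<rho> (E (- int R - 1)) (\<rho> (H (int R)) w) - 4 *\<^sub>C \<rho> (H (- int R - 1)) (\<rho> (E (int R)) w))"
proof (induction R)
  case 0
  have a: "\<rho> (H 0) (\<rho> (E (- 1)) w) = \<rho> (E (- 1)) (\<rho> (H 0) w) + 2 *\<^sub>C \<rho> (E (- 1)) w" for w
    using HE [of 0 "- 1" w] by simp
  have b: "\<rho> (F 0) (\<rho> (E (- 1)) w) = \<rho> (E (- 1)) (\<rho> (F 0) w) - \<rho> (H (- 1)) w" for w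
    using FE [of 0 "- 1" w] by simp
  have d: "x + 2 *\<^sub>C y + (2 *\<^sub>C y + 4 *\<^sub>C z) + (2 *\<^sub>C y' + 4 *\<^sub>C z) + (4 *\<^sub>C u - 4 *\<^sub>C t)
      = x + 2 *\<^sub>C y' + 4 *\<^sub>C u + (8 *\<^sub>C z + 0) + (4 *\<^sub>C y - 4 *\<^sub>C t)" for x y y' z u t :: 'v
    using scaleC_add_left [of 2 2 y] scaleC_add_left [of 4 4 z] by (simp add: algebra_simps)
  show ?case
    using d [of "\<rho> (E (- 1)) (\<rho> (H 0) (\<rho> (H 0) w))" "\<rho> (E (- 1)) (\<rho> (H 0) w)"
        "\<rho> (E (- 1)) w" "\<rho> (E (- 1)) (\<rho> (H 0) w)" "\<rho> (E (- 1)) (\<rho> (F 0) (\<rho> (E 0) w))"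
        "\<rho> (H (- 1)) (\<rho> (E 0) w)"]
    by (simp add: a b scale_simps EE [of 0])
next
  case (Suc R)
  define r where "r = int (Suc R)"
  have r: "r > 0" "r - 1 = int R" "- r = - int R - 1" by (simp_all add: r_def)
  have a: "\<rho> (H (- r)) (\<rho> (H r) (\<rho> (E (- 1)) w)) = \<rho> (E (- 1)) (\<rho> (H (- r)) (\<rho> (H r) w))
      + 2 *\<^sub>C \<rho> (E (- r - 1)) (\<rho> (H r) w) + 2 *\<^sub>C \<rho> (H (- r)) (\<rho> (E (r - 1)) w)"
    by (simp add: HE rep_simps)
  have b: "\<rho> (E (- r)) (\<rho> (F r) (\<rho> (E (- 1)) w)) = \<rho> (E (- 1)) (\<rho> (E (- r)) (\<rho> (F r) w))
      - \<rho> (E (- r)) (\<rho> (H (r - 1)) w) + (if r = 1 then \<rho> (E (- 1)) (\<rho> K w) else 0)"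
    using FE [of r "- 1" w] EE [of "- r" "- 1" "\<rho> (F r) w"]
    by (cases "r = 1") (simp_all add: rep_simps scaleC_one)
  have c: "\<rho> (F (- r)) (\<rho> (E r) (\<rho> (E (- 1)) w)) = \<rho> (E (- 1)) (\<rho> (F (- r)) (\<rho> (E r) w))
      - \<rho> (H (- r - 1)) (\<rho> (E r) w)"
    using FE [of "- r" "- 1" "\<rho> (E r) w"] r(1) by (simp add: EE [of r "- 1"])
  have "casimir_mode \<rho> r (\<rho> (E (- 1)) w) = \<rho> (E (- 1)) (casimir_mode \<rho> r w)
      + (if r = 1 then 4 *\<^sub>C \<rho> (E (- 1)) (\<rho> K w) else 0)
      + (4 *\<^sub>C \<rho> (E (- r - 1)) (\<rho> (H r) w) - 4 *\<^sub>C \<rho> (H (- r - 1)) (\<rho> (E r) w))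
      - (4 *\<^sub>C \<rho> (E (- r)) (\<rho> (H (r - 1)) w) - 4 *\<^sub>C \<rho> (H (- r)) (\<rho> (E (r - 1)) w))"
    unfolding casimir_mode_def a b c by (simp add: scale_simps)
  moreover have "r = 1 \<longleftrightarrow> R = 0" by (simp add: r_def)
  ultimately show ?case
    using Suc by (simp add: rep_simps r_def [symmetric] r(2) del: of_nat_Suc) (simp add: r(3))
qed

end

section \<open>Integrable highest weight modules\<close>

text \<open>
  Two spanning sets of the module generated by \<open>v0\<close>. The first consists of arbitrary products of currents
  of negative index applied to \<open>f\<^sub>0\<^sup>n v0\<close>, recorded with their degree, and shows that the degrees are
  bounded below with finite-dimensional components. The second uses only the two negative
  Chevalley generators, so that the Casimir operator has to be commuted with these alone.
\<close>

inductive lowered :: "'v::complex_vector rep \<Rightarrow> 'v \<Rightarrow> int \<Rightarrow> 'v \<Rightarrow> bool" for \<rho> v0 where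
  base: "lowered \<rho> v0 0 ((\<rho> (F 0) ^^ n) v0)"
| step: "lowered \<rho> v0 s w \<Longrightarrow> r > 0 \<Longrightarrow> X \<in> {E, H, F} \<Longrightarrow> lowered \<rho> v0 (s + r) (\<rho> (X (- r)) w)"

inductive chevalley_lowered :: "'v::complex_vector rep \<Rightarrow> 'v \<Rightarrow> 'v \<Rightarrow> bool" for \<rho> v0 where
  base: "chevalley_lowered \<rho> v0 v0"
| step: "chevalley_lowered \<rho> v0 w \<Longrightarrow> x \<in> {F 0, E (- 1)} \<Longrightarrow> chevalley_lowered \<rho> v0 (\<rho> x w)"

text \<open>
  Integrability is imposed on the highest weight vector only, where it can be checked for
  direct sums and tensor products. It spreads to the whole module that the vector generates.
\<close>

locale integrable_highest_weight = affine_sl2_rep \<rho> for \<rho> :: "'v::complex_vector rep" +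
  fixes v0 :: 'v and j c :: nat
  assumes nonzero: "v0 \<noteq> 0" and highest: "highest_weight_vector \<rho> v0"
    and wt_H: "\<rho> (H 0) v0 = of_nat j *\<^sub>C v0" and wt_K: "\<rho> K v0 = of_nat c *\<^sub>C v0"
    and wt_D: "\<rho> D v0 = 0"
    and nilpotent_F: "\<exists>n. (\<rho> (F 0) ^^ n) v0 = 0" and nilpotent_E: "\<exists>n. (\<rho> (E (- 1)) ^^ n) v0 = 0"
begin

definition grade :: "int \<Rightarrow> 'v set" where
  "grade s = complex_vector.span {w. lowered \<rho> v0 s w}"

definition hw_module :: "'v set" where
  "hw_module = generated_submodule \<rho> v0"

lemma submodule_module: "submodule \<rho> hw_module"
  unfolding hw_module_def by (rule submodule_generated)

lemmas module_subspace = submodule_subspace [OF submodule_module]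
  and module_closed = submodule_closed [OF submodule_module]

lemma v0_mem: "v0 \<in> hw_module"
  unfolding hw_module_def by (rule generated_submodule_mem)

lemma E0_v0: "\<rho> (E 0) v0 = 0" and positive_v0: "X \<in> {E, H, F} \<Longrightarrow> r > 0 \<Longrightarrow> \<rho> (X r) v0 = 0"
  using highest by (auto simp: highest_weight_vector_def)

lemma F0_top_power: "(\<rho> (F 0) ^^ Suc j) v0 = 0"
proof -
  obtain N where "(\<rho> (F 0) ^^ N) v0 = 0" using nilpotent_F by blast
  from sl0.highest_weight_nat [OF wt_H E0_v0 nonzero this]
  obtain n where "of_nat j = (of_nat n :: complex)" and n: "(\<rho> (F 0) ^^ Suc n) v0 = 0" by blast
  then have "n = j" using of_nat_eq_iff by metis
  with n show ?thesis by blast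
qed

lemma grade_subspace: "complex_vector.subspace (grade s)"
  by (simp add: grade_def)

lemma lowered_grade: "lowered \<rho> v0 s w \<Longrightarrow> w \<in> grade s"
  by (simp add: grade_def complex_vector.span_base)

lemma lowered_nonneg: "lowered \<rho> v0 s w \<Longrightarrow> s \<ge> 0"
  by (induction rule: lowered.induct) auto

lemma lowered_0: "lowered \<rho> v0 s w \<Longrightarrow> s = 0 \<Longrightarrow> \<exists>n. w = (\<rho> (F 0) ^^ n) v0"
  by (induction rule: lowered.induct) (use lowered_nonneg in fastforce)+

lemma grade_negative: "s < 0 \<Longrightarrow> grade s = {0}"
  using lowered_nonneg unfolding grade_def
  by (metis Collect_empty_eq complex_vector.span_empty not_less)

lemma lowered_K: "lowered \<rho> v0 s w \<Longrightarrow> \<rho> K w = of_nat c *\<^sub>C w"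
proof (induction rule: lowered.induct)
  case (base n)
  show ?case by (induction n) (auto simp: wt_K Kx rep_simps)
qed (simp add: Kx rep_simps)

lemma lowered_D: "lowered \<rho> v0 s w \<Longrightarrow> \<rho> D w = of_int s *\<^sub>C w"
proof (induction rule: lowered.induct)
  case (base n)
  show ?case by (induction n) (auto simp: wt_D DF rep_simps)
next
  case (step s w r X)
  then show ?case by (simp add: current_D rep_simps scaleC_add_left)
qed

lemma lowered_H:
  "lowered \<rho> v0 s w \<Longrightarrow> \<exists>a. \<rho> (H 0) w = of_int a *\<^sub>C w \<and> a \<le> int j + 2 * s"
proof (induction rule: lowered.induct)
  case (base n)
  have "\<rho> (H 0) ((\<rho> (F 0) ^^ n) v0) = of_int (int j - 2 * int n) *\<^sub>C (\<rho> (F 0) ^^ n) v0"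
    using sl0.h_f_pow [OF wt_H, of n] by simp
  then show ?case by (intro exI [of _ "int j - 2 * int n"]) simp
next
  case (step s w r X)
  then obtain a where a: "\<rho> (H 0) w = of_int a *\<^sub>C w" "a \<le> int j + 2 * s" by blast
  obtain b where b: "b \<le> 1"
    "\<And>n v. \<rho> (H 0) (\<rho> (X n) v) = \<rho> (X n) (\<rho> (H 0) v) + of_int (2 * b) *\<^sub>C \<rho> (X n) v"
    using current_H [OF step(3)] by blast
  have "\<rho> (H 0) (\<rho> (X (- r)) w) = of_int (a + 2 * b) *\<^sub>C \<rho> (X (- r)) w"
    by (simp only: a b(2) rep_simps scaleC_add_left of_int_add)
  then show ?case using a(2) b(1) step(2) by (intro exI [of _ "a + 2 * b"]) simp
qed

lemma negative_grade: "X \<in> {E, H, F} \<Longrightarrow> r > 0 \<Longrightarrow> w \<in> grade s \<Longrightarrow> \<rho> (X (- r)) w \<in> grade (s + r)"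
  unfolding grade_def
  by (rule clinear_span_mem [OF clinear_rep]) (auto intro: complex_vector.span_base lowered.step)

lemma F0_grade_0: "w \<in> grade 0 \<Longrightarrow> \<rho> (F 0) w \<in> grade 0"
  unfolding grade_def
proof (rule clinear_span_mem [OF clinear_rep])
  fix b assume "b \<in> {w. lowered \<rho> v0 0 w}"
  then obtain n where "b = (\<rho> (F 0) ^^ n) v0" using lowered_0 by blast
  then have "\<rho> (F 0) b = (\<rho> (F 0) ^^ Suc n) v0" by simp
  then show "\<rho> (F 0) b \<in> complex_vector.span {w. lowered \<rho> v0 0 w}"
    using lowered.base [of \<rho> v0 "Suc n"] by (metis complex_vector.span_base mem_Collect_eq)
qed auto

lemma current_F_pow_grade:
  assumes "q \<ge> 0" and "X \<in> {E, H, F}"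
  shows "\<rho> (X q) ((\<rho> (F 0) ^^ n) v0) \<in> grade (- q)"
  using assms(2)
proof (induction n arbitrary: X)
  case 0
  show ?case
  proof (cases "q = 0")
    case True
    have v0: "v0 \<in> grade 0" using lowered_grade [OF lowered.base [of \<rho> v0 0]] by simp
    show ?thesis using 0 True v0 F0_grade_0 grade_subspace
      by (auto simp: E0_v0 wt_H complex_vector.subspace_0 complex_vector.subspace_scale)
  next
    case False
    then show ?thesis using 0 assms(1) positive_v0 [of X q] grade_subspace
      by (simp add: complex_vector.subspace_0)
  qed
next
  case (Suc n)
  let ?w = "(\<rho> (F 0) ^^ n) v0"
  obtain Z a b where Z: "Z \<in> {E, H, F}" and com: "\<And>m n v. \<rho> (X m) (\<rho> (F n) v) =
    \<rho> (F n) (\<rho> (X m) v) + a *\<^sub>C \<rho> (Z (m + n)) v + (if m + n = 0 then (of_int m * b) *\<^sub>C \<rho> K v else 0)"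
    using current_bracket [of X F] Suc.prems by blast
  have "\<rho> (X q) ((\<rho> (F 0) ^^ Suc n) v0) = \<rho> (F 0) (\<rho> (X q) ?w) + a *\<^sub>C \<rho> (Z q) ?w"
    using com [of q 0 ?w] by auto
  moreover have "\<rho> (F 0) (\<rho> (X q) ?w) \<in> grade (- q)"
    using Suc.IH [OF Suc.prems] F0_grade_0 assms(1) grade_negative [of "- q"]
    by (cases "q = 0") (auto simp: rep_simps)
  ultimately show ?case
    using Suc.IH [OF Z] grade_subspace
    by (simp add: complex_vector.subspace_add complex_vector.subspace_scale)
qed

text \<open>
  The grades are compatible with the whole algebra, because commuting \<open>X\<^sub>q\<close>, \<open>q \<ge> 0\<close>, past a
  lowering operator leaves shorter products. Hence the products of lowering operators need no
  ordering to span the module.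
\<close>

lemma current_grade:
  assumes "X \<in> {E, H, F}" and "w \<in> grade s"
  shows "\<rho> (X q) w \<in> grade (s - q)"
proof -
  have main: "\<rho> (X q) w \<in> grade (s - q)" if "lowered \<rho> v0 s w" "X \<in> {E, H, F}" for X q w s
    using that
  proof (induction arbitrary: X q rule: lowered.induct)
    case (base n)
    show ?case
    proof (cases "q \<ge> 0")
      case True
      then show ?thesis using current_F_pow_grade base by simp
    next
      case False
      then show ?thesis
        using negative_grade [OF base, of "- q"] lowered_grade [OF lowered.base] by fastforce
    qed
  next
    case (step s w r Y)
    obtain Z a b where Z: "Z \<in> {E, H, F}" and com: "\<And>m n v. \<rho> (X m) (\<rho> (Y n) v) =
      \<rho> (Y n) (\<rho> (X m) v) + a *\<^sub>C \<rho> (Z (m + n)) v + (if m + n = 0 then (of_int m * b) *\<^sub>C \<rho> K v else 0)"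
      using current_bracket [OF step.prems step.hyps(3)] by blast
    have 1: "\<rho> (Y (- r)) (\<rho> (X q) w) \<in> grade (s + r - q)"
      using negative_grade [OF step.hyps(3,2) step.IH [OF step.prems]] by (simp add: algebra_simps)
    have 2: "\<rho> (Z (q - r)) w \<in> grade (s + r - q)"
      using step.IH [OF Z, of "q - r"] by (simp add: algebra_simps)
    have 3: "(if q - r = 0 then (of_int q * b) *\<^sub>C \<rho> K w else 0) \<in> grade (s + r - q)"
      using lowered_K [OF step.hyps(1)] lowered_grade [OF step.hyps(1)] grade_subspace
      by (simp add: complex_vector.subspace_0 complex_vector.subspace_scale)
    show ?case
      using com [of q "- r" w] 1 2 3 grade_subspace
      by (simp only: add_uminus_conv_diff complex_vector.subspace_add complex_vector.subspace_scale)
  qed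
  have "w \<in> complex_vector.span {w. lowered \<rho> v0 s w}" using assms(2) by (simp add: grade_def)
  then show ?thesis
    by (rule clinear_span_mem [OF clinear_rep _ grade_subspace]) (use main [OF _ assms(1)] in blast)
qed

lemma killed_by_high_modes: "X \<in> {E, H, F} \<Longrightarrow> w \<in> grade s \<Longrightarrow> r > s \<Longrightarrow> \<rho> (X r) w = 0"
  using current_grade [of X w s r] grade_negative [of "s - r"] by simp

lemma grade_D: "w \<in> grade s \<Longrightarrow> \<rho> D w = of_int s *\<^sub>C w"
  unfolding grade_def
  by (erule clinear_eq_on_span [OF clinear_rep clinear_scaled [OF clinear_ident]])
    (auto simp: lowered_D)

lemma module_eq: "hw_module = complex_vector.span {w. \<exists>s. lowered \<rho> v0 s w}" (is "_ = ?S")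
proof
  have grade_S: "grade s \<subseteq> ?S" for s
    unfolding grade_def by (rule complex_vector.span_mono) auto
  have "submodule \<rho> ?S"
    unfolding submodule_def
  proof (intro conjI allI ballI)
    fix x w assume w: "w \<in> ?S"
    show "\<rho> x w \<in> ?S"
    proof (rule clinear_span_mem [OF clinear_rep w])
      fix b assume "b \<in> {w. \<exists>s. lowered \<rho> v0 s w}"
      then obtain s where s: "lowered \<rho> v0 s b" by blast
      note b = lowered_grade [OF s]
      show "\<rho> x b \<in> ?S"
        using current_grade [OF _ b] grade_S subsetD [OF grade_S b]
        by (cases x) (auto simp: lowered_K [OF s] lowered_D [OF s] complex_vector.span_scale)
    qed simp
  qed simp
  moreover have "v0 \<in> ?S"
    using lowered.base [of \<rho> v0 0] by (auto intro!: complex_vector.span_base)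
  ultimately show "hw_module \<subseteq> ?S"
    unfolding hw_module_def by (rule generated_submodule_minimal)
  have "w \<in> hw_module" if "lowered \<rho> v0 s w" for w s
    using that by (induction rule: lowered.induct)
      (auto simp: module_closed submodule_funpow [OF submodule_module] v0_mem)
  then show "?S \<subseteq> hw_module"
    by (intro complex_vector.span_minimal module_subspace) auto
qed

lemma grade_module: "grade s \<subseteq> hw_module"
  unfolding grade_def module_eq by (rule complex_vector.span_mono) auto

lemma module_K: "w \<in> hw_module \<Longrightarrow> \<rho> K w = of_nat c *\<^sub>C w"
  unfolding module_eq
  by (erule clinear_eq_on_span [OF clinear_rep clinear_scaled [OF clinear_ident]])
    (auto simp: lowered_K)

lemma module_D_eigenvector:
  assumes "w \<in> hw_module" "\<rho> D w = of_int s *\<^sub>C w"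
  shows "w \<in> grade s"
proof -
  have "w \<in> complex_vector.span {b \<in> {w. \<exists>s. lowered \<rho> v0 s w}. \<rho> D b = of_int s *\<^sub>C b}"
    using assms lowered_D unfolding module_eq
    by (intro eigenvector_in_span [OF clinear_rep]) auto
  moreover have "b \<in> grade s" if "lowered \<rho> v0 t b" "\<rho> D b = of_int s *\<^sub>C b" for b t
  proof -
    have "(of_int t - of_int s) *\<^sub>C b = 0"
      using that(2) lowered_D [OF that(1)] by (simp add: complex_vector.scale_left_diff_distrib)
    then have "t = s \<or> b = 0" by (simp add: complex_vector.scale_eq_0_iff)
    then show ?thesis using lowered_grade [OF that(1)] grade_subspace
      by (auto simp: complex_vector.subspace_0)
  qed
  ultimately show ?thesis
    by (elim clinear_span_mem [OF clinear_ident _ grade_subspace]) auto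
qed

lemma module_decompose:
  assumes "w \<in> hw_module"
  obtains A y where "finite A" "A \<subseteq> of_int ` {0..}" "w = (\<Sum>a\<in>A. y a)"
    "\<And>a. a \<in> A \<Longrightarrow> \<rho> D (y a) = a *\<^sub>C y a" "\<And>a. a \<in> A \<Longrightarrow> y a \<in> hw_module"
proof -
  have "\<exists>a\<in>of_int ` {0..}. \<rho> D b = a *\<^sub>C b" if "b \<in> {w. \<exists>s. lowered \<rho> v0 s w}" for b
    using that lowered_D lowered_nonneg by fastforce
  from span_eigenvectors_decompose [OF clinear_rep assms [unfolded module_eq] this]
  obtain A y where A: "finite A" "A \<subseteq> of_int ` {0..}" "w = (\<Sum>a\<in>A. y a)"
    and y: "\<And>a. a \<in> A \<Longrightarrow> \<rho> D (y a) = a *\<^sub>C y a"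
    and m: "\<And>a. a \<in> A \<Longrightarrow>
      y a \<in> complex_vector.span {b \<in> {w. \<exists>s. lowered \<rho> v0 s w}. \<rho> D b = a *\<^sub>C b}"
    by blast
  have "y a \<in> hw_module" if "a \<in> A" for a
    using m [OF that] unfolding module_eq
    by (rule rev_subsetD [OF _ complex_vector.span_mono]) blast
  then show thesis using that [OF A y] by blast
qed

text \<open>
  Degree zero is spanned by the finitely many nonzero \<open>f\<^sub>0\<^sup>n v0\<close>, and a positive degree is reached from
  finitely many smaller ones by finitely many currents.
\<close>

lemma grade_finite: "\<exists>B. finite B \<and> grade s \<subseteq> complex_vector.span B"
proof -
  have "\<exists>B. finite B \<and> grade (int n) \<subseteq> complex_vector.span B" for n
  proof (induction n rule: less_induct)
    case (less n)
    show ?case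
    proof (cases "n = 0")
      case True
      obtain N where N: "(\<rho> (F 0) ^^ N) v0 = 0" using nilpotent_F by blast
      let ?B = "insert 0 ((\<lambda>n. (\<rho> (F 0) ^^ n) v0) ` {..<N})"
      have "(\<rho> (F 0) ^^ n) v0 \<in> ?B" for n
        using clinear_funpow_eq_0_mono [OF clinear_rep N, of n] by (cases "n < N") auto
      then have "{w. lowered \<rho> v0 0 w} \<subseteq> ?B" using lowered_0 by blast
      then have "grade (int n) \<subseteq> complex_vector.span ?B"
        using True unfolding grade_def by (simp only: complex_vector.span_mono of_nat_0)
      then show ?thesis by (intro exI [of _ ?B]) simp
    next
      case False
      obtain B where B: "\<And>m. m < n \<Longrightarrow> finite (B m) \<and> grade (int m) \<subseteq> complex_vector.span (B m)"
        using less by metis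
      define C where "C = (\<Union>m<n. \<Union>X\<in>{E, H, F}. \<rho> (X (- int (n - m))) ` B m)"
      have fin: "finite C" using B by (auto simp: C_def)
      have "w \<in> complex_vector.span C" if "lowered \<rho> v0 (int n) w" for w
        using that
      proof (cases rule: lowered.cases)
        case base
        with False show ?thesis by simp
      next
        case (step s w' r X)
        define m where "m = nat s"
        have m: "s = int m" "m < n" "r = int (n - m)"
          using step lowered_nonneg [OF step(3)] by (auto simp: m_def)
        have "w' \<in> complex_vector.span (B m)"
          using lowered_grade [OF step(3)] B [OF m(2)] m by auto
        then have "\<rho> (X (- r)) w' \<in> complex_vector.span C"
        proof (rule clinear_span_mem [OF clinear_rep])
          fix b assume "b \<in> B m"
          then have "\<rho> (X (- r)) b \<in> C" using step(5) m unfolding C_def by blast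
          then show "\<rho> (X (- r)) b \<in> complex_vector.span C" by (rule complex_vector.span_base)
        qed simp
        then show ?thesis using step by simp
      qed
      then have "grade (int n) \<subseteq> complex_vector.span C"
        unfolding grade_def by (intro complex_vector.span_minimal) auto
      with fin show ?thesis by blast
    qed
  qed
  from this [of "nat s"] show ?thesis
    using grade_negative [of s] by (cases "s \<ge> 0") (auto simp: complex_vector.span_zero)
qed

lemma chevalley_lowered_grade: "chevalley_lowered \<rho> v0 w \<Longrightarrow> \<exists>s. w \<in> grade s"
proof (induction rule: chevalley_lowered.induct)
  case base
  show ?case using lowered_grade [OF lowered.base [of \<rho> v0 0]] by auto
next
  case (step w x)
  then obtain s where "w \<in> grade s" by blast
  then have "\<rho> (F 0) w \<in> grade s" "\<rho> (E (- 1)) w \<in> grade (s + 1)"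
    using current_grade [of F w s 0] current_grade [of E w s "- 1"] by auto
  then show ?case using step(2) by blast
qed

lemma chevalley_lowered_H: "chevalley_lowered \<rho> v0 w \<Longrightarrow> \<exists>a. \<rho> (H 0) w = a *\<^sub>C w"
proof (induction rule: chevalley_lowered.induct)
  case base
  show ?case using wt_H by blast
next
  case (step w x)
  then obtain a where "\<rho> (H 0) w = a *\<^sub>C w" by blast
  then have "\<rho> (H 0) (\<rho> (F 0) w) = (a - 2) *\<^sub>C \<rho> (F 0) w"
    "\<rho> (H 0) (\<rho> (E (- 1)) w) = (a + 2) *\<^sub>C \<rho> (E (- 1)) w"
    by (simp_all add: HE HF rep_simps scaleC_add_left complex_vector.scale_left_diff_distrib)
  then show ?case using step(2) by blast
qed

text \<open>
  A positive Chevalley generator commutes with the negative one of the other simple root, and its bracket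
  with its own partner is diagonal, so it maps products of negative generators to combinations of shorter
  ones.
\<close>

lemma module_chevalley: "hw_module \<subseteq> complex_vector.span {w. chevalley_lowered \<rho> v0 w}" (is "_ \<subseteq> ?S")
proof -
  have sub: "complex_vector.subspace ?S" by simp
  have mem: "w \<in> ?S" if "chevalley_lowered \<rho> v0 w" for w
    using that by (simp add: complex_vector.span_base)
  have lower: "\<rho> x w \<in> ?S" if "w \<in> ?S" "x \<in> {F 0, E (- 1)}" for x w
    using that by (intro clinear_span_mem [OF clinear_rep that(1) sub] mem)
      (simp add: chevalley_lowered.step)
  have diag: "\<rho> (H 0) w \<in> ?S \<and> \<rho> D w \<in> ?S \<and> \<rho> K w \<in> ?S" if w: "chevalley_lowered \<rho> v0 w" for w
    using chevalley_lowered_H [OF w] chevalley_lowered_grade [OF w] mem [OF w]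
    by (auto simp: complex_vector.span_scale grade_D module_K [OF subsetD [OF grade_module]])
  have raise: "\<rho> (E 0) w \<in> ?S \<and> \<rho> (F 1) w \<in> ?S" if "chevalley_lowered \<rho> v0 w" for w
    using that
  proof (induction rule: chevalley_lowered.induct)
    case base
    show ?case using E0_v0 positive_v0 [of F 1] by (simp add: complex_vector.span_zero)
  next
    case (step w x)
    have "\<rho> (E 0) (\<rho> (F 0) w) \<in> ?S" "\<rho> (F 1) (\<rho> (F 0) w) \<in> ?S"
      using step(3) diag [OF step(1)] lower [of "\<rho> (E 0) w" "F 0"] lower [of "\<rho> (F 1) w" "F 0"]
      by (simp_all add: sl0.ef complex_vector.span_add FF [of 1 0])
    moreover have "\<rho> (E 0) (\<rho> (E (- 1)) w) \<in> ?S" "\<rho> (F 1) (\<rho> (E (- 1)) w) \<in> ?S"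
      using step(3) diag [OF step(1)]
        lower [of "\<rho> (E 0) w" "E (- 1)"] lower [of "\<rho> (F 1) w" "E (- 1)"]
      by (simp_all add: sl1.ef complex_vector.span_add complex_vector.span_diff EE [of 0 "- 1"])
    ultimately show ?case using step(2) by blast
  qed
  have "submodule \<rho> ?S"
  proof (rule submodule_if_chevalley_closed [OF sub])
    fix w assume w: "w \<in> ?S"
    show "\<rho> (E 0) w \<in> ?S" "\<rho> (F 1) w \<in> ?S" "\<rho> D w \<in> ?S"
      by (rule clinear_span_mem [OF clinear_rep w sub]; use raise diag in blast)+
    show "\<rho> (F 0) w \<in> ?S" "\<rho> (E (- 1)) w \<in> ?S"
      using lower [OF w] by auto
  qed
  then show ?thesis
    unfolding hw_module_def
    by (rule generated_submodule_minimal) (rule mem [OF chevalley_lowered.base])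
qed

lemma casimir_highest:
  assumes "highest_weight_vector \<rho> w"
  shows "casimir \<rho> R w = \<rho> (H 0) (\<rho> (H 0) w) + 2 *\<^sub>C \<rho> (H 0) w"
  using assms
  by (induction R) (simp_all add: highest_weight_vector_def casimir_mode_def rep_simps)

text \<open>
  The Casimir operator has the same commutators with \<open>f\<^sub>0\<close> and \<open>e\<^sub>-\<^sub>1\<close> as \<open>4 (c + 2) d\<close>, so their
  difference acts on the module by its value on the highest weight vector.
\<close>

lemma casimir_module:
  assumes "w \<in> hw_module"
  shows "\<exists>R0. \<forall>R\<ge>R0. casimir \<rho> R w
    = (4 * (of_nat c + 2)) *\<^sub>C \<rho> D w + (of_nat j * (of_nat j + 2)) *\<^sub>C w"
proof -
  let ?P = "\<lambda>R w. casimir \<rho> R w = (4 * (of_nat c + 2)) *\<^sub>C \<rho> D w + (of_nat j * (of_nat j + 2)) *\<^sub>C w"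
  let ?Z = "{w. \<exists>R0. \<forall>R\<ge>R0. ?P R w}"
  note cas = clinear_simps [OF clinear_casimir]
  have sub: "complex_vector.subspace ?Z"
  proof (rule complex_vector.subspaceI)
    show "0 \<in> ?Z" by (auto simp: cas rep_simps)
  next
    fix x y assume "x \<in> ?Z" "y \<in> ?Z"
    then obtain R0 R1 where "\<forall>R\<ge>R0. ?P R x" "\<forall>R\<ge>R1. ?P R y" by blast
    then have "\<forall>R\<ge>max R0 R1. ?P R (x + y)"
      by (simp add: cas rep_simps scaleC_add_right)
    then show "x + y \<in> ?Z" by blast
  next
    fix a x assume "x \<in> ?Z"
    then obtain R0 where "\<forall>R\<ge>R0. ?P R x" by blast
    then have "\<forall>R\<ge>R0. ?P R (a *\<^sub>C x)"
      by (simp add: cas rep_simps scaleC_add_right scaleC_scaleC mult.commute)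
    then show "a *\<^sub>C x \<in> ?Z" by blast
  qed
  have "w \<in> ?Z" if "chevalley_lowered \<rho> v0 w" for w
    using that
  proof (induction rule: chevalley_lowered.induct)
    case base
    have "?P R v0" for R
      by (simp add: casimir_highest [OF highest] wt_H wt_D rep_simps scaleC_scaleC
          distrib_left scaleC_add_left mult.commute)
    then show ?case by blast
  next
    case (step w x)
    then obtain R0 where R0: "\<forall>R\<ge>R0. ?P R w" by blast
    obtain s where s: "w \<in> grade s" using chevalley_lowered_grade [OF step(1)] by blast
    show ?case
    proof (cases "x = F 0")
      case True
      have "\<forall>R\<ge>R0. ?P R (\<rho> x w)"
        using R0 by (simp add: True casimir_F0 rep_simps DF)
      then show ?thesis by blast
    next
      case False
      then have x: "x = E (- 1)" using step(2) by simp
      have "?P R (\<rho> x w)" if R: "R \<ge> max R0 (nat s + 1)" for R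
      proof -
        have "int R > s" "R \<noteq> 0" using R by auto
        then have "\<rho> (E (int R)) w = 0" "\<rho> (H (int R)) w = 0"
          using killed_by_high_modes [OF _ s] by auto
        then have "casimir \<rho> R (\<rho> x w) = \<rho> x (casimir \<rho> R w) + (8 *\<^sub>C \<rho> x w + (4 * of_nat c) *\<^sub>C \<rho> x w)"
          using \<open>R \<noteq> 0\<close>
          by (simp add: x casimir_E_minus_1 rep_simps module_K [OF subsetD [OF grade_module s]] scaleC_scaleC)
        moreover have "8 *\<^sub>C y + (4 * of_nat c) *\<^sub>C y = (4 * (of_nat c + 2)) *\<^sub>C y" for y :: 'v
          by (simp add: scaleC_add_left [symmetric] distrib_left add.commute)
        ultimately show ?thesis
          using R0 R by (simp add: x DE rep_simps scaleC_add_right scaleC_one scaleC_scaleC mult.commute)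
      qed
      then show ?thesis by blast
    qed
  qed
  then have "complex_vector.span {w. chevalley_lowered \<rho> v0 w} \<subseteq> ?Z"
    by (intro complex_vector.span_minimal sub) auto
  then show ?thesis using assms module_chevalley by blast
qed

lemma module_nilpotent:
  assumes "w \<in> hw_module" "x \<in> {E 0, F 0, E (- 1)}"
  shows "\<exists>n. (\<rho> x ^^ n) w = 0"
proof -
  have "\<exists>n. (\<rho> x ^^ n) v0 = 0"
    using assms(2) nilpotent_E nilpotent_F E0_v0 by (auto intro: exI [of _ 1])
  then have "hw_module \<subseteq> {w. \<exists>n. (\<rho> x ^^ n) w = 0}"
    unfolding hw_module_def
    by (intro generated_submodule_minimal nilpotent_vectors_submodule [OF assms(2)]) simp
  then show ?thesis using assms(1) by blast
qed

text \<open>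
  A highest weight vector of weight \<open>a\<close> in degree \<open>s\<close> satisfies
  \<open>(a - j) (a + j + 2) = 4 (c + 2) s\<close> by the Casimir operator, where \<open>a, j \<le> c\<close> by integrability
  and \<open>a - j \<le> 2 s\<close>. Then \<open>s > 0\<close> is impossible, and \<open>s = 0\<close> forces \<open>a = j\<close>.
\<close>

lemma highest_weight_eigenvector:
  assumes z: "z \<in> grade s" and hw: "highest_weight_vector \<rho> z" and s: "s \<ge> 0"
    and H: "\<rho> (H 0) z = of_int a *\<^sub>C z" and a: "a \<le> int j + 2 * s"
  shows "z \<in> complex_vector.span {v0}"
proof (cases "z = 0")
  case False
  have zm: "z \<in> hw_module" using grade_module z by blast
  have e: "\<rho> (E 0) z = 0" "\<rho> (F 1) z = 0" using hw by (auto simp: highest_weight_vector_def)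
  obtain N where "(\<rho> (F 0) ^^ N) z = 0" using module_nilpotent [OF zm] by blast
  from sl0.highest_weight_nat [OF H e(1) False this] obtain n
    where "complex_of_int a = of_nat n" by blast
  then have a0: "a \<ge> 0" by (metis of_int_eq_iff of_int_of_nat_eq of_nat_0_le_iff)
  have le_c: "b \<le> int c" if hyp: "\<rho> (H 0) z' = of_int b *\<^sub>C z'" "\<rho> (F 1) z' = 0" "z' \<in> hw_module" "z' \<noteq> 0" for b z'
  proof -
    obtain N where N: "(\<rho> (E (- 1)) ^^ N) z' = 0" using module_nilpotent [OF hyp(3)] by blast
    have "\<rho> K z' - \<rho> (H 0) z' = of_int (int c - b) *\<^sub>C z'"
      by (simp add: module_K [OF hyp(3)] hyp(1) complex_vector.scale_left_diff_distrib)
    from sl1.highest_weight_nat [OF this hyp(2,4) N] obtain n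
      where "complex_of_int (int c - b) = of_nat n" by blast
    then show ?thesis by (metis diff_ge_0_iff_ge of_int_eq_iff of_int_of_nat_eq of_nat_0_le_iff)
  qed
  have ac: "a \<le> int c" by (rule le_c [OF H e(2) zm False])
  have jc: "int j \<le> int c"
    by (rule le_c [of v0]) (use wt_H positive_v0 [of F 1] v0_mem nonzero in auto)
  obtain R where "casimir \<rho> R z
      = (4 * (of_nat c + 2)) *\<^sub>C \<rho> D z + (of_nat j * (of_nat j + 2)) *\<^sub>C z"
    using casimir_module [OF zm] by blast
  then have "of_int (a * a + 2 * a) *\<^sub>C z = of_int (4 * (int c + 2) * s + int j * (int j + 2)) *\<^sub>C z"
    by (simp add: casimir_highest [OF hw] H rep_simps scaleC_scaleC grade_D [OF z] scaleC_add_left)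
  then have "complex_of_int (a * a + 2 * a) = of_int (4 * (int c + 2) * s + int j * (int j + 2))"
    using False by (simp only: complex_vector.scale_cancel_right) simp
  then have "a * a + 2 * a = 4 * (int c + 2) * s + int j * (int j + 2)"
    by (simp only: of_int_eq_iff)
  then have eq: "(a - int j) * (a + int j + 2) = 4 * (int c + 2) * s"
    by (simp add: algebra_simps)
  have s0: "s = 0"
  proof (rule ccontr)
    assume "s \<noteq> 0"
    with s have s1: "s \<ge> 1" by simp
    have "(a - int j) * (a + int j + 2) \<le> (2 * s) * (a + int j + 2)"
      using a a0 by (intro mult_right_mono) auto
    also have "\<dots> \<le> (2 * s) * (2 * int c + 2)"
      using s ac jc by (intro mult_left_mono) auto
    also have "\<dots> < 4 * (int c + 2) * s" using s1 by (simp add: algebra_simps)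
    finally show False using eq by simp
  qed
  with eq a0 have aj: "a = int j" by auto
  have "z \<in> complex_vector.span {b \<in> {w. lowered \<rho> v0 0 w}. \<rho> (H 0) b = of_nat j *\<^sub>C b}"
    using z H lowered_H unfolding s0 grade_def aj of_int_of_nat_eq
    by (intro eigenvector_in_span [OF clinear_rep]) auto
  then show ?thesis
  proof (rule clinear_span_mem [OF clinear_ident])
    fix b assume "b \<in> {b \<in> {w. lowered \<rho> v0 0 w}. \<rho> (H 0) b = of_nat j *\<^sub>C b}"
    then obtain n where b: "b = (\<rho> (F 0) ^^ n) v0" "\<rho> (H 0) b = of_nat j *\<^sub>C b"
      using lowered_0 by blast
    then have "(of_nat j - 2 * of_nat n) *\<^sub>C b - of_nat j *\<^sub>C b = 0"
      using sl0.h_f_pow [OF wt_H, of n] by simp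
    then have "(- (2 * of_nat n) :: complex) *\<^sub>C b = 0"
      by (simp only: complex_vector.scale_left_diff_distrib [symmetric]) simp
    then have "n = 0 \<or> b = 0" by simp
    then show "b \<in> complex_vector.span {v0}"
      using b by (auto simp: complex_vector.span_zero complex_vector.span_base)
  qed simp
qed (simp add: complex_vector.span_zero)

lemma highest_weight_vector_subspace: "complex_vector.subspace {w. highest_weight_vector \<rho> w}"
  by (rule complex_vector.subspaceI) (auto simp: highest_weight_vector_def rep_simps)

lemma highest_weight_vector_D: "highest_weight_vector \<rho> w \<Longrightarrow> highest_weight_vector \<rho> (\<rho> D w)"
proof -
  assume w: "highest_weight_vector \<rho> w"
  have "\<rho> (X r) (\<rho> D w) = 0" if "X \<in> {E, H, F}" "\<rho> (X r) w = 0" for X r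
    using current_D [OF that(1), of r w] that(2) by (simp add: rep_simps)
  then show ?thesis using w by (auto simp: highest_weight_vector_def)
qed

lemma highest_weight_vector_H: "highest_weight_vector \<rho> w \<Longrightarrow> highest_weight_vector \<rho> (\<rho> (H 0) w)"
proof -
  assume w: "highest_weight_vector \<rho> w"
  have "\<rho> (X r) (\<rho> (H 0) w) = 0" if X: "X \<in> {E, H, F}" and "\<rho> (X r) w = 0" for X r
  proof -
    obtain c where c: "\<And>n v. \<rho> (H 0) (\<rho> (X n) v) = \<rho> (X n) (\<rho> (H 0) v) + of_int (2 * c) *\<^sub>C \<rho> (X n) v"
      using current_H [OF X] by blast
    show ?thesis using c [of r w] that(2) by (simp add: rep_simps)
  qed
  then show ?thesis using w by (auto simp: highest_weight_vector_def)
qed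

text \<open>
  The operators \<open>d\<close> and \<open>h\<^sub>0\<close> preserve the space of highest weight vectors, so the joint
  eigencomponents of a highest weight vector are highest weight vectors.
\<close>

theorem highest_weight_vector_unique:
  assumes "w \<in> hw_module" and "highest_weight_vector \<rho> w"
  shows "w \<in> complex_vector.span {v0}"
proof -
  note hw_sub = highest_weight_vector_subspace
  obtain A y where A: "finite A" "A \<subseteq> of_int ` {0..}" and w: "w = (\<Sum>a\<in>A. y a)"
    and yD: "\<And>a. a \<in> A \<Longrightarrow> \<rho> D (y a) = a *\<^sub>C y a" and ym: "\<And>a. a \<in> A \<Longrightarrow> y a \<in> hw_module"
    using module_decompose [OF assms(1)] by blast
  have y_hw: "y a \<in> {w. highest_weight_vector \<rho> w}" if "a \<in> A" for a
    by (rule eigencomponent_mem [OF clinear_rep hw_sub _ A(1) yD _ that])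
      (use assms(2) w highest_weight_vector_D in auto)
  have "y a \<in> complex_vector.span {v0}" if a: "a \<in> A" for a
  proof -
    obtain s where s: "a = of_int s" "s \<ge> 0" using A(2) a by auto
    have ys: "y a \<in> grade s" using module_D_eigenvector ym [OF a] yD [OF a] s by blast
    have "\<exists>b\<in>of_int ` {..int j + 2 * s}. \<rho> (H 0) x = b *\<^sub>C x" if "x \<in> {w. lowered \<rho> v0 s w}" for x
      using lowered_H that by blast
    from span_eigenvectors_decompose [OF clinear_rep ys [unfolded grade_def] this]
    obtain B z where B: "finite B" "B \<subseteq> of_int ` {..int j + 2 * s}" and yz: "y a = (\<Sum>b\<in>B. z b)"
      and zH: "\<And>b. b \<in> B \<Longrightarrow> \<rho> (H 0) (z b) = b *\<^sub>C z b"
      and "\<And>b. b \<in> B \<Longrightarrow>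
        z b \<in> complex_vector.span {x \<in> {w. lowered \<rho> v0 s w}. \<rho> (H 0) x = b *\<^sub>C x}"
      by blast
    let ?S = "{w. highest_weight_vector \<rho> w} \<inter> grade s"
    have sub: "complex_vector.subspace ?S"
      by (rule complex_vector.subspace_inter [OF hw_sub grade_subspace])
    have "z b \<in> complex_vector.span {v0}" if b: "b \<in> B" for b
    proof -
      have "z b \<in> ?S"
      proof (rule eigencomponent_mem [OF clinear_rep sub _ B(1) zH _ b])
        show "\<rho> (H 0) x \<in> ?S" if "x \<in> ?S" for x
          using that highest_weight_vector_H current_grade [of H x s 0] by auto
        show "(\<Sum>b\<in>B. z b) \<in> ?S" using y_hw [OF a] ys yz by simp
      qed
      then show ?thesis
        using highest_weight_eigenvector [of "z b" s] zH [OF b] B(2) b s(2) by auto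
    qed
    then show ?thesis unfolding yz by (rule complex_vector.span_sum)
  qed
  then show ?thesis unfolding w by (rule complex_vector.span_sum)
qed

text \<open>
  A vector of minimal degree in a submodule is killed by all currents of positive index.
  Raising it by \<open>e\<^sub>0\<close> as often as possible gives a highest weight vector.
\<close>

corollary module_irreducible:
  assumes N: "submodule \<rho> N" and sub: "N \<subseteq> hw_module" and x: "x \<in> N" "x \<noteq> 0"
  shows "N = hw_module"
proof -
  note NS = submodule_subspace [OF N]
  define P where "P n \<longleftrightarrow> (\<exists>x\<in>N. x \<noteq> 0 \<and> x \<in> grade (int n))" for n
  have "\<exists>n. P n"
  proof -
    obtain A y where A: "finite A" "A \<subseteq> of_int ` {0..}" and xy: "x = (\<Sum>a\<in>A. y a)"
      and yD: "\<And>a. a \<in> A \<Longrightarrow> \<rho> D (y a) = a *\<^sub>C y a" and ym: "\<And>a. a \<in> A \<Longrightarrow> y a \<in> hw_module"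
      using module_decompose x(1) sub by blast
    have yN: "y a \<in> N" if "a \<in> A" for a
      by (rule eigencomponent_mem [OF clinear_rep NS _ A(1) yD _ that])
        (use x xy submodule_closed [OF N] in auto)
    obtain a where a: "a \<in> A" "y a \<noteq> 0" using x(2) xy by (metis sum.neutral)
    then obtain s where s: "a = of_int s" "s \<ge> 0" using A(2) by auto
    then have "y a \<in> grade (int (nat s))"
      using module_D_eigenvector ym [OF a(1)] yD [OF a(1)] by simp
    then show ?thesis using a yN unfolding P_def by blast
  qed
  then obtain n where n: "P n" "\<And>m. m < n \<Longrightarrow> \<not> P m"
    using exists_least_iff [of P] by blast
  then obtain u where u: "u \<in> N" "u \<noteq> 0" "u \<in> grade (int n)" unfolding P_def by blast
  define y where "y q = (\<rho> (E 0) ^^ q) u" for q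
  have y_grade: "y q \<in> grade (int n)" for q
    by (induction q) (use u current_grade [of E _ "int n" 0] in \<open>auto simp: y_def\<close>)
  have yN: "y q \<in> N" for q unfolding y_def by (rule submodule_funpow [OF N u(1)])
  define q where "q = (LEAST q. y q = 0)"
  obtain N0 where "y N0 = 0" using module_nilpotent [of u "E 0"] u sub by (auto simp: y_def)
  then have yq: "y q = 0" unfolding q_def by (rule LeastI)
  then obtain p where p: "q = Suc p" using u(2) by (cases q) (auto simp: y_def)
  have yp: "y p \<noteq> 0" using not_less_Least [of p "\<lambda>q. y q = 0"] p unfolding q_def by auto
  have kill: "\<rho> (X r) (y p) = 0" if X: "X \<in> {E, H, F}" and r: "r > 0" for X r
  proof (rule ccontr)
    assume ne: "\<rho> (X r) (y p) \<noteq> 0"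
    have g: "\<rho> (X r) (y p) \<in> grade (int n - r)" by (rule current_grade [OF X y_grade])
    then have "int n - r \<ge> 0" using ne grade_negative [of "int n - r"] by force
    then have "P (nat (int n - r))"
      unfolding P_def using g ne submodule_closed [OF N yN] by auto
    moreover have "nat (int n - r) < n" using r \<open>int n - r \<ge> 0\<close> by auto
    ultimately show False using n(2) by blast
  qed
  have "highest_weight_vector \<rho> (y p)"
    using kill yq by (auto simp: highest_weight_vector_def p y_def)
  then have "y p \<in> complex_vector.span {v0}"
    using highest_weight_vector_unique yN sub by blast
  then obtain a where a: "y p = a *\<^sub>C v0"
    by (auto simp: complex_vector.span_singleton)
  then have "a \<noteq> 0" using yp by auto
  then have "v0 \<in> N" by (rule subspace_scale_cancel [OF NS]) (use yN [of p] a in simp)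
  then have "hw_module \<subseteq> N" unfolding hw_module_def by (rule generated_submodule_minimal [OF N])
  with sub show ?thesis by blast
qed

end

lemma integrable_highest_weight_scale:
  assumes "integrable_highest_weight \<rho> v j c" "a \<noteq> 0"
  shows "integrable_highest_weight \<rho> (a *\<^sub>C v) j c"
proof -
  interpret integrable_highest_weight \<rho> v j c by fact
  note pow = clinear_scale [OF clinear_funpow [OF clinear_rep]]
  show ?thesis
  proof
    show "a *\<^sub>C v \<noteq> 0" using nonzero assms(2) by simp
    show "highest_weight_vector \<rho> (a *\<^sub>C v)"
      by (rule complex_vector.subspace_scale [OF highest_weight_vector_subspace, simplified]) (rule highest)
    show "\<exists>n. (\<rho> (F 0) ^^ n) (a *\<^sub>C v) = 0" "\<exists>n. (\<rho> (E (- 1)) ^^ n) (a *\<^sub>C v) = 0"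
      using nilpotent_F nilpotent_E by (auto simp: pow)
  qed (simp_all add: rep_simps wt_H wt_K wt_D scaleC_scaleC mult.commute)
qed

section \<open>Borel submodules\<close>

definition borel :: "affine_sl2 set" where
  "borel = {E n | n. n \<ge> 0} \<union> {H n | n. n \<ge> 0} \<union> {F n | n. n > 0} \<union> {K, D}"

definition borel_stable :: "'v::complex_vector rep \<Rightarrow> 'v set \<Rightarrow> bool" where
  "borel_stable \<rho> S \<longleftrightarrow> complex_vector.subspace S \<and> (\<forall>x\<in>borel. \<forall>v\<in>S. \<rho> x v \<in> S)"

definition borel_submodule :: "'v::complex_vector rep \<Rightarrow> 'v \<Rightarrow> 'v set" where
  "borel_submodule \<rho> v = borel_stable \<rho> hull {v}"

lemma borel_stable_submodule: "borel_stable \<rho> (borel_submodule \<rho> v)"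
  unfolding borel_submodule_def
  by (rule hull_in) (auto simp: borel_stable_def complex_vector.subspace_Inter)

lemma borel_submodule_mem: "v \<in> borel_submodule \<rho> v"
  unfolding borel_submodule_def using hull_subset [of "{v}" "borel_stable \<rho>"] by blast

lemma borel_submodule_minimal: "borel_stable \<rho> S \<Longrightarrow> v \<in> S \<Longrightarrow> borel_submodule \<rho> v \<subseteq> S"
  unfolding borel_submodule_def by (rule hull_minimal) auto

lemma borel_submodule_subspace: "complex_vector.subspace (borel_submodule \<rho> v)"
  and borel_submodule_closed: "x \<in> borel \<Longrightarrow> w \<in> borel_submodule \<rho> v \<Longrightarrow> \<rho> x w \<in> borel_submodule \<rho> v"
  using borel_stable_submodule [of \<rho> v] by (auto simp: borel_stable_def)

lemma borel_submodule_funpow: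
  "x \<in> borel \<Longrightarrow> w \<in> borel_submodule \<rho> v \<Longrightarrow> (\<rho> x ^^ n) w \<in> borel_submodule \<rho> v"
  by (induction n) (auto simp: borel_submodule_closed)

text \<open>
  A negative Chevalley generator together with the Borel subalgebra spans a parabolic subalgebra.
  So a module generated over the Borel subalgebra by one vector is stable under the Chevalley
  generator as soon as the latter kills that vector.
\<close>

lemma (in affine_sl2_rep) borel_submodule_parabolic:
  assumes y: "y \<in> {F 0, E (- 1)}" and v: "\<rho> y v = 0" and w: "w \<in> borel_submodule \<rho> v"
  shows "\<rho> y w \<in> borel_submodule \<rho> v"
proof -
  let ?B = "borel_submodule \<rho> v" and ?S = "{w \<in> borel_submodule \<rho> v. \<rho> y w \<in> borel_submodule \<rho> v}"
  note B = borel_submodule_subspace [of \<rho> v]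
  note sub = complex_vector.subspace_add [OF B] complex_vector.subspace_diff [OF B]
    complex_vector.subspace_scale [OF B] complex_vector.subspace_0 [OF B]
  have S: "complex_vector.subspace ?S"
    by (rule complex_vector.subspaceI) (auto simp: rep_simps sub)
  have "\<rho> y (\<rho> x u) \<in> ?B" if x: "x \<in> borel" and u: "u \<in> ?B" and yu: "\<rho> y u \<in> ?B" for x u
  proof -
    note cl = borel_submodule_closed [of _ _ \<rho> v]
    have E: "\<rho> (E n) w \<in> ?B" if "n \<ge> 0" "w \<in> ?B" for n w using that by (auto simp: borel_def intro!: cl)
    have H: "\<rho> (H n) w \<in> ?B" if "n \<ge> 0" "w \<in> ?B" for n w using that by (auto simp: borel_def intro!: cl)
    have F: "\<rho> (F n) w \<in> ?B" if "n > 0" "w \<in> ?B" for n w using that by (auto simp: borel_def intro!: cl)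
    have K: "\<rho> K w \<in> ?B" and D: "\<rho> D w \<in> ?B" if "w \<in> ?B" for w using that by (auto simp: borel_def intro!: cl)
    consider "y = F 0" | "y = E (- 1)" using y by blast
    then show ?thesis
    proof cases
      case 1
      have yn: "\<rho> (F n) u \<in> ?B" if "n \<ge> 0" for n using yu F [of n u] u 1 that by (cases "n = 0") auto
      consider n where "x = E n" "n \<ge> 0" | n where "x = H n" "n \<ge> 0" | n where "x = F n" "n > 0"
        | "x = K" | "x = D"
        using x by (auto simp: borel_def)
      then show ?thesis
      proof cases
        case (1 n)
        have "\<rho> (F 0) (\<rho> (E n) u) = \<rho> (E n) (\<rho> (F 0) u) - \<rho> (H n) u" using FE [of 0 n u] by simp
        then show ?thesis using \<open>y = F 0\<close> 1 E H u yu by (simp add: sub)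
      next
        case (2 n)
        have "\<rho> (F 0) (\<rho> (H n) u) = \<rho> (H n) (\<rho> (F 0) u) + 2 *\<^sub>C \<rho> (F n) u" using HF [of n 0 u] by simp
        then show ?thesis using \<open>y = F 0\<close> 2 H yn yu by (simp add: sub)
      next
        case (3 n)
        then show ?thesis using \<open>y = F 0\<close> F yu FF [of 0 n u] by simp
      next
        case 4
        then show ?thesis using K [OF yu] by (simp add: Kx)
      next
        case 5
        have "\<rho> (F 0) (\<rho> D u) = \<rho> D (\<rho> (F 0) u)" by (simp add: DF)
        then show ?thesis using \<open>y = F 0\<close> 5 D yu by simp
      qed
    next
      case 2
      have yn: "\<rho> (E n) u \<in> ?B" if "n \<ge> - 1" for n
        using yu E [of n u] u 2 that by (cases "n = - 1") auto
      consider n where "x = E n" "n \<ge> 0" | n where "x = H n" "n \<ge> 0" | n where "x = F n" "n > 0"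
        | "x = K" | "x = D"
        using x by (auto simp: borel_def)
      then show ?thesis
      proof cases
        case (1 n)
        then show ?thesis using \<open>y = E (- 1)\<close> E yu EE [of "- 1" n u] by simp
      next
        case (2 n)
        have "\<rho> (E (- 1)) (\<rho> (H n) u) = \<rho> (H n) (\<rho> (E (- 1)) u) - 2 *\<^sub>C \<rho> (E (n - 1)) u"
          using HE [of n "- 1" u] by simp
        then show ?thesis using \<open>y = E (- 1)\<close> 2 H yn yu by (simp add: sub)
      next
        case (3 n)
        have "\<rho> (E (- 1)) (\<rho> (F n) u) = \<rho> (F n) (\<rho> (E (- 1)) u) + \<rho> (H (n - 1)) u
            - (if n = 1 then \<rho> K u else 0)"
          using EF [of "- 1" n u] by (auto simp: scaleC_one)
        then show ?thesis using \<open>y = E (- 1)\<close> 3 F H K yu u by (simp add: sub)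
      next
        case 4
        then show ?thesis using K [OF yu] by (simp add: Kx)
      next
        case 5
        have "\<rho> (E (- 1)) (\<rho> D u) = \<rho> D (\<rho> (E (- 1)) u) - \<rho> (E (- 1)) u"
          using DE [of "- 1" u] by (simp add: scaleC_one)
        then show ?thesis using \<open>y = E (- 1)\<close> 5 D yu by (simp add: sub)
      qed
    qed
  qed
  then have "borel_stable \<rho> ?S"
    using S by (auto simp: borel_stable_def borel_submodule_closed)
  then have "?B \<subseteq> ?S"
    by (rule borel_submodule_minimal) (simp add: borel_submodule_mem v sub)
  with w show ?thesis by blast
qed

section \<open>The level one modules\<close>

lemma (in affine_sl2_rep) E_pow_weight:
  assumes "\<rho> (H 0) x = of_int a *\<^sub>C x" "\<rho> D x = of_int s *\<^sub>C x"
  shows "\<rho> (H 0) ((\<rho> (E n) ^^ m) x) = of_int (a + 2 * int m) *\<^sub>C (\<rho> (E n) ^^ m) x"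
    and "\<rho> D ((\<rho> (E n) ^^ m) x) = of_int (s - n * int m) *\<^sub>C (\<rho> (E n) ^^ m) x"
  using assms
  by (induction m)
    (simp_all add: HE DE rep_simps scaleC_add_left complex_vector.scale_left_diff_distrib distrib_left distrib_right)

lemma (in affine_sl2_rep) F_pow_weight:
  assumes "\<rho> (H 0) x = of_int a *\<^sub>C x" "\<rho> D x = of_int s *\<^sub>C x"
  shows "\<rho> (H 0) ((\<rho> (F n) ^^ m) x) = of_int (a - 2 * int m) *\<^sub>C (\<rho> (F n) ^^ m) x"
    and "\<rho> D ((\<rho> (F n) ^^ m) x) = of_int (s - n * int m) *\<^sub>C (\<rho> (F n) ^^ m) x"
  using assms
  by (induction m)
    (simp_all add: HF DF rep_simps scaleC_add_left complex_vector.scale_left_diff_distrib distrib_left distrib_right diff_diff_eq add_ac)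

locale irreducible_integrable = integrable_highest_weight \<rho> v0 j c
  for \<rho> :: "'v::complex_vector rep" and v0 j c +
  assumes generated: "hw_module = UNIV"
    and nilpotent: "x \<in> {E 0, F 0, F 1, E (- 1)} \<Longrightarrow> \<exists>n. (\<rho> x ^^ n) w = 0"

lemma is_L_realization:
  assumes "is_L l k \<rho>"
  obtains v0 where "irreducible_integrable \<rho> v0 l k"
proof -
  from assms have rep: "affine_sl2_rep \<rho>" and irr: "irreducible_rep \<rho>"
    and int: "\<And>x v. x \<in> {E 0, F 0, F 1, E (- 1)} \<Longrightarrow> \<exists>n. (\<rho> x ^^ n) v = 0"
    and K: "\<And>v. \<rho> K v = of_nat k *\<^sub>C v"
    by (auto simp: is_L_def integrable_rep_def)
  from assms obtain v0 where v0: "v0 \<noteq> 0" "highest_weight_vector \<rho> v0"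
    "\<rho> (H 0) v0 = of_nat l *\<^sub>C v0" "\<rho> D v0 = 0"
    by (auto simp: is_L_def)
  interpret affine_sl2_rep \<rho> by (rule rep)
  interpret integrable_highest_weight \<rho> v0 l k
    by unfold_locales (use v0 K int in auto)
  have "hw_module = UNIV"
    using irr submodule_module v0_mem v0(1) by (auto simp: irreducible_rep_def)
  then have "irreducible_integrable \<rho> v0 l k"
    by unfold_locales (use int in auto)
  with that show thesis .
qed

locale level_one = irreducible_integrable \<rho> v0 i 1
  for \<rho> :: "'v::complex_vector rep" and v0 i +
  assumes i_le_1: "i \<le> 1"
begin

lemma K_eq: "\<rho> K x = x"
  using module_K [of x] generated by (simp add: scaleC_one)

lemma D_nonneg:
  assumes "\<rho> D x = of_int s *\<^sub>C x" "x \<noteq> 0"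
  shows "s \<ge> 0"
proof (rule ccontr)
  assume "\<not> s \<ge> 0"
  then have "grade s = {0}" by (intro grade_negative) simp
  moreover have "x \<in> grade s" using module_D_eigenvector assms(1) generated by auto
  ultimately show False using assms(2) by auto
qed

text \<open>
  Simple reflections preserve \<open>a\<^sup>2 - 4 s\<close> and act injectively on weight spaces. From a weight outside
  the parabola \<open>a\<^sup>2 \<le> 4 s + i\<close> alternating reflections would lead to ever smaller degrees, whereas
  degrees are nonnegative.
\<close>

lemma weight_bound:
  assumes "\<rho> (H 0) x = of_int a *\<^sub>C x" "\<rho> D x = of_int s *\<^sub>C x" "x \<noteq> 0" "even (a - int i)"
  shows "a * a \<le> 4 * s + int i"
  using assms
proof (induction "nat s" arbitrary: x a s rule: less_induct)
  case less
  have s: "s \<ge> 0" by (rule D_nonneg [OF less.prems(2,3)])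
  have pos: "b * b \<le> 4 * s + int i"
    if y: "\<rho> (H 0) y = of_int b *\<^sub>C y" "\<rho> D y = of_int s *\<^sub>C y" "y \<noteq> 0" "even (b - int i)" and b: "b \<ge> 2" for y b
  proof -
    define n where "n = nat (b - 1)"
    have n: "int n = b - 1" "n > 0" using b by (auto simp: n_def)
    let ?z = "(\<rho> (F 1) ^^ n) y"
    have z: "\<rho> (H 0) ?z = of_int (2 - b) *\<^sub>C ?z" "\<rho> D ?z = of_int (s - b + 1) *\<^sub>C ?z"
    proof -
      have "b - 2 * int n = 2 - b" "s - 1 * int n = s - b + 1" using n by simp_all
      then show "\<rho> (H 0) ?z = of_int (2 - b) *\<^sub>C ?z" "\<rho> D ?z = of_int (s - b + 1) *\<^sub>C ?z"
        using F_pow_weight [OF y(1,2), where n = 1 and m = n] by (simp_all only:)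
    qed
    obtain N where N: "(\<rho> (E (- 1)) ^^ N) y = 0" using nilpotent by blast
    have "\<rho> K y - \<rho> (H 0) y = - of_nat n *\<^sub>C y"
    proof -
      have "- of_nat n = (1 - of_int b :: complex)"
        using arg_cong [OF n(1), of "of_int :: int \<Rightarrow> complex"] by simp
      then show ?thesis
        by (simp only: K_eq y(1) complex_vector.scale_left_diff_distrib scaleC_one)
    qed
    with N y(3) have z0: "?z \<noteq> 0" using sl1.reflection_injective_lowest by blast
    have "s - b + 1 \<ge> 0" by (rule D_nonneg [OF z(2) z0])
    then have "nat (s - b + 1) < nat s" using b by simp
    from less.hyps [OF this z z0]
    have "(2 - b) * (2 - b) \<le> 4 * (s - b + 1) + int i" using y(4) by auto
    then show ?thesis by (simp add: algebra_simps)
  qed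
  consider "a \<ge> 2" | "a \<le> - 2" | "a = - 1 \<or> a = 0 \<or> a = 1" by linarith
  then show ?case
  proof cases
    case 1
    then show ?thesis using pos less.prems by blast
  next
    case 2
    define n where "n = nat (- a)"
    have n: "int n = - a" using 2 by (simp add: n_def)
    let ?z = "(\<rho> (E 0) ^^ n) x"
    have z: "\<rho> (H 0) ?z = of_int (- a) *\<^sub>C ?z" "\<rho> D ?z = of_int s *\<^sub>C ?z"
    proof -
      have "a + 2 * int n = - a" "s - 0 * int n = s" using n by simp_all
      then show "\<rho> (H 0) ?z = of_int (- a) *\<^sub>C ?z" "\<rho> D ?z = of_int s *\<^sub>C ?z"
        using E_pow_weight [OF less.prems(1,2), where n = 0 and m = n] by (simp_all only:)
    qed
    obtain N where N: "(\<rho> (F 0) ^^ N) x = 0" using nilpotent by blast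
    have "\<rho> (H 0) x = - of_nat n *\<^sub>C x"
    proof -
      have "- of_nat n = (of_int a :: complex)"
        using arg_cong [OF n, of "of_int :: int \<Rightarrow> complex"] by simp
      then show ?thesis by (simp only: less.prems(1))
    qed
    with N less.prems(3) have "?z \<noteq> 0" using sl0.reflection_injective_lowest by blast
    then have "(- a) * (- a) \<le> 4 * s + int i"
      using pos [OF z] 2 less.prems(4) by simp
    then show ?thesis by simp
  next
    case 3
    then show ?thesis using s less.prems(4) i_le_1 by (cases "i = 0") (auto simp: le_Suc_eq)
  qed
qed

text \<open>
  The extremal vectors in the order of their distance from the highest weight vector. Their
  \<open>h\<^sub>0\<close>-weights are \<open>0, 2, - 2, 4, - 4, \<dots>\<close> for \<open>i = 0\<close> and \<open>1, - 1, 3, - 3, \<dots>\<close> for \<open>i = 1\<close>, and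
  the \<open>m\<close>-th one has coroot eigenvalue \<open>m + 1\<close> for the simple reflection that leads to the next
  one. The parity of \<open>m + i\<close> tells which of the two simple reflections this is.
\<close>

definition lower_op :: "nat \<Rightarrow> affine_sl2" where
  "lower_op m = (if odd (m + i) then F 0 else E (- 1))"

definition raise_op :: "nat \<Rightarrow> affine_sl2" where
  "raise_op m = (if odd (m + i) then E 0 else F 1)"

definition coroot_op :: "nat \<Rightarrow> 'v \<Rightarrow> 'v" where
  "coroot_op m x = (if odd (m + i) then \<rho> (H 0) x else \<rho> K x - \<rho> (H 0) x)"

definition chain_weight :: "nat \<Rightarrow> int" where
  "chain_weight m = (if odd (m + i) then int m + 1 else - int m)"

primrec chain :: "nat \<Rightarrow> 'v" where
  "chain 0 = v0"
| "chain (Suc m) = (\<rho> (lower_op m) ^^ Suc m) (chain m)"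

lemma chain_1: "odd i \<Longrightarrow> chain 1 = \<rho> (F 0) v0"
  by (simp add: lower_op_def)

lemma triple: "sl2_triple (\<rho> (raise_op m)) (coroot_op m) (\<rho> (lower_op m))"
proof (cases "odd (m + i)")
  case True
  then have "coroot_op m = \<rho> (H 0)" by (auto simp: coroot_op_def)
  with True show ?thesis using sl0.sl2_triple_axioms by (simp add: raise_op_def lower_op_def)
next
  case False
  then have "coroot_op m = (\<lambda>v. \<rho> K v - \<rho> (H 0) v)" by (auto simp: coroot_op_def)
  with False show ?thesis using sl1.sl2_triple_axioms by (simp add: raise_op_def lower_op_def)
qed

lemma lower_op_nilpotent: "\<exists>n. (\<rho> (lower_op m) ^^ n) x = 0"
  by (rule nilpotent) (simp add: lower_op_def)

lemma chain_weights:
  "\<rho> (H 0) (chain m) = of_int (chain_weight m) *\<^sub>C chain m \<and>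
   (\<exists>s. \<rho> D (chain m) = of_int s *\<^sub>C chain m \<and> chain_weight m * chain_weight m = 4 * s + int i)"
proof (induction m)
  case 0
  have "\<rho> D v0 = of_int 0 *\<^sub>C v0" by (simp add: wt_D)
  moreover have "i = 0 \<or> i = 1" using i_le_1 by linarith
  then have "int i * int i = int i" "chain_weight 0 = int i" unfolding chain_weight_def by auto
  ultimately show ?case using wt_H by (intro conjI exI [of _ 0]) simp_all
next
  case (Suc m)
  then obtain s where H: "\<rho> (H 0) (chain m) = of_int (chain_weight m) *\<^sub>C chain m"
    and D: "\<rho> D (chain m) = of_int s *\<^sub>C chain m"
    and s: "chain_weight m * chain_weight m = 4 * s + int i" by blast
  show ?case
  proof (cases "odd (m + i)")
    case True
    have w: "chain_weight m - 2 * int (Suc m) = chain_weight (Suc m)"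
      using True by (simp add: chain_weight_def)
    have "\<rho> (H 0) (chain (Suc m)) = of_int (chain_weight (Suc m)) *\<^sub>C chain (Suc m)"
      "\<rho> D (chain (Suc m)) = of_int s *\<^sub>C chain (Suc m)"
      using F_pow_weight [OF H D, where n = 0 and m = "Suc m"] True unfolding w
      by (simp_all only: chain.simps lower_op_def simp_thms if_True mult_zero_left diff_0_right)
    moreover have "chain_weight (Suc m) * chain_weight (Suc m) = 4 * s + int i"
      using s True by (simp add: chain_weight_def algebra_simps)
    ultimately show ?thesis by blast
  next
    case False
    have w: "chain_weight m + 2 * int (Suc m) = chain_weight (Suc m)"
      using False by (simp add: chain_weight_def)
    have "\<rho> (H 0) (chain (Suc m)) = of_int (chain_weight (Suc m)) *\<^sub>C chain (Suc m)"
      "\<rho> D (chain (Suc m)) = of_int (s - (- 1) * int (Suc m)) *\<^sub>C chain (Suc m)"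
      using E_pow_weight [OF H D, where n = "- 1" and m = "Suc m"] False unfolding w
      by (simp_all only: chain.simps lower_op_def simp_thms if_False)
    moreover have "chain_weight (Suc m) * chain_weight (Suc m) = 4 * (s - (- 1) * int (Suc m)) + int i"
      using s False by (simp add: chain_weight_def algebra_simps)
    ultimately show ?thesis by blast
  qed
qed

lemma chain_coroot: "coroot_op m (chain m) = of_nat (Suc m) *\<^sub>C chain m"
proof (cases "odd (m + i)")
  case True
  then show ?thesis using chain_weights [of m]
    by (simp add: coroot_op_def chain_weight_def add.commute)
next
  case False
  then have "of_int (chain_weight m) = (1 - of_nat (Suc m) :: complex)" by (simp add: chain_weight_def)
  then show ?thesis using chain_weights [of m] False
    by (simp only: coroot_op_def simp_thms if_False K_eq complex_vector.scale_left_diff_distrib scaleC_one) simp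
qed

text \<open>
  The chain lies on the boundary parabola, and the raised vector would have a weight outside of it.
\<close>

lemma chain_raise: "\<rho> (raise_op m) (chain m) = 0"
proof (rule ccontr)
  assume ne: "\<rho> (raise_op m) (chain m) \<noteq> 0"
  obtain s where H: "\<rho> (H 0) (chain m) = of_int (chain_weight m) *\<^sub>C chain m"
    and D: "\<rho> D (chain m) = of_int s *\<^sub>C chain m"
    and s: "chain_weight m * chain_weight m = 4 * s + int i"
    using chain_weights by blast
  show False
  proof (cases "odd (m + i)")
    case True
    let ?z = "\<rho> (E 0) (chain m)"
    have "\<rho> (H 0) ?z = of_int (chain_weight m + 2) *\<^sub>C ?z" "\<rho> D ?z = of_int s *\<^sub>C ?z"
      using E_pow_weight [OF H D, where n = 0 and m = 1] by simp_all
    from weight_bound [OF this] show False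
      using ne True s by (auto simp: raise_op_def chain_weight_def algebra_simps)
  next
    case False
    let ?z = "\<rho> (F 1) (chain m)"
    have "\<rho> (H 0) ?z = of_int (chain_weight m - 2) *\<^sub>C ?z" "\<rho> D ?z = of_int (s - 1) *\<^sub>C ?z"
      using F_pow_weight [OF H D, where n = 1 and m = 1] by simp_all
    from weight_bound [OF this] show False
      using ne False s by (auto simp: raise_op_def chain_weight_def algebra_simps)
  qed
qed

lemma chain_back:
  "\<exists>a. a \<noteq> 0 \<and> (\<rho> (raise_op m) ^^ Suc m) (chain (Suc m)) = a *\<^sub>C chain m"
  unfolding chain.simps
  by (rule sl2_triple.e_pow_f_pow_highest [OF triple chain_coroot chain_raise order_refl])

lemma chain_nonzero: "chain m \<noteq> 0"
proof (induction m)
  case (Suc m)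
  then show ?case
    using chain_back [of m] clinear_zero [OF clinear_funpow [OF clinear_rep]]
    by (metis complex_vector.scale_eq_0_iff)
qed (simp add: nonzero)

lemma chain_lower: "\<rho> (lower_op m) (chain (Suc m)) = 0"
proof -
  obtain N where "(\<rho> (lower_op m) ^^ N) (chain m) = 0" using lower_op_nilpotent by blast
  from sl2_triple.highest_weight_nat [OF triple chain_coroot chain_raise chain_nonzero this]
  obtain n where "of_nat (Suc m) = (of_nat n :: complex)"
    and n: "(\<rho> (lower_op m) ^^ Suc n) (chain m) = 0"
    by blast
  then have "n = Suc m" using of_nat_eq_iff by metis
  with n show ?thesis by simp
qed

lemma chain_weight_eq:
  assumes "w = a *\<^sub>C chain m" "a \<noteq> 0" "\<rho> (H 0) w = of_int b *\<^sub>C w"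
  shows "chain_weight m = b"
proof -
  have "of_int (chain_weight m) *\<^sub>C w = of_int b *\<^sub>C w"
    using assms(1,3) chain_weights [of m]
    by (simp add: rep_simps scaleC_scaleC mult.commute)
  moreover have "w \<noteq> 0" using assms(1,2) chain_nonzero by simp
  ultimately show ?thesis by (simp add: complex_vector.scale_cancel_right)
qed

text \<open>
  By uniqueness of the highest weight vector, all extremal vectors are multiples of members of the
  chain: each of the two reflections moves one step along it, and one of them fixes its start.
\<close>

lemma extremal_in_chain:
  assumes "extremal \<rho> w"
  shows "\<exists>m a. a \<noteq> 0 \<and> w = a *\<^sub>C chain m"
  using assms
proof (induction rule: extremal.induct)
  case (highest v)
  have "v \<in> complex_vector.span {v0}"
    using highest_weight_vector_unique [OF _ highest(2)] generated by blast
  then obtain a where "v = a *\<^sub>C v0" by (auto simp: complex_vector.span_singleton)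
  with highest(1) show ?case by (intro exI [of _ 0] exI [of _ a]) auto
next
  case (reflect1_pos v n)
  then obtain m a where a: "a \<noteq> 0" "v = a *\<^sub>C chain m" by blast
  have cw: "chain_weight m = int n" by (rule chain_weight_eq [OF a(2,1)]) (simp add: reflect1_pos)
  note lin = clinear_scale [OF clinear_funpow [OF clinear_rep]]
  show ?case
  proof (cases "odd (m + i)")
    case True
    then have "n = Suc m" using cw by (simp add: chain_weight_def)
    then have "(\<rho> (F 0) ^^ n) v = a *\<^sub>C chain (Suc m)"
      using True by (simp only: a lin chain.simps lower_op_def simp_thms if_True)
    with a show ?thesis by blast
  next
    case False
    then have "n = 0" using cw by (simp add: chain_weight_def)
    with a show ?thesis by auto
  qed
next
  case (reflect1_neg v n)
  then obtain m a where a: "a \<noteq> 0" "v = a *\<^sub>C chain m" by blast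
  have cw: "chain_weight m = - int n" by (rule chain_weight_eq [OF a(2,1)]) (simp add: reflect1_neg)
  note lin = clinear_scale [OF clinear_funpow [OF clinear_rep]]
  have n: "n = m" "even (m + i)" using cw by (auto simp: chain_weight_def split: if_splits)
  show ?case
  proof (cases m)
    case 0
    with a n show ?thesis by (intro exI [of _ 0] exI [of _ a]) simp
  next
    case (Suc m')
    then obtain b where b: "b \<noteq> 0" "(\<rho> (raise_op m') ^^ Suc m') (chain (Suc m')) = b *\<^sub>C chain m'"
      using chain_back by blast
    have "raise_op m' = E 0" using n Suc by (simp add: raise_op_def)
    then have "(\<rho> (E 0) ^^ n) v = (a * b) *\<^sub>C chain m'"
      using b(2) Suc n by (simp only: a lin scaleC_scaleC [symmetric])
    with a b show ?thesis by (intro exI [of _ m'] exI [of _ "a * b"]) simp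
  qed
next
  case (reflect0_pos v n)
  then obtain m a where a: "a \<noteq> 0" "v = a *\<^sub>C chain m" by blast
  have "\<rho> (H 0) v = of_int (1 - int n) *\<^sub>C v"
    using reflect0_pos(2)
    by (simp add: K_eq complex_vector.scale_left_diff_distrib scaleC_one algebra_simps)
  then have cw: "chain_weight m = 1 - int n" by (rule chain_weight_eq [OF a(2,1)])
  note lin = clinear_scale [OF clinear_funpow [OF clinear_rep]]
  show ?case
  proof (cases "odd (m + i)")
    case True
    then have "n = 0" using cw by (simp add: chain_weight_def)
    with a show ?thesis by auto
  next
    case False
    then have "n = Suc m" using cw by (simp add: chain_weight_def)
    then have "(\<rho> (E (- 1)) ^^ n) v = a *\<^sub>C chain (Suc m)"
      using False by (simp only: a lin chain.simps lower_op_def simp_thms if_False)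
    with a show ?thesis by blast
  qed
next
  case (reflect0_neg v n)
  then obtain m a where a: "a \<noteq> 0" "v = a *\<^sub>C chain m" by blast
  have "\<rho> (H 0) v = of_int (1 + int n) *\<^sub>C v"
    using reflect0_neg(2)
    by (simp add: K_eq scaleC_add_left scaleC_one algebra_simps)
  then have cw: "chain_weight m = 1 + int n" by (rule chain_weight_eq [OF a(2,1)])
  note lin = clinear_scale [OF clinear_funpow [OF clinear_rep]]
  have n: "n = m" "odd (m + i)" using cw by (auto simp: chain_weight_def split: if_splits)
  show ?case
  proof (cases m)
    case 0
    with a n show ?thesis by (intro exI [of _ 0] exI [of _ a]) simp
  next
    case (Suc m')
    then obtain b where b: "b \<noteq> 0" "(\<rho> (raise_op m') ^^ Suc m') (chain (Suc m')) = b *\<^sub>C chain m'"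
      using chain_back by blast
    have "raise_op m' = F 1" using n Suc by (simp add: raise_op_def)
    then have "(\<rho> (F 1) ^^ n) v = (a * b) *\<^sub>C chain m'"
      using b(2) Suc n by (simp only: a lin scaleC_scaleC [symmetric])
    with a b show ?thesis by (intro exI [of _ m'] exI [of _ "a * b"]) simp
  qed
qed

lemma extremal_eq_chain:
  assumes "extremal \<rho> w" "\<rho> (H 0) w = - of_nat p *\<^sub>C w"
  obtains a where "a \<noteq> 0" "w = a *\<^sub>C chain p" "even (p + i)"
proof -
  obtain m a where a: "a \<noteq> 0" "w = a *\<^sub>C chain m" using extremal_in_chain [OF assms(1)] by blast
  have "chain_weight m = - int p" by (rule chain_weight_eq [OF a(2,1)]) (simp add: assms(2))
  then have "m = p" "even (p + i)" by (auto simp: chain_weight_def split: if_splits)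
  with a that show thesis by blast
qed

lemma borel_chain_mono:
  assumes "m \<le> n"
  shows "borel_submodule \<rho> (chain m) \<subseteq> borel_submodule \<rho> (chain n)"
proof -
  have "borel_submodule \<rho> (chain m) \<subseteq> borel_submodule \<rho> (chain (Suc m))" for m
  proof (rule borel_submodule_minimal [OF borel_stable_submodule])
    obtain a where a: "a \<noteq> 0" "(\<rho> (raise_op m) ^^ Suc m) (chain (Suc m)) = a *\<^sub>C chain m"
      using chain_back by blast
    have "raise_op m \<in> borel" by (auto simp: raise_op_def borel_def)
    then have "a *\<^sub>C chain m \<in> borel_submodule \<rho> (chain (Suc m))"
      using borel_submodule_funpow [OF _ borel_submodule_mem] a(2) by metis
    then show "chain m \<in> borel_submodule \<rho> (chain (Suc m))"
      by (rule subspace_scale_cancel [OF borel_submodule_subspace a(1)])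
  qed
  then show ?thesis using lift_Suc_mono_le [of "\<lambda>m. borel_submodule \<rho> (chain m)"] assms by blast
qed

text \<open>
  Along the chain the Borel submodules grow, and each of them is stable under one of the two negative
  Chevalley generators, alternatingly. So their union is stable under all Chevalley generators.
\<close>

lemma borel_chain_exhausts: "\<exists>m. x \<in> borel_submodule \<rho> (chain m)"
proof -
  let ?B = "\<lambda>m. borel_submodule \<rho> (chain m)" and ?U = "\<Union>m. borel_submodule \<rho> (chain m)"
  have sub: "complex_vector.subspace ?U"
  proof (rule complex_vector.subspaceI)
    show "0 \<in> ?U" using complex_vector.subspace_0 [OF borel_submodule_subspace] by blast
  next
    fix x y assume "x \<in> ?U" "y \<in> ?U"
    then obtain m n where "x \<in> ?B m" "y \<in> ?B n" by blast
    then have "x \<in> ?B (max m n)" "y \<in> ?B (max m n)"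
      using borel_chain_mono [of m "max m n"] borel_chain_mono [of n "max m n"] by auto
    then have "x + y \<in> ?B (max m n)"
      by (rule complex_vector.subspace_add [OF borel_submodule_subspace])
    then show "x + y \<in> ?U" by blast
  next
    fix c x assume "x \<in> ?U"
    then show "c *\<^sub>C x \<in> ?U" using complex_vector.subspace_scale [OF borel_submodule_subspace] by blast
  qed
  have low: "\<rho> (lower_op m) x \<in> ?U" if "x \<in> ?B m" for m x
  proof -
    have "x \<in> ?B (Suc m)" using that borel_chain_mono [of m "Suc m"] by auto
    then have "\<rho> (lower_op m) x \<in> ?B (Suc m)"
      by (intro borel_submodule_parabolic [OF _ chain_lower]) (simp_all add: lower_op_def)
    then show ?thesis by blast
  qed
  have lowU: "\<rho> y x \<in> ?U" if x: "x \<in> ?U" and y: "y \<in> {F 0, E (- 1)}" for x y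
  proof -
    obtain m where m: "x \<in> ?B m" using x by blast
    then have m': "x \<in> ?B (Suc m)" using borel_chain_mono [of m "Suc m"] by auto
    have "y = lower_op m \<or> y = lower_op (Suc m)" using y by (auto simp: lower_op_def)
    then show ?thesis using low [OF m] low [OF m'] by blast
  qed
  have up: "\<rho> y x \<in> ?U" if "x \<in> ?U" "y \<in> borel" for x y
    using that borel_submodule_closed by blast
  have "submodule \<rho> ?U"
    by (rule submodule_if_chevalley_closed [OF sub])
      (use lowU up in \<open>auto simp: borel_def simp del: UN_iff\<close>)
  moreover have "v0 \<in> ?U" using borel_submodule_mem [of v0 \<rho>] by (auto intro: exI [of _ 0])
  ultimately have "hw_module \<subseteq> ?U" unfolding hw_module_def by (rule generated_submodule_minimal)
  then show ?thesis using generated by auto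
qed

end

section \<open>Tensor products of representations\<close>

lemma pure_linear: "clinear (\<lambda>x. pure (us @ x # ws))"
  by (rule multilinear_pure [unfolded multilinear_def, THEN spec, THEN spec])

lemma pure_linear_Cons: "clinear (\<lambda>x. pure (x # ws))"
  using pure_linear [of "[]"] by simp

lemma pure_update_linear:
  assumes "a < length vs"
  shows "clinear (\<lambda>x. pure (vs[a := x]))"
  using pure_linear assms by (simp add: upd_conv_take_nth_drop)

lemmas pure_update_simps = clinear_simps [OF pure_update_linear]

lemma pure_zero: "0 \<in> set vs \<Longrightarrow> pure vs = 0"
  using clinear_zero [OF pure_linear] by (auto dest: split_list)

lemma span_pure: "t \<in> complex_vector.span (range pure)"
proof -
  obtain f where t: "t = abs_tensor f" by (metis Quotient3_abs_rep [OF Quotient3_tensor])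
  have lk: "Poly_Mapping.lookup (c *\<^sub>C g) vs = c * Poly_Mapping.lookup g vs"
    for c and g :: "'a list \<Rightarrow>\<^sub>0 complex" and vs
    by transfer (simp add: scaleC_complex_def)
  have "f = (\<Sum>vs\<in>Poly_Mapping.keys f. Poly_Mapping.lookup f vs *\<^sub>C Poly_Mapping.single vs 1)"
    by (rule poly_mapping_eqI)
      (auto simp: lookup_sum lk lookup_single when_def in_keys_iff if_distrib [of "\<lambda>x. _ * x"] cong: if_cong)
  moreover have "abs_tensor (sum g A) = (\<Sum>a\<in>A. abs_tensor (g a))"
    for A and g :: "'a list \<Rightarrow> 'a list \<Rightarrow>\<^sub>0 complex"
    by (induction A rule: infinite_finite_induct)
      (simp_all flip: zero_tensor.abs_eq plus_tensor.abs_eq)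
  ultimately have "t = (\<Sum>vs\<in>Poly_Mapping.keys f.
      abs_tensor (Poly_Mapping.lookup f vs *\<^sub>C Poly_Mapping.single vs 1))"
    unfolding t by metis
  then have sum: "t = (\<Sum>vs\<in>Poly_Mapping.keys f. Poly_Mapping.lookup f vs *\<^sub>C pure vs)"
    by (simp add: pure.abs_eq scaleC_tensor.abs_eq)
  show ?thesis
    unfolding sum
    by (rule complex_vector.span_sum, rule complex_vector.span_scale,
        rule complex_vector.span_base, rule rangeI)
qed

lemma clinear_eq_on_pure:
  assumes "clinear f" "clinear g" "\<And>vs. f (pure vs) = g (pure vs)"
  shows "f t = g t"
  by (rule clinear_eq_on_span [OF assms(1,2) span_pure]) (auto simp: assms(3))

lemma clinear_eq_on_tensor_power:
  assumes "clinear f" "clinear g" "\<And>vs. length vs = n \<Longrightarrow> f (pure vs) = g (pure vs)"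
    and "t \<in> tensor_power n"
  shows "f t = g t"
  by (rule clinear_eq_on_span [OF assms(1,2) assms(4) [unfolded tensor_power_def]])
    (auto simp: assms(3))

lemma tensor_power_subspace: "complex_vector.subspace (tensor_power n)"
  by (simp add: tensor_power_def)

lemma pure_tensor_power: "length vs = n \<Longrightarrow> pure vs \<in> tensor_power n"
  by (auto simp: tensor_power_def intro!: complex_vector.span_base)

lemma tensor_power_induct:
  assumes "t \<in> tensor_power n" "complex_vector.subspace S" "\<And>vs. length vs = n \<Longrightarrow> pure vs \<in> S"
  shows "t \<in> S"
  using assms complex_vector.span_minimal [of "pure ` {vs. length vs = n}" S]
  unfolding tensor_power_def by auto

context
  fixes \<rho>s :: "'v::complex_vector rep list"
  assumes reps: "\<forall>\<rho>\<in>set \<rho>s. affine_sl2_rep \<rho>"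
begin

lemma clinear_tensor_rep: "clinear (tensor_rep \<rho>s x)"
  using reps by (intro tensor_rep_pure(1)) (simp add: affine_sl2_rep.clinear_rep)

lemma tensor_rep_eq:
  "length vs = length \<rho>s \<Longrightarrow>
    tensor_rep \<rho>s x (pure vs) = (\<Sum>a<length \<rho>s. pure (vs[a := (\<rho>s ! a) x (vs ! a)]))"
  using reps by (intro tensor_rep_pure(2)) (simp_all add: affine_sl2_rep.clinear_rep)

lemma tensor_rep_outside:
  assumes "length vs \<noteq> length \<rho>s"
  shows "tensor_rep \<rho>s x (pure vs) = 0"
proof -
  let ?\<phi> = "\<lambda>vs. if length vs = length \<rho>s
    then \<Sum>a<length \<rho>s. pure (vs[a := (\<rho>s ! a) x (vs ! a)]) else 0"
  \<comment> \<open>the defining map agrees with a linear operator after \<open>pure\<close>, hence it is multilinear\<close>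
  have "?\<phi> (us @ x' # ws) = (if length us + Suc (length ws) = length \<rho>s
      then tensor_rep \<rho>s x (pure (us @ x' # ws)) else 0)" for us x' ws
    using tensor_rep_eq [of "us @ x' # ws" x] by simp
  then have "multilinear ?\<phi>"
    unfolding multilinear_def
    by (auto intro!: clinearI simp: clinear_simps [OF clinear_comp [OF clinear_tensor_rep pure_linear]])
  from tensor_lift(2) [OF this, of vs] assms show ?thesis by (simp add: tensor_rep_def)
qed

text \<open>
  Operators on different factors commute, so only the commutators within one factor remain.
\<close>

lemma tensor_rep_commutator_pure:
  assumes len: "length vs = length \<rho>s"
  shows "commutator (tensor_rep \<rho>s) x y (pure vs)
    = (\<Sum>a<length \<rho>s. pure (vs[a := commutator (\<rho>s ! a) x y (vs ! a)]))"
proof -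
  let ?n = "length \<rho>s"
  note lin = clinear_simps [OF clinear_tensor_rep]
  have two: "tensor_rep \<rho>s z (tensor_rep \<rho>s w (pure vs)) = (\<Sum>b<?n. \<Sum>a<?n.
      pure (if a = b then vs[a := (\<rho>s ! a) z ((\<rho>s ! a) w (vs ! a))]
        else vs[a := (\<rho>s ! a) z (vs ! a), b := (\<rho>s ! b) w (vs ! b)]))" for z w
    unfolding tensor_rep_eq [OF len] lin
    by (rule sum.cong [OF refl], subst tensor_rep_eq)
      (use len in \<open>auto intro!: sum.cong arg_cong [of _ _ pure] simp: nth_list_update list_update_swap\<close>)
  have swapped: "tensor_rep \<rho>s y (tensor_rep \<rho>s x (pure vs)) = (\<Sum>b<?n. \<Sum>a<?n.
      pure (if a = b then vs[a := (\<rho>s ! a) y ((\<rho>s ! a) x (vs ! a))]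
        else vs[a := (\<rho>s ! a) x (vs ! a), b := (\<rho>s ! b) y (vs ! b)]))"
    unfolding two by (subst sum.swap) (auto intro!: sum.cong simp: list_update_swap)
  have "commutator (tensor_rep \<rho>s) x y (pure vs) = (\<Sum>b<?n. \<Sum>a<?n.
      if a = b then pure (vs[a := commutator (\<rho>s ! a) x y (vs ! a)]) else 0)"
    unfolding commutator_def two [of x y] swapped sum_subtractf [symmetric]
    by (intro sum.cong refl) (use len in \<open>auto simp: pure_update_simps\<close>)
  also have "\<dots> = (\<Sum>a<?n. pure (vs[a := commutator (\<rho>s ! a) x y (vs ! a)]))"
    by simp
  finally show ?thesis .
qed

lemma tensor_rep_relation:
  assumes rel: "\<And>\<rho> v. \<rho> \<in> set \<rho>s \<Longrightarrow> commutator \<rho> x y v = c *\<^sub>C \<rho> z v + d *\<^sub>C \<rho> w v"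
  shows "commutator (tensor_rep \<rho>s) x y t = c *\<^sub>C tensor_rep \<rho>s z t + d *\<^sub>C tensor_rep \<rho>s w t"
proof -
  note T = clinear_tensor_rep
  have 1: "clinear (\<lambda>t. commutator (tensor_rep \<rho>s) x y t)"
    unfolding commutator_def by (rule clinear_minus [OF clinear_comp [OF T T] clinear_comp [OF T T]])
  have 2: "clinear (\<lambda>t. c *\<^sub>C tensor_rep \<rho>s z t + d *\<^sub>C tensor_rep \<rho>s w t)"
    by (rule clinear_plus [OF clinear_scaled [OF T] clinear_scaled [OF T]])
  show ?thesis
  proof (rule clinear_eq_on_pure [OF 1 2])
    fix vs :: "'v list"
    show "commutator (tensor_rep \<rho>s) x y (pure vs)
        = c *\<^sub>C tensor_rep \<rho>s z (pure vs) + d *\<^sub>C tensor_rep \<rho>s w (pure vs)"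
    proof (cases "length vs = length \<rho>s")
      case True
      have "pure (vs[a := commutator (\<rho>s ! a) x y (vs ! a)])
          = c *\<^sub>C pure (vs[a := (\<rho>s ! a) z (vs ! a)]) + d *\<^sub>C pure (vs[a := (\<rho>s ! a) w (vs ! a)])"
        if "a < length \<rho>s" for a
        using that True rel [of "\<rho>s ! a"] by (simp add: pure_update_simps)
      then show ?thesis
        by (simp add: tensor_rep_commutator_pure [OF True] tensor_rep_eq [OF True] sum.distrib
            complex_vector.scale_sum_right)
    next
      case False
      then show ?thesis
        by (simp add: commutator_def tensor_rep_outside clinear_simps [OF T])
    qed
  qed
qed

lemma affine_tensor_rep: "affine_sl2_rep (tensor_rep \<rho>s)"
proof (rule affine_sl2_rep.intro)
  fix m n :: int and v :: "'v tensor" and x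
  note rel = affine_sl2_rep.E_E affine_sl2_rep.F_F affine_sl2_rep.H_H affine_sl2_rep.H_E
    affine_sl2_rep.H_F affine_sl2_rep.E_F affine_sl2_rep.K_central affine_sl2_rep.D_E
    affine_sl2_rep.D_H affine_sl2_rep.D_F
  note s = complex_vector.scale_zero_left add_0_right add_0_left scaleC_one
  show "clinear (tensor_rep \<rho>s x)" by (rule clinear_tensor_rep)
  show "commutator (tensor_rep \<rho>s) (E m) (E n) v = 0"
    using tensor_rep_relation [of "E m" "E n" 0 K 0 K v] by (simp add: rel reps)
  show "commutator (tensor_rep \<rho>s) (F m) (F n) v = 0"
    using tensor_rep_relation [of "F m" "F n" 0 K 0 K v] by (simp add: rel reps)
  show "commutator (tensor_rep \<rho>s) (H m) (H n) v
      = (if m + n = 0 then (2 * of_int m) *\<^sub>C tensor_rep \<rho>s K v else 0)"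
    using tensor_rep_relation [of "H m" "H n" "if m + n = 0 then 2 * of_int m else 0" K 0 K v]
    by (auto simp: rel reps)
  show "commutator (tensor_rep \<rho>s) (H m) (E n) v = 2 *\<^sub>C tensor_rep \<rho>s (E (m + n)) v"
    using tensor_rep_relation [of "H m" "E n" 2 "E (m + n)" 0 K v] by (simp add: rel reps)
  show "commutator (tensor_rep \<rho>s) (H m) (F n) v = - 2 *\<^sub>C tensor_rep \<rho>s (F (m + n)) v"
    using tensor_rep_relation [of "H m" "F n" "- 2" "F (m + n)" 0 K v] by (simp add: rel reps)
  show "commutator (tensor_rep \<rho>s) (E m) (F n) v = tensor_rep \<rho>s (H (m + n)) v
      + (if m + n = 0 then of_int m *\<^sub>C tensor_rep \<rho>s K v else 0)"
    using tensor_rep_relation [of "E m" "F n" 1 "H (m + n)" "if m + n = 0 then of_int m else 0" K v]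
    by (auto simp: rel reps scaleC_one)
  show "commutator (tensor_rep \<rho>s) K x v = 0"
    using tensor_rep_relation [of K x 0 K 0 K v] by (simp add: rel reps)
  show "commutator (tensor_rep \<rho>s) D (E n) v = - of_int n *\<^sub>C tensor_rep \<rho>s (E n) v"
    using tensor_rep_relation [of D "E n" "- of_int n" "E n" 0 K v] by (simp add: rel reps)
  show "commutator (tensor_rep \<rho>s) D (H n) v = - of_int n *\<^sub>C tensor_rep \<rho>s (H n) v"
    using tensor_rep_relation [of D "H n" "- of_int n" "H n" 0 K v] by (simp add: rel reps)
  show "commutator (tensor_rep \<rho>s) D (F n) v = - of_int n *\<^sub>C tensor_rep \<rho>s (F n) v"
    using tensor_rep_relation [of D "F n" "- of_int n" "F n" 0 K v] by (simp add: rel reps)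
qed

lemma submodule_tensor_power: "submodule (tensor_rep \<rho>s) (tensor_power (length \<rho>s))"
  unfolding submodule_def
proof (intro conjI allI ballI)
  fix x and t :: "'v tensor" assume t: "t \<in> tensor_power (length \<rho>s)"
  show "tensor_rep \<rho>s x t \<in> tensor_power (length \<rho>s)"
    by (rule clinear_span_mem [OF clinear_tensor_rep t [unfolded tensor_power_def] tensor_power_subspace])
      (auto simp: tensor_rep_eq intro!: complex_vector.subspace_sum tensor_power_subspace pure_tensor_power)
qed (rule tensor_power_subspace)

lemma tensor_rep_eigenvector:
  assumes "length vs = length \<rho>s" "\<And>a. a < length \<rho>s \<Longrightarrow> (\<rho>s ! a) x (vs ! a) = c a *\<^sub>C (vs ! a)"
  shows "tensor_rep \<rho>s x (pure vs) = (\<Sum>a<length \<rho>s. c a) *\<^sub>C pure vs"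
  using assms by (simp add: tensor_rep_eq pure_update_simps complex_vector.scale_sum_left)

text \<open>
  Each factor \<open>v\<^sub>a\<close> is killed by more than \<open>n\<^sub>a\<close> applications of \<open>x\<close>. So only one way to distribute
  \<open>\<Sum> n\<^sub>a\<close> applications of \<open>x\<close> over the factors survives, with a multinomial coefficient.
\<close>

lemma tensor_rep_top_power:
  assumes "length vs = length \<rho>s" "length ns = length \<rho>s"
    "\<And>a. a < length \<rho>s \<Longrightarrow> (\<rho>s ! a) x (((\<rho>s ! a) x ^^ (ns ! a)) (vs ! a)) = 0"
  shows "\<exists>c>0. (tensor_rep \<rho>s x ^^ sum_list ns) (pure vs)
    = of_nat c *\<^sub>C pure (map (\<lambda>a. ((\<rho>s ! a) x ^^ (ns ! a)) (vs ! a)) [0..<length \<rho>s])"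
  using assms
proof (induction "sum_list ns" arbitrary: ns vs)
  case 0
  then have "ns ! a = 0" if "a < length \<rho>s" for a
    using that by (metis elem_le_sum_list le_zero_eq)
  then have "map (\<lambda>a. ((\<rho>s ! a) x ^^ (ns ! a)) (vs ! a)) [0..<length \<rho>s] = vs"
    using 0(2) by (intro nth_equalityI) simp_all
  then show ?case by (intro exI [of _ 1]) (simp add: 0(1) [symmetric] scaleC_one)
next
  case (Suc N)
  define top where "top ns vs = pure (map (\<lambda>a. ((\<rho>s ! a) x ^^ (ns ! a)) (vs ! a)) [0..<length \<rho>s])"
    for ns :: "nat list" and vs
  have lin: "clinear (tensor_rep \<rho>s x ^^ N)" by (rule clinear_funpow [OF clinear_tensor_rep])
  have "\<exists>c. (tensor_rep \<rho>s x ^^ N) (pure (vs[a := (\<rho>s ! a) x (vs ! a)])) = of_nat c *\<^sub>C top ns vs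
      \<and> (ns ! a > 0 \<longrightarrow> c > 0)" if a: "a < length \<rho>s" for a
  proof (cases "ns ! a")
    case 0
    then have "pure (vs[a := (\<rho>s ! a) x (vs ! a)]) = 0"
      using Suc.prems(3) [OF a] a Suc.prems(1) by (simp add: pure_update_simps)
    then show ?thesis using 0 by (intro exI [of _ 0]) (simp add: clinear_zero [OF lin])
  next
    case (Suc p)
    let ?ns = "ns[a := p]" and ?vs = "vs[a := (\<rho>s ! a) x (vs ! a)]"
    have pow: "((\<rho>s ! b) x ^^ (?ns ! b)) (?vs ! b) = ((\<rho>s ! b) x ^^ (ns ! b)) (vs ! b)"
      if "b < length \<rho>s" for b
      using that a Suc Suc.prems(1,2) by (cases "b = a") (simp_all add: funpow_swap1)
    have "sum_list ns = Suc (sum_list ?ns)"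
      using a Suc Suc.prems(2) elem_le_sum_list [of a ns] by (simp add: sum_list_update)
    then have N: "N = sum_list ?ns" using Suc.hyps(2) by simp
    have "\<exists>c>0. (tensor_rep \<rho>s x ^^ sum_list ?ns) (pure ?vs) = of_nat c *\<^sub>C top ?ns ?vs"
      unfolding top_def
      by (rule Suc.hyps(1) [OF N]) (use Suc.prems pow in \<open>auto simp del: nth_list_update\<close>)
    moreover have "top ?ns ?vs = top ns vs"
      unfolding top_def using pow by (intro arg_cong [of _ _ pure]) simp
    ultimately show ?thesis using N by auto
  qed
  then obtain c where c: "\<And>a. a < length \<rho>s \<Longrightarrow>
      (tensor_rep \<rho>s x ^^ N) (pure (vs[a := (\<rho>s ! a) x (vs ! a)])) = of_nat (c a) *\<^sub>C top ns vs"
    and pos: "\<And>a. a < length \<rho>s \<Longrightarrow> ns ! a > 0 \<Longrightarrow> c a > 0"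
    by metis
  have "(tensor_rep \<rho>s x ^^ Suc N) (pure vs) = of_nat (\<Sum>a<length \<rho>s. c a) *\<^sub>C top ns vs"
    using c by (simp only: funpow_Suc_right o_apply tensor_rep_eq [OF Suc.prems(1)] clinear_sum [OF lin])
      (simp add: complex_vector.scale_sum_left)
  moreover have "(\<Sum>a<length \<rho>s. c a) > 0"
  proof -
    have "sum_list ns \<noteq> 0" by (metis Suc.hyps(2) nat.distinct(1))
    then obtain a where "a < length \<rho>s" "ns ! a > 0"
      using Suc.prems(2) by (auto simp: in_set_conv_nth sum_list_eq_0_iff)
    then have "c a > 0" "a \<in> {..<length \<rho>s}" using pos by auto
    then show ?thesis by (metis finite_lessThan gr0I sum_eq_0_iff less_irrefl)
  qed
  ultimately show ?case unfolding top_def Suc.hyps(2) [symmetric] by blast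
qed

lemma tensor_rep_nilpotent:
  assumes "length vs = length \<rho>s" "\<And>a. a < length \<rho>s \<Longrightarrow> \<exists>n. ((\<rho>s ! a) x ^^ n) (vs ! a) = 0"
    and "\<rho>s \<noteq> []"
  shows "\<exists>n. (tensor_rep \<rho>s x ^^ n) (pure vs) = 0"
proof -
  obtain n where n: "\<And>a. a < length \<rho>s \<Longrightarrow> ((\<rho>s ! a) x ^^ n a) (vs ! a) = 0"
    using assms(2) by metis
  have zero: "(\<rho>s ! a) x 0 = 0" if "a < length \<rho>s" for a
    using that reps by (simp add: clinear_zero [OF affine_sl2_rep.clinear_rep])
  let ?ns = "map n [0..<length \<rho>s]"
  obtain c where c: "(tensor_rep \<rho>s x ^^ sum_list ?ns) (pure vs)
      = of_nat c *\<^sub>C pure (map (\<lambda>a. ((\<rho>s ! a) x ^^ (?ns ! a)) (vs ! a)) [0..<length \<rho>s])"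
    using tensor_rep_top_power [OF assms(1), of ?ns x] n zero by auto
  have "0 \<in> set (map (\<lambda>a. ((\<rho>s ! a) x ^^ (?ns ! a)) (vs ! a)) [0..<length \<rho>s])"
    using assms(3) n [of 0] by (auto simp: image_iff intro!: bexI [of _ 0])
  from pure_zero [OF this] have "(tensor_rep \<rho>s x ^^ sum_list ?ns) (pure vs) = 0"
    using c by simp
  then show ?thesis by blast
qed

end

lemma complex_clinear_functional:
  fixes u :: "'v::complex_vector"
  assumes "u \<noteq> 0"
  obtains \<phi> :: "'v \<Rightarrow> complex" where "clinear \<phi>" "\<phi> u = 1"
proof -
  interpret vector_space_pair "scaleC :: complex \<Rightarrow> 'v \<Rightarrow> 'v" "scaleC :: complex \<Rightarrow> complex \<Rightarrow> complex" ..
  have ind: "complex_vector.independent {u}" using assms by simp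
  show thesis
    by (rule that [OF linear_construct [OF ind] construct_basis [OF ind]]) simp
qed

text \<open>
  Contracting the first factor with a linear functional reduces the number of factors.
\<close>

lemma pure_nonzero: "0 \<notin> set vs \<Longrightarrow> pure vs \<noteq> 0"
proof (induction vs)
  case Nil
  have "multilinear (\<lambda>vs :: 'a list. if vs = [] then 1 else 0 :: complex)"
    by (auto simp: multilinear_def intro: clinearI)
  note lift = tensor_lift [OF this]
  show ?case using lift(2) [of "[]"] clinear_zero [OF lift(1)] by auto
next
  case (Cons u us)
  then obtain \<phi> :: "'a \<Rightarrow> complex" where \<phi>: "clinear \<phi>" "\<phi> u = 1"
    using complex_clinear_functional [of u] by auto
  define g where "g vs = (case vs of [] \<Rightarrow> 0 | x # ws \<Rightarrow> \<phi> x *\<^sub>C pure ws)" for vs :: "'a list"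
  have "clinear (\<lambda>x. g (us @ x # ws))" for us ws
  proof (cases us)
    case Nil
    then show ?thesis
      by (auto simp: g_def clinear_simps [OF \<phi>(1)] scaleC_complex_def scaleC_add_left scaleC_scaleC intro!: clinearI)
  next
    case (Cons y ys)
    then show ?thesis by (simp add: g_def clinear_scaled pure_linear)
  qed
  then have "multilinear g" by (simp add: multilinear_def)
  note lift = tensor_lift [OF this]
  have "tensor_lift g (pure (u # us)) = pure us"
    by (simp add: lift(2) g_def \<phi>(2) scaleC_one)
  then show ?case using Cons clinear_zero [OF lift(1)] by auto
qed

lemma integrable_highest_weight_tensor:
  assumes len: "length us = length \<rho>s" and ne: "\<rho>s \<noteq> []"
    and fac: "\<And>a. a < length \<rho>s \<Longrightarrow> integrable_highest_weight (\<rho>s ! a) (us ! a) (j a) (c a)"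
  shows "integrable_highest_weight (tensor_rep \<rho>s) (pure us)
    (\<Sum>a<length \<rho>s. j a) (\<Sum>a<length \<rho>s. c a)"
proof -
  have reps: "\<forall>\<rho>\<in>set \<rho>s. affine_sl2_rep \<rho>"
    using fac by (auto simp: in_set_conv_nth integrable_highest_weight_def)
  note axioms = fac [unfolded integrable_highest_weight_def integrable_highest_weight_axioms_def]
  have kill: "tensor_rep \<rho>s x (pure us) = 0" if "\<And>a. a < length \<rho>s \<Longrightarrow> (\<rho>s ! a) x (us ! a) = 0" for x
    using tensor_rep_eigenvector [OF reps len, of x "\<lambda>_. 0"] that by simp
  have "highest_weight_vector (tensor_rep \<rho>s) (pure us)"
    unfolding highest_weight_vector_def
    by (intro conjI allI impI kill) (use axioms in \<open>auto simp: highest_weight_vector_def\<close>)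
  moreover have "pure us \<noteq> 0"
    using axioms len by (intro pure_nonzero) (metis in_set_conv_nth)
  moreover have "tensor_rep \<rho>s (H 0) (pure us) = of_nat (\<Sum>a<length \<rho>s. j a) *\<^sub>C pure us"
    using tensor_rep_eigenvector [OF reps len, of "H 0" "\<lambda>a. of_nat (j a)"] axioms by simp
  moreover have "tensor_rep \<rho>s K (pure us) = of_nat (\<Sum>a<length \<rho>s. c a) *\<^sub>C pure us"
    using tensor_rep_eigenvector [OF reps len, of K "\<lambda>a. of_nat (c a)"] axioms by simp
  moreover have "tensor_rep \<rho>s D (pure us) = 0" using kill axioms by simp
  moreover have "\<exists>n. (tensor_rep \<rho>s (F 0) ^^ n) (pure us) = 0"
    "\<exists>n. (tensor_rep \<rho>s (E (- 1)) ^^ n) (pure us) = 0"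
    by (intro tensor_rep_nilpotent [OF reps len _ ne]; use axioms in blast)+
  ultimately show ?thesis
    using affine_tensor_rep [OF reps]
    by (simp add: integrable_highest_weight_def integrable_highest_weight_axioms_def)
qed

section \<open>Uniqueness of the irreducible highest weight module\<close>

instantiation prod :: (complex_vector, complex_vector) complex_vector
begin

definition scaleC_prod :: "complex \<Rightarrow> 'a \<times> 'b \<Rightarrow> 'a \<times> 'b" where
  "scaleC_prod c p = (c *\<^sub>C fst p, c *\<^sub>C snd p)"

instance
  by standard (simp_all add: scaleC_prod_def scaleC_add_right scaleC_add_left scaleC_scaleC scaleC_one prod_eq_iff)

end

lemma scaleC_Pair: "c *\<^sub>C (a, b) = (c *\<^sub>C a, c *\<^sub>C b)"
  by (simp add: scaleC_prod_def)

definition sum_rep :: "'v::complex_vector rep \<Rightarrow> 'w::complex_vector rep \<Rightarrow> ('v \<times> 'w) rep" where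
  "sum_rep \<rho> \<sigma> x p = (\<rho> x (fst p), \<sigma> x (snd p))"

lemma sum_rep_funpow: "(sum_rep \<rho> \<sigma> x ^^ n) (a, b) = ((\<rho> x ^^ n) a, (\<sigma> x ^^ n) b)"
  by (induction n) (simp_all add: sum_rep_def)

lemma affine_sum_rep:
  assumes "affine_sl2_rep \<rho>" "affine_sl2_rep \<sigma>"
  shows "affine_sl2_rep (sum_rep \<rho> \<sigma>)"
proof -
  interpret r: affine_sl2_rep \<rho> by fact
  interpret s: affine_sl2_rep \<sigma> by fact
  have com: "commutator (sum_rep \<rho> \<sigma>) x y v = (commutator \<rho> x y (fst v), commutator \<sigma> x y (snd v))"
    for x y v by (simp add: commutator_def sum_rep_def)
  show ?thesis
  proof (rule affine_sl2_rep.intro)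
    show "clinear (sum_rep \<rho> \<sigma> x)" for x
      by (rule clinearI) (simp_all add: sum_rep_def r.rep_simps s.rep_simps scaleC_prod_def)
  qed (simp_all add: com r.E_E s.E_E r.F_F s.F_F r.H_H s.H_H r.H_E s.H_E r.H_F s.H_F r.E_F s.E_F
      r.K_central s.K_central r.D_E s.D_E r.D_H s.D_H r.D_F s.D_F sum_rep_def scaleC_prod_def zero_prod_def)
qed

text \<open>
  In the direct sum of two integrable modules with highest weight vectors \<open>u0\<close>, \<open>v0\<close> of the same
  weight, the pair \<open>(u0, v0)\<close> generates an irreducible module. Neither projection can have a
  kernel on it, so it is the graph of an isomorphism.
\<close>

theorem highest_weight_isomorphism:
  fixes \<rho> :: "'w::complex_vector rep" and \<sigma> :: "'v::complex_vector rep"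
  assumes u: "integrable_highest_weight \<rho> u0 j c" and v: "irreducible_integrable \<sigma> v0 j c"
  obtains \<psi> where "clinear \<psi>" "inj \<psi>" "\<And>x w. \<psi> (\<sigma> x w) = \<rho> x (\<psi> w)" "\<psi> v0 = u0"
proof -
  interpret U: integrable_highest_weight \<rho> u0 j c by (rule u)
  interpret V: irreducible_integrable \<sigma> v0 j c by (rule v)
  let ?\<tau> = "sum_rep \<rho> \<sigma>"
  interpret T: affine_sl2_rep ?\<tau>
    by (rule affine_sum_rep [OF U.affine_sl2_rep_axioms V.affine_sl2_rep_axioms])
  have nil: "\<exists>n. (?\<tau> x ^^ n) (u0, v0) = 0"
    if u0: "\<exists>n. (\<rho> x ^^ n) u0 = 0" and v0: "\<exists>n. (\<sigma> x ^^ n) v0 = 0" for x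
  proof -
    obtain m n where "(\<rho> x ^^ m) u0 = 0" "(\<sigma> x ^^ n) v0 = 0" using u0 v0 by blast
    then have "(\<rho> x ^^ (m + n)) u0 = 0" "(\<sigma> x ^^ (m + n)) v0 = 0"
      using clinear_funpow_eq_0_mono [OF U.clinear_rep] clinear_funpow_eq_0_mono [OF V.clinear_rep] by auto
    then show ?thesis by (auto simp: sum_rep_funpow zero_prod_def)
  qed
  interpret P: integrable_highest_weight ?\<tau> "(u0, v0)" j c
  proof
    show "highest_weight_vector ?\<tau> (u0, v0)"
      using U.highest V.highest by (simp add: highest_weight_vector_def sum_rep_def zero_prod_def)
    show "\<exists>n. (?\<tau> (F 0) ^^ n) (u0, v0) = 0" "\<exists>n. (?\<tau> (E (- 1)) ^^ n) (u0, v0) = 0"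
      using nil U.nilpotent_F V.nilpotent_F U.nilpotent_E V.nilpotent_E by blast+
  qed (simp_all add: sum_rep_def U.nonzero U.wt_H V.wt_H U.wt_K V.wt_K U.wt_D V.wt_D scaleC_prod_def zero_prod_def)
  let ?G = P.hw_module
  note G = P.module_subspace and Gc = P.module_closed
  have kernel: "p = 0" if p: "p \<in> ?G" "g p = 0" and g: "clinear g" "g (u0, v0) \<noteq> 0"
    and inter: "\<And>x p. g p = 0 \<Longrightarrow> g (?\<tau> x p) = 0" for g :: "'w \<times> 'v \<Rightarrow> 'z::complex_vector" and p
  proof (rule ccontr)
    assume "p \<noteq> 0"
    have "complex_vector.subspace {p. g p \<in> {0}}"
      by (rule clinear_vimage_subspace [OF g(1) complex_vector.subspace_single_0])
    then have "submodule ?\<tau> (?G \<inter> {p. g p = 0})"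
      using G Gc inter by (auto simp: submodule_def intro!: complex_vector.subspace_inter)
    from P.module_irreducible [OF this _ _ \<open>p \<noteq> 0\<close>] p have "?G \<inter> {p. g p = 0} = ?G" by auto
    then show False using P.v0_mem g(2) by auto
  qed
  have lin: "clinear (fst :: 'w \<times> 'v \<Rightarrow> 'w)" "clinear (snd :: 'w \<times> 'v \<Rightarrow> 'v)"
    by (rule clinearI; simp add: scaleC_prod_def)+
  have fst0: "p = 0" if "p \<in> ?G" "fst p = 0" for p
    by (rule kernel [OF that lin(1)]) (auto simp: sum_rep_def U.rep_simps U.nonzero)
  have snd0: "p = 0" if "p \<in> ?G" "snd p = 0" for p
    by (rule kernel [OF that lin(2)]) (auto simp: sum_rep_def V.rep_simps V.nonzero)
  have "submodule \<sigma> (snd ` ?G)"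
    unfolding submodule_def
  proof (intro conjI allI ballI)
    show "complex_vector.subspace (snd ` ?G)" by (rule clinear_image_subspace [OF lin(2) G])
    fix x w assume "w \<in> snd ` ?G"
    then obtain p where p: "p \<in> ?G" "w = snd p" by blast
    then have "\<sigma> x w = snd (?\<tau> x p)" by (simp add: sum_rep_def)
    then show "\<sigma> x w \<in> snd ` ?G" using Gc [OF p(1)] by blast
  qed
  moreover have "v0 \<in> snd ` ?G" using P.v0_mem by force
  ultimately have "V.hw_module \<subseteq> snd ` ?G"
    unfolding V.hw_module_def by (rule generated_submodule_minimal)
  then have "\<exists>a. (a, w) \<in> ?G" for w using V.generated by force
  then obtain \<psi> where \<psi>: "\<And>w. (\<psi> w, w) \<in> ?G" by metis
  have uniq: "\<psi> w = a" if "(a, w) \<in> ?G" for a w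
    using snd0 [of "(\<psi> w, w) - (a, w)"] complex_vector.subspace_diff [OF G \<psi> [of w] that]
    by (simp add: zero_prod_def)
  show thesis
  proof (rule that)
    show "clinear \<psi>"
    proof (rule clinearI)
      show "\<psi> (x + y) = \<psi> x + \<psi> y" for x y
        using complex_vector.subspace_add [OF G \<psi> [of x] \<psi> [of y]] by (intro uniq) simp
      show "\<psi> (a *\<^sub>C x) = a *\<^sub>C \<psi> x" for a x
        using complex_vector.subspace_scale [OF G \<psi> [of x], of a] by (intro uniq) (simp add: scaleC_Pair)
    qed
    show "inj \<psi>"
    proof (rule injI)
      fix x y assume "\<psi> x = \<psi> y"
      then show "x = y"
        using fst0 [of "(\<psi> x, x) - (\<psi> y, y)"] complex_vector.subspace_diff [OF G \<psi> [of x] \<psi> [of y]]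
        by (simp add: zero_prod_def)
    qed
    show "\<psi> (\<sigma> x w) = \<rho> x (\<psi> w)" for x w
      using Gc [OF \<psi> [of w], of x] by (intro uniq) (simp add: sum_rep_def)
    show "\<psi> v0 = u0" by (rule uniq [OF P.v0_mem])
  qed
qed

section \<open>Replacing a tensor factor by an isomorphic copy\<close>

definition cons_tensor :: "'v::complex_vector \<Rightarrow> 'v tensor \<Rightarrow> 'v tensor" where
  "cons_tensor x = tensor_lift (\<lambda>ws. pure (x # ws))"

lemma multilinear_pure_Cons: "multilinear (\<lambda>ws. pure (x # ws))"
  using pure_linear [of "x # us" for us] by (simp add: multilinear_def)

lemma clinear_cons_tensor: "clinear (cons_tensor x)"
  and cons_tensor_pure: "cons_tensor x (pure ws) = pure (x # ws)"
  unfolding cons_tensor_def by (rule tensor_lift [OF multilinear_pure_Cons])+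

lemma clinear_cons_tensor_left: "clinear (\<lambda>x. cons_tensor x t)"
proof (rule clinearI)
  note lin = clinear_cons_tensor
  show "cons_tensor (x + y) t = cons_tensor x t + cons_tensor y t" for x y
    by (rule clinear_eq_on_pure [OF lin clinear_plus [OF lin lin]])
      (simp add: cons_tensor_pure clinear_add [OF pure_linear_Cons])
  show "cons_tensor (c *\<^sub>C x) t = c *\<^sub>C cons_tensor x t" for c x
    by (rule clinear_eq_on_pure [OF lin clinear_scaled [OF lin]])
      (simp add: cons_tensor_pure clinear_scale [OF pure_linear_Cons])
qed

lemma tensor_rep_cons:
  fixes \<rho> :: "'v::complex_vector rep"
  assumes \<rho>: "affine_sl2_rep \<rho>" and reps: "\<forall>\<rho>\<in>set \<rho>s. affine_sl2_rep \<rho>"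
    and t: "t \<in> tensor_power (length \<rho>s)"
  shows "tensor_rep (\<rho> # \<rho>s) g (cons_tensor x t)
    = cons_tensor (\<rho> g x) t + cons_tensor x (tensor_rep \<rho>s g t)"
proof -
  have reps': "\<forall>\<tau>\<in>set (\<rho> # \<rho>s). affine_sl2_rep \<tau>" using \<rho> reps by auto
  note T = clinear_tensor_rep [OF reps, where x = g] and T' = clinear_tensor_rep [OF reps', where x = g]
  note lin = clinear_cons_tensor
  show ?thesis
  proof (rule clinear_eq_on_tensor_power [OF _ _ _ t])
    show "clinear (\<lambda>t. tensor_rep (\<rho> # \<rho>s) g (cons_tensor x t))"
      by (rule clinear_comp [OF T' lin])
    show "clinear (\<lambda>t. cons_tensor (\<rho> g x) t + cons_tensor x (tensor_rep \<rho>s g t))"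
      by (rule clinear_plus [OF lin clinear_comp [OF lin T]])
    fix vs :: "'v list" assume len: "length vs = length \<rho>s"
    have "tensor_rep (\<rho> # \<rho>s) g (pure (x # vs))
        = pure (\<rho> g x # vs) + (\<Sum>a<length \<rho>s. pure (x # vs[a := (\<rho>s ! a) g (vs ! a)]))"
      by (subst tensor_rep_eq [OF reps'])
        (use len in \<open>simp_all add: sum.lessThan_Suc_shift del: sum.lessThan_Suc\<close>)
    then show "tensor_rep (\<rho> # \<rho>s) g (cons_tensor x (pure vs))
        = cons_tensor (\<rho> g x) (pure vs) + cons_tensor x (tensor_rep \<rho>s g (pure vs))"
      by (simp add: cons_tensor_pure tensor_rep_eq [OF reps len] clinear_sum [OF lin])
  qed
qed

lemma tensor_rep_pair:
  assumes "affine_sl2_rep \<rho>" "affine_sl2_rep \<sigma>"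
  shows "tensor_rep [\<rho>, \<sigma>] g (pure [x, y]) = pure [\<rho> g x, y] + pure [x, \<sigma> g y]"
proof -
  have "\<forall>\<tau>\<in>set [\<rho>, \<sigma>]. affine_sl2_rep \<tau>" using assms by auto
  from tensor_rep_eq [OF this, where vs = "[x, y]" and x = g] show ?thesis by simp
qed

lemma pure_pair_linear: "clinear (\<lambda>x. pure [x, y])" "clinear (\<lambda>y. pure [x, y])"
  using pure_linear [of "[]" "[y]"] pure_linear [of "[x]" "[]"] by simp_all

lemma tensor_power_2_induct:
  assumes "t \<in> tensor_power 2" "complex_vector.subspace S" "\<And>x y. pure [x, y] \<in> S"
  shows "t \<in> S"
  by (rule tensor_power_induct [OF assms(1,2)]) (auto simp: assms(3) length_Suc_conv numeral_2_eq_2)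

text \<open>
  An injective intertwiner on the second factor stays injective after tensoring with the first
  factor, because it has a linear left inverse.
\<close>

lemma tensor_intertwiner:
  fixes \<psi> :: "'v::complex_vector \<Rightarrow> 'v tensor"
  assumes \<rho>: "affine_sl2_rep \<rho>" and \<sigma>: "affine_sl2_rep \<sigma>"
    and reps: "\<forall>\<rho>\<in>set \<rho>s. affine_sl2_rep \<rho>"
    and \<psi>: "clinear \<psi>" "inj \<psi>" "\<And>g y. \<psi> (\<sigma> g y) = tensor_rep \<rho>s g (\<psi> y)"
    and power: "\<And>y. \<psi> y \<in> tensor_power (length \<rho>s)"
  obtains \<Theta> where "clinear \<Theta>" "inj_on \<Theta> (tensor_power 2)"
    "\<And>x y. \<Theta> (pure [x, y]) = cons_tensor x (\<psi> y)"
    "\<And>g t. t \<in> tensor_power 2 \<Longrightarrow> \<Theta> (tensor_rep [\<rho>, \<sigma>] g t) = tensor_rep (\<rho> # \<rho>s) g (\<Theta> t)"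
proof -
  interpret vector_space_pair "scaleC :: complex \<Rightarrow> 'v \<Rightarrow> 'v" "scaleC :: complex \<Rightarrow> 'v tensor \<Rightarrow> 'v tensor" ..
  obtain \<chi> :: "'v tensor \<Rightarrow> 'v" where \<chi>: "clinear \<chi>" "\<chi> \<circ> \<psi> = id"
    using linear_injective_left_inverse [OF \<psi>(1,2)] by blast
  define f where "f vs = (if length vs = 2 then cons_tensor (vs ! 0) (\<psi> (vs ! 1)) else 0)" for vs
  have "clinear (\<lambda>x. f (us @ x # ws))" for us ws
  proof -
    consider y where "us = []" "ws = [y]" | y where "us = [y]" "ws = []" | "length us + length ws \<noteq> 1"
      by (cases us; cases ws) auto
    then show ?thesis
    proof cases
      case 1
      then show ?thesis by (simp add: f_def clinear_cons_tensor_left)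
    next
      case 2
      then show ?thesis by (simp add: f_def clinear_comp [OF clinear_cons_tensor \<psi>(1)])
    next
      case 3
      then have "f (us @ x # ws) = 0" for x by (auto simp: f_def)
      then show ?thesis by (auto intro: clinearI)
    qed
  qed
  then have "multilinear f" by (simp add: multilinear_def)
  note \<Theta> = tensor_lift [OF this]
  define \<Theta> where "\<Theta> = tensor_lift f"
  have \<Theta>_pure: "\<Theta> (pure [x, y]) = cons_tensor x (\<psi> y)" for x y
    unfolding \<Theta>_def \<Theta>(2) by (simp add: f_def)
  define f' where "f' vs = (case vs of [] \<Rightarrow> 0 | x # ws \<Rightarrow> pure [x, \<chi> (pure ws)])" for vs
  have "clinear (\<lambda>x. f' (us @ x # ws))" for us ws
  proof (cases us)
    case Nil
    then show ?thesis by (simp add: f'_def pure_pair_linear)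
  next
    case (Cons a us')
    show ?thesis
      unfolding Cons f'_def
      using clinear_comp [OF pure_pair_linear(2) clinear_comp [OF \<chi>(1) pure_linear]] by simp
  qed
  then have "multilinear f'" by (simp add: multilinear_def)
  note \<Theta>' = tensor_lift [OF this]
  have cons: "tensor_lift f' (cons_tensor x t) = pure [x, \<chi> t]" for x t
    by (rule clinear_eq_on_pure [OF clinear_comp [OF \<Theta>'(1) clinear_cons_tensor]
          clinear_comp [OF pure_pair_linear(2) \<chi>(1)]])
      (simp add: cons_tensor_pure \<Theta>'(2) f'_def)
  have lin: "clinear \<Theta>" unfolding \<Theta>_def by (rule \<Theta>(1))
  have inv: "tensor_lift f' (\<Theta> t) = t" if t: "t \<in> tensor_power 2" for t
  proof -
    have "complex_vector.subspace {t. tensor_lift f' (\<Theta> t) - t \<in> {0}}"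
      by (rule clinear_vimage_subspace [OF clinear_minus [OF clinear_comp [OF \<Theta>'(1) lin] clinear_ident]])
        (rule complex_vector.subspace_single_0)
    then have "t \<in> {t. tensor_lift f' (\<Theta> t) - t \<in> {0}}"
      by (rule tensor_power_2_induct [OF t])
        (use \<chi>(2) in \<open>simp add: \<Theta>_pure cons fun_eq_iff\<close>)
    then show ?thesis by simp
  qed
  have reps2: "\<forall>\<tau>\<in>set [\<rho>, \<sigma>]. affine_sl2_rep \<tau>" using \<rho> \<sigma> by auto
  have reps': "\<forall>\<tau>\<in>set (\<rho> # \<rho>s). affine_sl2_rep \<tau>" using \<rho> reps by auto
  show thesis
  proof (rule that [OF lin _ \<Theta>_pure])
    show "inj_on \<Theta> (tensor_power 2)" by (rule inj_on_inverseI) (rule inv)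
    fix g and t :: "'v tensor" assume t: "t \<in> tensor_power 2"
    note T = clinear_tensor_rep [OF reps2, where x = g] and T' = clinear_tensor_rep [OF reps', where x = g]
    have "complex_vector.subspace {t. \<Theta> (tensor_rep [\<rho>, \<sigma>] g t) - tensor_rep (\<rho> # \<rho>s) g (\<Theta> t) \<in> {0}}"
      by (rule clinear_vimage_subspace [OF clinear_minus [OF clinear_comp [OF lin T] clinear_comp [OF T' lin]]])
        (rule complex_vector.subspace_single_0)
    then have "t \<in> {t. \<Theta> (tensor_rep [\<rho>, \<sigma>] g t) - tensor_rep (\<rho> # \<rho>s) g (\<Theta> t) \<in> {0}}"
    proof (rule tensor_power_2_induct [OF t])
      fix x y
      show "pure [x, y] \<in> {t. \<Theta> (tensor_rep [\<rho>, \<sigma>] g t) - tensor_rep (\<rho> # \<rho>s) g (\<Theta> t) \<in> {0}}"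
        by (simp add: tensor_rep_pair [OF \<rho> \<sigma>] clinear_add [OF lin] \<Theta>_pure \<psi>(3)
            tensor_rep_cons [OF \<rho> reps power])
    qed
    then show "\<Theta> (tensor_rep [\<rho>, \<sigma>] g t) = tensor_rep (\<rho> # \<rho>s) g (\<Theta> t)" by simp
  qed
qed

lemma generated_submodule_image:
  assumes lin: "clinear \<Theta>" and P: "submodule \<rho> P" "w \<in> P"
    and inter: "\<And>x t. t \<in> P \<Longrightarrow> \<Theta> (\<rho> x t) = \<sigma> x (\<Theta> t)"
  shows "\<Theta> ` generated_submodule \<rho> w = generated_submodule \<sigma> (\<Theta> w)"
proof
  have G: "submodule \<rho> (generated_submodule \<rho> w)" by (rule submodule_generated)
  have GP: "generated_submodule \<rho> w \<subseteq> P" by (rule generated_submodule_minimal [OF P])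
  have G': "submodule \<sigma> (generated_submodule \<sigma> (\<Theta> w))" by (rule submodule_generated)
  have "submodule \<rho> (P \<inter> {t. \<Theta> t \<in> generated_submodule \<sigma> (\<Theta> w)})"
    unfolding submodule_def
    using clinear_vimage_subspace [OF lin submodule_subspace [OF G']] submodule_subspace [OF P(1)]
    by (auto simp: inter submodule_closed [OF G'] submodule_closed [OF P(1)]
        intro: complex_vector.subspace_inter)
  from generated_submodule_minimal [OF this, of w]
  show "\<Theta> ` generated_submodule \<rho> w \<subseteq> generated_submodule \<sigma> (\<Theta> w)"
    using P(2) generated_submodule_mem by blast
  have "submodule \<sigma> (\<Theta> ` generated_submodule \<rho> w)"
    unfolding submodule_def
  proof (intro conjI allI ballI)
    show "complex_vector.subspace (\<Theta> ` generated_submodule \<rho> w)"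
      by (rule clinear_image_subspace [OF lin submodule_subspace [OF G]])
    fix x t assume "t \<in> \<Theta> ` generated_submodule \<rho> w"
    then obtain u where u: "u \<in> generated_submodule \<rho> w" "t = \<Theta> u" by blast
    then have "\<sigma> x t = \<Theta> (\<rho> x u)" using inter GP by auto
    then show "\<sigma> x t \<in> \<Theta> ` generated_submodule \<rho> w" using submodule_closed [OF G u(1)] by blast
  qed
  then show "generated_submodule \<sigma> (\<Theta> w) \<subseteq> \<Theta> ` generated_submodule \<rho> w"
    by (rule generated_submodule_minimal) (simp add: generated_submodule_mem)
qed

lemma dim_injective_image:
  fixes f :: "'a::complex_vector \<Rightarrow> 'b::complex_vector"
  assumes lin: "clinear f" and T: "complex_vector.subspace T" and inj: "inj_on f T"
  shows "complex_vector.dim (f ` T) = complex_vector.dim T"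
proof -
  interpret vector_space_pair "scaleC :: complex \<Rightarrow> 'a \<Rightarrow> 'a" "scaleC :: complex \<Rightarrow> 'b \<Rightarrow> 'b" ..
  obtain B where B: "B \<subseteq> T" "complex_vector.independent B" "T \<subseteq> complex_vector.span B"
    by (rule complex_vector.maximal_independent_subset)
  then have span: "complex_vector.span B = T"
    using complex_vector.span_minimal [OF B(1) T] by blast
  have "complex_vector.independent (f ` B)"
    by (rule linear_independent_injective_image [OF lin B(2)]) (simp add: span inj)
  moreover have "complex_vector.span (f ` B) = complex_vector.span (f ` T)"
    using clinear_image_span [OF lin, of B] by (simp add: span complex_vector.span_span)
  ultimately have "complex_vector.dim (f ` T) = card (f ` B)" by (intro complex_vector.dim_eq_card)
  also have "\<dots> = card B" by (rule card_image [OF inj_on_subset [OF inj B(1)]])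
  also have "\<dots> = complex_vector.dim T"
    by (rule complex_vector.dim_eq_card [symmetric]) (simp_all add: span [symmetric] B(2) complex_vector.span_span)
  finally show ?thesis .
qed

section \<open>The tensor product with a level one module\<close>

text \<open>
  Since degrees are nonnegative in both factors, degree \<open>s\<close> of the tensor product only involves the
  finitely many pairs of degrees \<open>a\<close> and \<open>s - a\<close> with \<open>0 \<le> a \<le> s\<close>.
\<close>

lemma tensor_grade_finite:
  assumes "irreducible_integrable \<rho> v j c" and "irreducible_integrable \<sigma> w j' c'"
  shows "\<exists>B. finite B \<and>
    {t \<in> tensor_power 2. tensor_rep [\<rho>, \<sigma>] D t = of_int s *\<^sub>C t} \<subseteq> complex_vector.span B"
proof -
  interpret V: irreducible_integrable \<rho> v j c by fact
  interpret W: irreducible_integrable \<sigma> w j' c' by fact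
  note reps = V.affine_sl2_rep_axioms W.affine_sl2_rep_axioms
  have reps2: "\<forall>\<tau>\<in>set [\<rho>, \<sigma>]. affine_sl2_rep \<tau>" using reps by auto
  obtain B where B: "\<And>a. finite (B a)" "\<And>a. V.grade a \<subseteq> complex_vector.span (B a)"
    using V.grade_finite by metis
  obtain C where C: "\<And>a. finite (C a)" "\<And>a. W.grade a \<subseteq> complex_vector.span (C a)"
    using W.grade_finite by metis
  define G where "G = (\<lambda>(x, y). pure [x, y]) `
    ({x. \<exists>a. lowered \<rho> v a x} \<times> {y. \<exists>b. lowered \<sigma> w b y})"
  define A where "A = (\<Union>a\<in>{0..s}. (\<lambda>(x, y). pure [x, y]) ` (B a \<times> C (s - a)))"
  have "finite A" using B(1) C(1) by (simp add: A_def)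
  have span_G: "pure [x, y] \<in> complex_vector.span G" for x y
  proof (rule clinear_span_mem [OF pure_pair_linear(1)])
    show "x \<in> complex_vector.span {x. \<exists>a. lowered \<rho> v a x}"
      using V.generated V.module_eq by auto
    fix x' assume x': "x' \<in> {x. \<exists>a. lowered \<rho> v a x}"
    show "pure [x', y] \<in> complex_vector.span G"
    proof (rule clinear_span_mem [OF pure_pair_linear(2)])
      show "y \<in> complex_vector.span {y. \<exists>b. lowered \<sigma> w b y}"
        using W.generated W.module_eq by auto
      fix y' assume "y' \<in> {y. \<exists>b. lowered \<sigma> w b y}"
      with x' show "pure [x', y'] \<in> complex_vector.span G"
        by (intro complex_vector.span_base) (auto simp: G_def)
    qed simp
  qed simp
  have G_eig: "tensor_rep [\<rho>, \<sigma>] D (pure [x, y]) = of_int (a + b) *\<^sub>C pure [x, y]"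
    if "lowered \<rho> v a x" "lowered \<sigma> w b y" for a b x y
    using that
    by (simp add: tensor_rep_pair [OF reps] V.lowered_D W.lowered_D scaleC_add_left
        clinear_scale [OF pure_pair_linear(1)] clinear_scale [OF pure_pair_linear(2)])
  have "t \<in> complex_vector.span A"
    if t: "t \<in> tensor_power 2" and Dt: "tensor_rep [\<rho>, \<sigma>] D t = of_int s *\<^sub>C t" for t
  proof -
    have "t \<in> complex_vector.span G"
      by (rule tensor_power_2_induct [OF t _ span_G]) simp
    then have "t \<in> complex_vector.span {b \<in> G. tensor_rep [\<rho>, \<sigma>] D b = of_int s *\<^sub>C b}"
      by (rule eigenvector_in_span [OF clinear_tensor_rep [OF reps2] _ _ Dt])
        (use G_eig in \<open>auto simp: G_def\<close>)
    then show ?thesis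
    proof (rule clinear_span_mem [OF clinear_ident])
      fix p assume "p \<in> {b \<in> G. tensor_rep [\<rho>, \<sigma>] D b = of_int s *\<^sub>C b}"
      then obtain x y a b where p: "p = pure [x, y]" and x: "lowered \<rho> v a x" and y: "lowered \<sigma> w b y"
        and Dp: "tensor_rep [\<rho>, \<sigma>] D p = of_int s *\<^sub>C p"
        by (auto simp: G_def)
      show "p \<in> complex_vector.span A"
      proof (cases "p = 0")
        case False
        have "of_int (a + b) *\<^sub>C p = of_int s *\<^sub>C p" using G_eig [OF x y] Dp p by simp
        then have "complex_of_int (a + b) = of_int s"
          using False complex_vector.scale_cancel_right by blast
        then have s: "b = s - a" by (simp only: of_int_eq_iff)
        have a: "a \<in> {0..s}" using s V.lowered_nonneg [OF x] W.lowered_nonneg [OF y] by simp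
        have xB: "x \<in> complex_vector.span (B a)" using B(2) V.lowered_grade [OF x] by blast
        have yC: "y \<in> complex_vector.span (C (s - a))" using C(2) W.lowered_grade [OF y] s by blast
        show ?thesis
          unfolding p
        proof (rule clinear_span_mem [OF pure_pair_linear(1) xB])
          fix x' assume x': "x' \<in> B a"
          show "pure [x', y] \<in> complex_vector.span A"
          proof (rule clinear_span_mem [OF pure_pair_linear(2) yC])
            fix y' assume "y' \<in> C (s - a)"
            with x' a show "pure [x', y'] \<in> complex_vector.span A"
              by (intro complex_vector.span_base) (auto simp: A_def)
          qed simp
        qed simp
      qed (simp add: complex_vector.span_zero)
    qed simp
  qed
  with \<open>finite A\<close> show ?thesis by blast
qed

text \<open>
  The vector \<open>x(p) \<otimes> u\<close>, where \<open>x(p)\<close> is extremal of weight \<open>- p\<close>, generates \<open>x(- p) \<otimes> w\<close> with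
  the highest weight vector \<open>w\<close>, by the top power of \<open>e\<^sub>0\<close>. The Borel subalgebra acts on
  \<open>w\<close> by scalars, so it generates \<open>x \<otimes> w\<close> for all \<open>x\<close> in a Borel submodule that exhausts the first
  factor as \<open>p\<close> grows; and \<open>w\<close> generates the second factor.
\<close>

lemma (in level_one) tensor_exhaustion:
  assumes W: "irreducible_integrable \<sigma> w j c"
    and u: "(\<sigma> (E 0) ^^ j) u = b *\<^sub>C w" "b \<noteq> 0"
    and x: "\<And>n. a n \<noteq> 0" "\<And>n. x n = a n *\<^sub>C chain (2 * n + i)"
    and t: "t \<in> tensor_power 2"
  shows "\<exists>n0. \<forall>n\<ge>n0. t \<in> generated_submodule (tensor_rep [\<rho>, \<sigma>]) (pure [x n, u])"
proof -
  interpret W: irreducible_integrable \<sigma> w j c by (rule W)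
  note reps = affine_sl2_rep_axioms W.affine_sl2_rep_axioms
  have reps2: "\<forall>\<tau>\<in>set [\<rho>, \<sigma>]. affine_sl2_rep \<tau>" using reps by auto
  define M where "M n = generated_submodule (tensor_rep [\<rho>, \<sigma>]) (pure [x n, u])" for n
  have M: "submodule (tensor_rep [\<rho>, \<sigma>]) (M n)" for n unfolding M_def by (rule submodule_generated)
  note sub = submodule_subspace [OF M] and closed = submodule_closed [OF M]
  have top: "pure [chain (2 * n + i - 1), w] \<in> M n" if n: "n \<ge> 1" for n
  proof -
    define p where "p = 2 * n + i - 1"
    have p: "2 * n + i = Suc p" "odd (p + i)" using n by (auto simp: p_def)
    then have raise: "raise_op p = E 0" by (simp add: raise_op_def)
    obtain d where d: "d \<noteq> 0" "(\<rho> (E 0) ^^ Suc p) (chain (Suc p)) = d *\<^sub>C chain p"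
      using chain_back [of p] by (auto simp: raise simp del: chain.simps funpow.simps)
    have E_chain: "\<rho> (E 0) (chain p) = 0" using chain_raise [of p] by (simp add: raise)
    have x_top: "(\<rho> (E 0) ^^ Suc p) (x n) = (a n * d) *\<^sub>C chain p"
      by (simp only: x(2) p(1) clinear_scale [OF clinear_funpow [OF clinear_rep]] d(2) scaleC_scaleC)
    have "\<exists>m>0. (tensor_rep [\<rho>, \<sigma>] (E 0) ^^ sum_list [Suc p, j]) (pure [x n, u]) = of_nat m *\<^sub>C
        pure (map (\<lambda>q. (([\<rho>, \<sigma>] ! q) (E 0) ^^ ([Suc p, j] ! q)) ([x n, u] ! q)) [0..<length [\<rho>, \<sigma>]])"
    proof (rule tensor_rep_top_power [OF reps2])
      fix q assume "q < length [\<rho>, \<sigma>]"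
      then have "q = 0 \<or> q = 1" by auto
      then show "([\<rho>, \<sigma>] ! q) (E 0) ((([\<rho>, \<sigma>] ! q) (E 0) ^^ ([Suc p, j] ! q)) ([x n, u] ! q)) = 0"
        using x_top u(1) W.E0_v0 E_chain
        by (auto simp: rep_simps W.rep_simps simp del: funpow.simps)
    qed simp_all
    then obtain m where m: "m > 0" and
      "(tensor_rep [\<rho>, \<sigma>] (E 0) ^^ sum_list [Suc p, j]) (pure [x n, u])
        = of_nat m *\<^sub>C pure [(\<rho> (E 0) ^^ Suc p) (x n), (\<sigma> (E 0) ^^ j) u]"
      by (auto simp: upt_rec simp del: funpow.simps)
    then have eq: "(tensor_rep [\<rho>, \<sigma>] (E 0) ^^ sum_list [Suc p, j]) (pure [x n, u])
        = (of_nat m * (a n * d * b)) *\<^sub>C pure [chain p, w]"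
      by (simp only: x_top u(1) clinear_scale [OF pure_pair_linear(1)]
          clinear_scale [OF pure_pair_linear(2)] scaleC_scaleC mult_ac)
    have "pure [x n, u] \<in> M n" unfolding M_def by (rule generated_submodule_mem)
    then have "(of_nat m * (a n * d * b)) *\<^sub>C pure [chain p, w] \<in> M n"
      unfolding eq [symmetric] by (rule submodule_funpow [OF M])
    then have "pure [chain p, w] \<in> M n"
      by (rule subspace_scale_cancel [OF sub, rotated]) (use m x(1) d(1) u(2) in simp)
    then show ?thesis by (simp add: p_def)
  qed
  have borel: "pure [z, w] \<in> M n" if n: "n \<ge> 1" and z: "z \<in> borel_submodule \<rho> (chain (2 * n + i - 1))" for z n
  proof -
    have w_scalar: "\<exists>b. \<sigma> g w = b *\<^sub>C w" if "g \<in> borel" for g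
    proof -
      have "\<exists>b. \<sigma> (X r) w = b *\<^sub>C w" if "X \<in> {E, H, F}" "r > 0" for X r
        using W.positive_v0 [OF that] by (intro exI [of _ 0]) simp
      moreover have "\<exists>b. \<sigma> (E 0) w = b *\<^sub>C w" "\<exists>b. \<sigma> D w = b *\<^sub>C w"
        using W.E0_v0 W.wt_D by (auto intro: exI [of _ 0])
      moreover have "\<exists>b. \<sigma> (H 0) w = b *\<^sub>C w" "\<exists>b. \<sigma> K w = b *\<^sub>C w"
        using W.wt_H W.wt_K by auto
      ultimately show ?thesis using that unfolding borel_def
        by (auto simp: order_le_less)
    qed
    have "borel_stable \<rho> {z. pure [z, w] \<in> M n}"
      unfolding borel_stable_def
    proof (intro conjI ballI)
      show "complex_vector.subspace {z. pure [z, w] \<in> M n}"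
        by (rule clinear_vimage_subspace [OF pure_pair_linear(1) sub])
      fix g z assume g: "g \<in> borel" and z: "z \<in> {z. pure [z, w] \<in> M n}"
      obtain b where "\<sigma> g w = b *\<^sub>C w" using w_scalar [OF g] by blast
      then have "pure [\<rho> g z, w] = tensor_rep [\<rho>, \<sigma>] g (pure [z, w]) - b *\<^sub>C pure [z, w]"
        by (simp add: tensor_rep_pair [OF reps] clinear_scale [OF pure_pair_linear(2)])
      then show "\<rho> g z \<in> {z. pure [z, w] \<in> M n}"
        using z closed sub by (simp add: complex_vector.subspace_diff complex_vector.subspace_scale)
    qed
    from borel_submodule_minimal [OF this, of "chain (2 * n + i - 1)"] top [OF n] z
    show ?thesis by auto
  qed
  define A where "A = {t. \<exists>n0. \<forall>n\<ge>n0. t \<in> M n}"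
  have A_sub: "complex_vector.subspace A"
  proof (rule complex_vector.subspaceI)
    show "0 \<in> A" unfolding A_def using complex_vector.subspace_0 [OF sub] by blast
  next
    fix s t assume "s \<in> A" "t \<in> A"
    then obtain m n where "\<forall>k\<ge>m. s \<in> M k" "\<forall>k\<ge>n. t \<in> M k" unfolding A_def by blast
    then have "\<forall>k\<ge>max m n. s + t \<in> M k"
      using complex_vector.subspace_add [OF sub] by simp
    then show "s + t \<in> A" unfolding A_def by blast
  next
    fix d t assume "t \<in> A"
    then show "d *\<^sub>C t \<in> A" unfolding A_def using complex_vector.subspace_scale [OF sub] by blast
  qed
  have A_closed: "tensor_rep [\<rho>, \<sigma>] g t \<in> A" if "t \<in> A" for g t
    using that closed unfolding A_def by blast
  have A_w: "pure [z, w] \<in> A" for z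
  proof -
    obtain m where m: "z \<in> borel_submodule \<rho> (chain m)" using borel_chain_exhausts by blast
    have "pure [z, w] \<in> M n" if n: "n \<ge> Suc m" for n
    proof (rule borel)
      have "m \<le> 2 * n + i - 1" using n by linarith
      then show "z \<in> borel_submodule \<rho> (chain (2 * n + i - 1))"
        using borel_chain_mono m by blast
    qed (use n in simp)
    then show ?thesis unfolding A_def by blast
  qed
  have "W.hw_module \<subseteq> {y. \<forall>z. pure [z, y] \<in> A}"
    unfolding W.hw_module_def
  proof (rule generated_submodule_minimal)
    show "submodule \<sigma> {y. \<forall>z. pure [z, y] \<in> A}"
      unfolding submodule_def
    proof (intro conjI allI ballI)
      show "complex_vector.subspace {y. \<forall>z. pure [z, y] \<in> A}"
        using A_sub
        by (auto simp: complex_vector.subspace_def clinear_simps [OF pure_pair_linear(2)])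
      fix g y assume y: "y \<in> {y. \<forall>z. pure [z, y] \<in> A}"
      have "pure [z, \<sigma> g y] = tensor_rep [\<rho>, \<sigma>] g (pure [z, y]) - pure [\<rho> g z, y]" for z
        by (simp add: tensor_rep_pair [OF reps])
      then show "\<sigma> g y \<in> {y. \<forall>z. pure [z, y] \<in> A}"
        using y A_closed A_sub by (simp add: complex_vector.subspace_diff)
    qed
  qed (simp add: A_w)
  then have "pure [z, y] \<in> A" for z y using W.generated by auto
  then have "t \<in> A" by (rule tensor_power_2_induct [OF t A_sub])
  then show ?thesis unfolding A_def M_def by blast
qed

section \<open>Characters of the spaces of highest weight vectors\<close>

lemma tail_sums_one_power_tuple:
  assumes "j \<le> k"
  shows "tail_sums (one_power_tuple (k + 1) N j) = (N + 1) # replicate j 1 @ replicate (k - j) 0"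
proof (rule nth_equalityI)
  show "length (tail_sums (one_power_tuple (k + 1) N j))
      = length ((N + 1) # replicate j 1 @ replicate (k - j) 0)"
    using assms by (simp add: tail_sums_def one_power_tuple_def del: upt_Suc)
next
  fix a assume "a < length (tail_sums (one_power_tuple (k + 1) N j))"
  then have a: "a \<le> k" by (simp add: tail_sums_def one_power_tuple_def del: upt_Suc)
  have "tail_sums (one_power_tuple (k + 1) N j) ! a
      = (\<Sum>b\<in>{a + 1..<k + 2}. (if b = 1 then N else 0) + (if b = j + 1 then 1 else 0))"
    using a
    by (simp add: tail_sums_def one_power_tuple_def drop_map sum_list_distinct_conv_sum_set del: upt_Suc)
  also have "\<dots> = (if a = 0 then N else 0) + (if a \<le> j then 1 else 0)"
    using assms by (simp add: sum.distrib sum.delta)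
  finally show "tail_sums (one_power_tuple (k + 1) N j) ! a
      = ((N + 1) # replicate j 1 @ replicate (k - j) 0) ! a"
    using a assms by (cases a) (auto simp: nth_append)
qed

text \<open>
  A product of \<open>k\<close> highest weight vectors of level one, \<open>j\<close> of them of weight \<open>1\<close> and the others of
  weight \<open>0\<close>, is a highest weight vector of level \<open>k\<close> and weight \<open>j\<close>. So it generates a copy of the
  irreducible module. In it, \<open>f\<^sub>0\<^sup>j\<close> leads to the product of the lowest vectors \<open>f\<^sub>0 u1\<close> and \<open>u0\<close> of
  the degree zero components, by the top power of \<open>f\<^sub>0\<close>, and \<open>e\<^sub>0\<^sup>j\<close> leads back.
\<close>

lemma level_one_realization:
  fixes L :: "nat \<Rightarrow> nat \<Rightarrow> 'v::complex_vector rep"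
  assumes k: "k \<ge> 1" and j: "j \<le> k"
    and L0: "integrable_highest_weight (L 0 1) u0 0 1" and L1: "integrable_highest_weight (L 1 1) u1 1 1"
    and M: "irreducible_integrable \<sigma> w j k"
  defines "\<rho>s \<equiv> replicate j (L 1 1) @ replicate (k - j) (L 0 1)"
  obtains \<psi> u b where "clinear \<psi>" "inj \<psi>" "\<And>x y. \<psi> (\<sigma> x y) = tensor_rep \<rho>s x (\<psi> y)"
    "\<And>y. \<psi> y \<in> tensor_power k"
    "\<psi> u = pure (replicate j (L 1 1 (F 0) u1) @ replicate (k - j) u0)"
    "b \<noteq> 0" "(\<sigma> (E 0) ^^ j) u = b *\<^sub>C w"
proof -
  interpret U0: integrable_highest_weight "L 0 1" u0 0 1 by (rule L0)
  interpret U1: integrable_highest_weight "L 1 1" u1 1 1 by (rule L1)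
  interpret W: irreducible_integrable \<sigma> w j k by (rule M)
  define us where "us = replicate j u1 @ replicate (k - j) u0"
  define ns where "ns = replicate j 1 @ replicate (k - j) (0 :: nat)"
  define zs where "zs = replicate j (L 1 1 (F 0) u1) @ replicate (k - j) u0"
  have len: "length \<rho>s = k" "length us = k" "length ns = k" "length zs = k"
    using j by (simp_all add: \<rho>s_def us_def ns_def zs_def)
  have nth: "\<rho>s ! a = (if a < j then L 1 1 else L 0 1)" "us ! a = (if a < j then u1 else u0)"
    "ns ! a = (if a < j then 1 else 0)" "zs ! a = (if a < j then L 1 1 (F 0) u1 else u0)"
    if "a < k" for a
    using that by (auto simp: \<rho>s_def us_def ns_def zs_def nth_append)
  have reps: "\<forall>\<rho>\<in>set \<rho>s. affine_sl2_rep \<rho>"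
    using U0.affine_sl2_rep_axioms U1.affine_sl2_rep_axioms by (auto simp: \<rho>s_def)
  have "integrable_highest_weight (tensor_rep \<rho>s) (pure us)
      (\<Sum>a<length \<rho>s. if a < j then 1 else 0) (\<Sum>a<length \<rho>s. 1)"
    by (rule integrable_highest_weight_tensor) (use k len L0 L1 in \<open>auto simp: nth\<close>)
  moreover have "(\<Sum>a<k. if a < j then 1 else 0 :: nat) = j"
  proof -
    have "(\<Sum>a<k. if a < j then 1 else 0 :: nat) = card {a \<in> {..<k}. a < j}"
      by (simp add: sum.If_cases Int_def)
    also have "{a \<in> {..<k}. a < j} = {..<j}" using j by auto
    finally show ?thesis by simp
  qed
  ultimately have U: "integrable_highest_weight (tensor_rep \<rho>s) (pure us) j k"
    by (simp add: len)
  obtain \<psi> where \<psi>: "clinear \<psi>" "inj \<psi>" "\<And>x y. \<psi> (\<sigma> x y) = tensor_rep \<rho>s x (\<psi> y)" "\<psi> w = pure us"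
    by (rule highest_weight_isomorphism [OF U M]) blast
  have T: "submodule (tensor_rep \<rho>s) (tensor_power k)"
    using submodule_tensor_power [OF reps] by (simp add: len)
  have "submodule \<sigma> {y. \<psi> y \<in> tensor_power k}"
    unfolding submodule_def
    using clinear_vimage_subspace [OF \<psi>(1) submodule_subspace [OF T]]
    by (auto simp: \<psi>(3) submodule_closed [OF T])
  then have "W.hw_module \<subseteq> {y. \<psi> y \<in> tensor_power k}"
    unfolding W.hw_module_def
    by (rule generated_submodule_minimal) (simp add: \<psi>(4) pure_tensor_power len)
  then have power: "\<psi> y \<in> tensor_power k" for y using W.generated by blast
  have "\<exists>c>0. (tensor_rep \<rho>s (F 0) ^^ sum_list ns) (pure us)
      = of_nat c *\<^sub>C pure (map (\<lambda>a. ((\<rho>s ! a) (F 0) ^^ (ns ! a)) (us ! a)) [0..<length \<rho>s])"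
    by (rule tensor_rep_top_power [OF reps])
      (use len U0.F0_top_power U1.F0_top_power in \<open>auto simp: nth\<close>)
  moreover have "map (\<lambda>a. ((\<rho>s ! a) (F 0) ^^ (ns ! a)) (us ! a)) [0..<length \<rho>s] = zs"
    by (rule nth_equalityI) (auto simp: len nth)
  moreover have "sum_list ns = j" by (simp add: ns_def sum_list_replicate)
  ultimately obtain c where c: "c > 0"
    "(tensor_rep \<rho>s (F 0) ^^ j) (pure us) = of_nat c *\<^sub>C pure zs"
    by auto
  have pow: "\<psi> ((\<sigma> (F 0) ^^ n) w) = (tensor_rep \<rho>s (F 0) ^^ n) (pure us)" for n
    by (induction n) (simp_all add: \<psi>)
  define u where "u = inverse (of_nat c) *\<^sub>C (\<sigma> (F 0) ^^ j) w"
  have "\<psi> u = pure zs"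
    using c(1) by (simp add: u_def clinear_scale [OF \<psi>(1)] pow c(2) scaleC_scaleC scaleC_one)
  moreover obtain d where "d \<noteq> 0" "(\<sigma> (E 0) ^^ j) ((\<sigma> (F 0) ^^ j) w) = d *\<^sub>C w"
    using W.sl0.e_pow_f_pow_highest [OF W.wt_H W.E0_v0 order_refl] by blast
  then have "(\<sigma> (E 0) ^^ j) u = (inverse (of_nat c) * d) *\<^sub>C w" "inverse (of_nat c) * d \<noteq> 0"
    using c(1)
    by (simp_all add: u_def clinear_scale [OF clinear_funpow [OF W.clinear_rep]] scaleC_scaleC)
  ultimately show thesis
    using that [OF \<psi>(1,2,3) power] unfolding zs_def by blast
qed

lemma ch_q_highest_weight_space_image:
  fixes \<Theta> :: "'a::complex_vector \<Rightarrow> 'b::complex_vector"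
  assumes \<Theta>: "clinear \<Theta>" "inj_on \<Theta> P" and P: "submodule \<rho> P"
    and inter: "\<And>x t. t \<in> P \<Longrightarrow> \<Theta> (\<rho> x t) = \<sigma> x (\<Theta> t)"
    and \<rho>: "\<And>x. clinear (\<rho> x)" and M: "M \<subseteq> P" "complex_vector.subspace M"
  shows "ch_q \<sigma> (highest_weight_space \<sigma> (\<Theta> ` M) l) s = ch_q \<rho> (highest_weight_space \<rho> M l) s"
proof -
  let ?N = "{t \<in> highest_weight_space \<rho> M l. \<rho> D t = of_int s *\<^sub>C t}"
  have P0: "complex_vector.subspace P" by (rule submodule_subspace [OF P])
  have eig: "\<sigma> x (\<Theta> t) = c *\<^sub>C \<Theta> t \<longleftrightarrow> \<rho> x t = c *\<^sub>C t" if "t \<in> M" for x c t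
  proof -
    have t: "t \<in> P" using that M(1) by blast
    have "\<sigma> x (\<Theta> t) = c *\<^sub>C \<Theta> t \<longleftrightarrow> \<Theta> (\<rho> x t) = \<Theta> (c *\<^sub>C t)"
      by (simp add: inter [OF t] clinear_scale [OF \<Theta>(1)])
    also have "\<dots> \<longleftrightarrow> \<rho> x t = c *\<^sub>C t"
      using inj_on_eq_iff [OF \<Theta>(2) submodule_closed [OF P t] complex_vector.subspace_scale [OF P0 t]] .
    finally show ?thesis .
  qed
  have kill: "\<sigma> x (\<Theta> t) = 0 \<longleftrightarrow> \<rho> x t = 0" if "t \<in> M" for x t
    using eig [OF that, of x 0] by simp
  have hw: "highest_weight_vector \<sigma> (\<Theta> t) \<longleftrightarrow> highest_weight_vector \<rho> t" if "t \<in> M" for t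
    unfolding highest_weight_vector_def by (simp add: kill [OF that])
  have "{t \<in> highest_weight_space \<sigma> (\<Theta> ` M) l. \<sigma> D t = of_int s *\<^sub>C t} = \<Theta> ` ?N"
    by (auto simp: highest_weight_space_def hw eig)
  moreover have "complex_vector.subspace ?N"
    using M(2)
    by (auto simp: highest_weight_space_def highest_weight_vector_def complex_vector.subspace_def
        clinear_simps [OF \<rho>] scaleC_add_right scaleC_scaleC mult.commute)
  moreover have "inj_on \<Theta> ?N"
    by (rule inj_on_subset [OF \<Theta>(2)]) (use M(1) in \<open>auto simp: highest_weight_space_def\<close>)
  ultimately show ?thesis by (simp only: ch_q_def dim_injective_image [OF \<Theta>(1)])
qed

theorem corollary5p2:
  fixes L :: "nat \<Rightarrow> nat \<Rightarrow> 'v::complex_vector rep"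
    and v :: "int \<Rightarrow> 'v"
    and i j k l :: nat
  assumes "k \<ge> 1" and "i \<in> {0, 1}" and "j \<le> k" and "l \<le> k + 1"
    and "is_L 0 1 (L 0 1)" and "is_L 1 1 (L 1 1)" and "is_L j k (L j k)"
    and "\<And>p. extremal (L (nat (p mod 2)) 1) (v p)"
    and "\<And>p. L (nat (p mod 2)) 1 (H 0) (v p) = - of_int p *\<^sub>C v p"
  shows "\<forall>s::int.
    (\<lambda>n. let m = one_power_tuple (k + 1) (2 * n + i - 1) j;
             \<rho> = fusion_limit_rep L m
         in ch_q \<rho> (highest_weight_space \<rho> (fusion_limit_space L v m) l) s)
    \<longlonglongrightarrow>
    (let \<rho> = tensor_rep [L i 1, L j k]
     in ch_q \<rho> (highest_weight_space \<rho> (tensor_power 2) l) s)"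
proof
  fix s :: int
  obtain z0 where z0: "irreducible_integrable (L 0 1) z0 0 1" using is_L_realization assms(5) by blast
  obtain z1 where z1: "irreducible_integrable (L 1 1) z1 1 1" using is_L_realization assms(6) by blast
  obtain w where w: "irreducible_integrable (L j k) w j k" using is_L_realization assms(7) by blast
  interpret P0: level_one "L 0 1" z0 0 by (rule level_one.intro [OF z0]) (simp add: level_one_axioms_def)
  interpret P1: level_one "L 1 1" z1 1 by (rule level_one.intro [OF z1]) (simp add: level_one_axioms_def)
  interpret W: irreducible_integrable "L j k" w j k by (rule w)
  obtain z where "level_one (L i 1) z i"
    using assms(2) P0.level_one_axioms P1.level_one_axioms by auto
  then interpret Q: level_one "L i 1" z i .

  \<comment> \<open>the given extremal vectors are nonzero multiples of members of the chains\<close>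
  obtain a0 where "a0 \<noteq> 0" "v 0 = a0 *\<^sub>C P0.chain 0"
  proof (rule P0.extremal_eq_chain [of "v 0" 0])
    show "extremal (L 0 1) (v 0)" using assms(8) [of 0] by simp
    show "L 0 1 (H 0) (v 0) = - of_nat 0 *\<^sub>C v 0" using assms(9) [of 0] by simp
  qed (use that in blast)
  then have a0: "a0 \<noteq> 0" "v 0 = a0 *\<^sub>C z0" by (simp_all only: P0.chain.simps simp_thms)
  obtain a1 where a1: "a1 \<noteq> 0" "v 1 = a1 *\<^sub>C P1.chain 1"
  proof (rule P1.extremal_eq_chain [of "v 1" 1])
    show "extremal (L 1 1) (v 1)" using assms(8) [of 1] by simp
    show "L 1 1 (H 0) (v 1) = - of_nat 1 *\<^sub>C v 1" using assms(9) [of 1] by simp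
  qed (use that in blast)
  have v1: "v 1 = L 1 1 (F 0) (a1 *\<^sub>C z1)"
    by (simp only: a1(2) P1.chain_1 [OF odd_one] P1.rep_simps)
  have v_chain: "\<exists>a. a \<noteq> 0 \<and> v (int (2 * n + i)) = a *\<^sub>C Q.chain (2 * n + i)" for n
  proof -
    have i: "nat (int (2 * n + i) mod 2) = i" using assms(2) by auto
    have "extremal (L i 1) (v (int (2 * n + i)))"
      using assms(8) [of "int (2 * n + i)"] unfolding i .
    moreover have "L i 1 (H 0) (v (int (2 * n + i))) = - of_nat (2 * n + i) *\<^sub>C v (int (2 * n + i))"
      using assms(9) [of "int (2 * n + i)"] unfolding i of_int_of_nat_eq .
    ultimately show ?thesis by (rule Q.extremal_eq_chain) blast
  qed
  then obtain a where a: "\<And>n. a n \<noteq> 0" "\<And>n. v (int (2 * n + i)) = a n *\<^sub>C Q.chain (2 * n + i)"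
    by metis

  define \<rho>s where "\<rho>s = replicate j (L 1 1) @ replicate (k - j) (L 0 1)"
  define zs where "zs = replicate j (v 1) @ replicate (k - j) (v 0)"
  have reps: "\<forall>\<rho>\<in>set \<rho>s. affine_sl2_rep \<rho>"
    using P0.affine_sl2_rep_axioms P1.affine_sl2_rep_axioms by (auto simp: \<rho>s_def)
  have len: "length \<rho>s = k" using assms(3) by (simp add: \<rho>s_def)
  obtain \<psi> u b where \<psi>: "clinear \<psi>" "inj \<psi>" "\<And>x y. \<psi> (L j k x y) = tensor_rep \<rho>s x (\<psi> y)"
    "\<And>y. \<psi> y \<in> tensor_power (length \<rho>s)"
    and u: "\<psi> u = pure zs" "b \<noteq> 0" "(L j k (E 0) ^^ j) u = b *\<^sub>C w"
    using level_one_realization [where L = L, OF assms(1,3)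
        integrable_highest_weight_scale [OF P0.integrable_highest_weight_axioms a0(1)]
        integrable_highest_weight_scale [OF P1.integrable_highest_weight_axioms a1(1)] w]
    unfolding \<rho>s_def [symmetric] v1 [symmetric] a0(2) [symmetric] zs_def [symmetric] len
    by metis

  let ?\<rho> = "tensor_rep [L i 1, L j k]" and ?\<sigma> = "tensor_rep (L i 1 # \<rho>s)"
  have reps2: "\<forall>\<rho>\<in>set [L i 1, L j k]. affine_sl2_rep \<rho>"
    using Q.affine_sl2_rep_axioms W.affine_sl2_rep_axioms by auto
  interpret R: affine_sl2_rep ?\<rho> by (rule affine_tensor_rep [OF reps2])
  have P: "submodule ?\<rho> (tensor_power 2)"
    using submodule_tensor_power [OF reps2] by (simp add: numeral_2_eq_2)
  obtain \<Theta> where \<Theta>: "clinear \<Theta>" "inj_on \<Theta> (tensor_power 2)"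
    "\<And>x y. \<Theta> (pure [x, y]) = cons_tensor x (\<psi> y)"
    "\<And>g t. t \<in> tensor_power 2 \<Longrightarrow> \<Theta> (?\<rho> g t) = ?\<sigma> g (\<Theta> t)"
    by (rule tensor_intertwiner [OF Q.affine_sl2_rep_axioms W.affine_sl2_rep_axioms reps \<psi>]) blast

  define M where "M n = generated_submodule ?\<rho> (pure [v (int (2 * n + i)), u])" for n
  have M: "complex_vector.subspace (M n)" "M n \<subseteq> tensor_power 2" for n
    unfolding M_def
    by (rule submodule_subspace [OF submodule_generated])
      (rule generated_submodule_minimal [OF P], simp add: pure_tensor_power)

  let ?N = "\<lambda>S. {t \<in> highest_weight_space ?\<rho> S l. ?\<rho> D t = of_int s *\<^sub>C t}"
  \<comment> \<open>a finite basis of the space of highest weight vectors lies in \<open>M n\<close> for all large \<open>n\<close>\<close>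
  have eventually_N: "\<exists>n0. \<forall>n\<ge>n0. ?N (tensor_power 2) \<subseteq> M n"
  proof -
    obtain B where B: "B \<subseteq> ?N (tensor_power 2)" "complex_vector.independent B"
      "?N (tensor_power 2) \<subseteq> complex_vector.span B"
      by (rule complex_vector.maximal_independent_subset)
    obtain C where C: "finite C"
      "{t \<in> tensor_power 2. ?\<rho> D t = of_int s *\<^sub>C t} \<subseteq> complex_vector.span C"
      using tensor_grade_finite [OF Q.irreducible_integrable_axioms w] by blast
    have "B \<subseteq> complex_vector.span C"
      using B(1) C(2) by (auto simp: highest_weight_space_def)
    with C(1) B(2) have fin: "finite B" using complex_vector.independent_span_bound by blast
    have "\<exists>n0. \<forall>n\<ge>n0. t \<in> M n" if "t \<in> B" for t
      unfolding M_def
      by (rule Q.tensor_exhaustion [OF w u(3,2) a]) (use that B(1) in \<open>auto simp: highest_weight_space_def\<close>)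
    then obtain N where N: "\<And>t n. t \<in> B \<Longrightarrow> n \<ge> N t \<Longrightarrow> t \<in> M n" by metis
    have "B \<subseteq> M n" if "n \<ge> Max (insert 0 (N ` B))" for n
      using that fin N by auto
    then have "?N (tensor_power 2) \<subseteq> M n" if "n \<ge> Max (insert 0 (N ` B))" for n
      using that B(3) complex_vector.span_minimal [OF _ M(1)] by blast
    then show ?thesis by blast
  qed
  then obtain n0 where n0: "\<And>n. n \<ge> n0 \<Longrightarrow> ?N (tensor_power 2) \<subseteq> M n" by blast

  \<comment> \<open>\<open>n \<ge> 1\<close> excludes the truncated subtraction \<open>2 * 0 + 0 - 1 = 0\<close>\<close>
  have stable: "(let m = one_power_tuple (k + 1) (2 * n + i - 1) j; \<rho> = fusion_limit_rep L m
      in ch_q \<rho> (highest_weight_space \<rho> (fusion_limit_space L v m) l) s)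
    = ch_q ?\<rho> (highest_weight_space ?\<rho> (tensor_power 2) l) s" if n: "n \<ge> max n0 1" for n
  proof -
    define m where "m = one_power_tuple (k + 1) (2 * n + i - 1) j"
    have tail: "tail_sums m = (2 * n + i) # replicate j 1 @ replicate (k - j) 0"
      using n unfolding m_def tail_sums_one_power_tuple [OF assms(3)] by simp
    have i: "i mod 2 = i" using assms(2) by auto
    have rep: "fusion_limit_rep L m = ?\<sigma>"
      unfolding fusion_limit_rep_def tail by (simp add: \<rho>s_def i)
    have "fusion_limit_space L v m = generated_submodule ?\<sigma> (pure (v (int (2 * n + i)) # zs))"
      unfolding fusion_limit_space_def rep tail by (simp add: zs_def)
    also have "pure (v (int (2 * n + i)) # zs) = \<Theta> (pure [v (int (2 * n + i)), u])"
      by (simp only: \<Theta>(3) u(1) cons_tensor_pure)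
    also have "generated_submodule ?\<sigma> \<dots> = \<Theta> ` M n"
      unfolding M_def
      by (rule generated_submodule_image [OF \<Theta>(1) P, symmetric])
        (simp add: pure_tensor_power, rule \<Theta>(4))
    finally have space: "fusion_limit_space L v m = \<Theta> ` M n" .
    have "?N (M n) = ?N (tensor_power 2)"
      using n0 [of n] n M(2) by (auto simp: highest_weight_space_def)
    then have "ch_q ?\<rho> (highest_weight_space ?\<rho> (M n) l) s
        = ch_q ?\<rho> (highest_weight_space ?\<rho> (tensor_power 2) l) s"
      by (simp only: ch_q_def)
    moreover have "ch_q ?\<sigma> (highest_weight_space ?\<sigma> (\<Theta> ` M n) l) s
        = ch_q ?\<rho> (highest_weight_space ?\<rho> (M n) l) s"
      by (rule ch_q_highest_weight_space_image [OF \<Theta>(1,2) P _ R.clinear_rep M(2,1)]) (rule \<Theta>(4))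
    ultimately show ?thesis
      unfolding Let_def m_def [symmetric] rep space by (simp only:)
  qed
  show "(\<lambda>n. let m = one_power_tuple (k + 1) (2 * n + i - 1) j; \<rho> = fusion_limit_rep L m
      in ch_q \<rho> (highest_weight_space \<rho> (fusion_limit_space L v m) l) s)
    \<longlonglongrightarrow> (let \<rho> = tensor_rep [L i 1, L j k]
      in ch_q \<rho> (highest_weight_space \<rho> (tensor_power 2) l) s)"
    unfolding Let_def [of "tensor_rep [L i 1, L j k]"]
    by (rule tendsto_eventually, rule eventually_sequentiallyI) (rule stable)
qed

end
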